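(* Let $(A,\alpha)\equiv(X,\sigma)$ and $(C,\gamma)\equiv(Y,\rho)$ be multivariable classical systems on compact Hausdorff spaces $X$ and $Y$. Suppose that they are piecewise conjugate, with multiplicity $d$, by the homeomorphism $\phi:X\to Y$ and let $\widehat{\phi}:C\to A$, $\widehat{\phi}(f)=f\circ\phi$, be the induced $*$-isomorphism. (1) If $\beta>\log d$, then the affine weak*-homeomorphism $S(A)\to S(C):\tau\mapsto\tau\widehat{\phi}$ lifts to an affine weak*-homeomorphism between the $(\sigma,\beta)$-KMS states on $\mathcal{T}(A,\alpha)$ and on $\mathcal{T}(C,\gamma)$. In particular, if $\tau\mapsto\psi_\tau$ is the parametrization of the $(\sigma,\beta)$-KMS states on $\mathcal{T}(A,\alpha)$ by the (tracial) states of $A$ (respectively on $\mathcal{T}(C,\gamma)$ by those of $C$) given in the context, then the lifted homeomorphism is $\psi_\tau\mapsto\psi_{\tau\widehat{\phi}}$ and $$\psi_{\tau\widehat{\phi}}(V_\mu cV_\nu^* )=\psi_\tau(V_\mu\widehat{\phi}(c)V_\nu^* )\quad\text{for all }c\in C\text{ and }\mu,\nu\in\mathbb{F}_+^d.$$ (2) If $\beta>\log d$, the same holds for the parametrization $\tau\mapsto\varphi_\tau$, given in the context, of the $(\sigma,\beta)$-KMS states on $\mathcal{O}(A,\alpha)$ and on $\mathcal{O}(C,\gamma)$: the map $\tau\mapsto\tau\widehat{\phi}$ from the states of $A$ vanishing on $J_{(A,\alpha)}$ onto the states of $C$ vanishing on $J_{(C,\gamma)}$ lifts to an affine weak*-homeomorphism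 $\varphi_\tau\mapsto\varphi_{\tau\widehat{\phi}}$ between the $(\sigma,\beta)$-KMS states on $\mathcal{O}(A,\alpha)$ and on $\mathcal{O}(C,\gamma)$, with $\varphi_{\tau\widehat{\phi}}(S_\mu cS_\nu^* )=\varphi_\tau(S_\mu\widehat{\phi}(c)S_\nu^* )$ for all $c\in C$ and $\mu,\nu\in\mathbb{F}_+^d$. (3) If $\beta=\log d>0$ and the systems are injective, the same holds for the parametrization $\tau\mapsto\psi_\tau$, given in the context, of the $(\sigma,\log d)$-KMS states on the Cuntz-Pimsner algebras by $AVT(A,\alpha)$ and $AVT(C,\gamma)$: the map $\tau\mapsto\tau\widehat{\phi}$ from $AVT(A,\alpha)$ onto $AVT(C,\gamma)$ lifts to an affine weak*-homeomorphism $\psi_\tau\mapsto\psi_{\tau\widehat{\phi}}$ between the $(\sigma,\log d)$-KMS states on $\mathcal{O}(A,\alpha)$ and on $\mathcal{O}(C,\gamma)$, with $\psi_{\tau\widehat{\phi}}(S_\mu cS_\nu^* )=\psi_\tau(S_\mu\widehat{\phi}(c)S_\nu^* )$ for all $c\in C$ and $\mu,\nu\in\mathbb{F}_+^d$.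
   Context: A multivariable classical system $(X,\sigma)$ of multiplicity $d$ ($1\le d<\infty$) on a compact Hausdorff space $X$ consists of continuous maps $\sigma_1,\dots,\sigma_d:X\to X$. It is identified with the unital C*-dynamical system $(A,\alpha)$, $A=C(X)$, $\alpha_i(f)=f\circ\sigma_i$; similarly $(Y,\rho)$ is identified with $(C,\gamma)$, $C=C(Y)$, $\gamma_i(f)=f\circ\rho_i$. $(X,\sigma)$ and $(Y,\rho)$ are piecewise conjugate by a homeomorphism $\phi:X\to Y$ if they have the same multiplicity $d$ and for every $x\in X$ there is a neighborhood $\mathcal{U}$ of $x$ and a permutation $\pi$ on $d$ symbols with $\rho_i\phi|_{\mathcal{U}}=\phi\sigma_{\pi(i)}|_{\mathcal{U}}$ for all $i=1,\dots,d$. $\mathbb{F}_+^d$ is the free semigroup (monoid) of words on $d$ symbols, $|\mu|$ is the length of $\mu$. For $w=i_m\cdots i_1$ write $\alpha_w=\alpha_{i_m}\circ\cdots\circ\alpha_{i_1}$ (identity for the empty word) and $\overline{w}=i_1\cdots i_m$. $J_{(A,\alpha)}:=(\bigcap_{i=1}^d\ker\alpha_i)^\perp$, where $I^\perp=\{a\in A:ab=0\text{ for all }b\in I\}$; the system is injective if $\bigcap_i\ker\alpha_i=(0)$. $S(A)$ is the state space of $A$ (all states are tracial as $A$ is commutative). $AVT(A,\alpha)$ is the set of $\tau\in S(A)$ with $\tau=\frac1d\sum_{i=1}^d\tau\alpha_i$. $\mathcal{T}(A,\alpha)$ is the universal C*-algebra generated by $A$ and $V_1,\dots,V_d$ with $V_i^*V_j=\delta_{i,j}1$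 and $aV_i=V_i\alpha_i(a)$ for all $a\in A$. $\mathcal{O}(A,\alpha)$ is its quotient by the ideal generated by $a(1-\sum_iV_iV_i^* )$, $a\in J_{(A,\alpha)}$, and $S_i$ is the image of $V_i$; $A$ embeds isometrically in both, and the unit of $A$ is the unit of both. For $\mu=\mu_n\cdots\mu_1$, $V_\mu=V_{\mu_n}\cdots V_{\mu_1}$ and $S_\mu=S_{\mu_n}\cdots S_{\mu_1}$. The gauge action of $z\in\mathbb{T}$ fixes $A$ and multiplies each $V_i$ (resp. $S_i$) by $z$; the action of $\mathbb{R}$ (denoted $\sigma$ in "$(\sigma,\beta)$-KMS", not to be confused with the maps $\sigma_i$) is the gauge action at $z=e^{it}$. The same notation is used for $(C,\gamma)$. A state $\psi$ is a $(\sigma,\beta)$-KMS state if $\psi(xy)=\psi(y\sigma_{i\beta}(x))$ for all $x,y$ in a norm-dense $\sigma$-invariant $*$-subalgebra of analytic elements. Parametrizations (known for every unital system $(A,\alpha)$ of multiplicity $d$, $A$ commutative here): (a) For $\beta>\log d$, $\tau\mapsto\psi_\tau$ is an affine weak*-homeomorphism from the tracial states of $A$ onto the $(\sigma,\beta)$-KMS states of $\mathcal{T}(A,\alpha)$, where $\psi_\tau(V_\mu aV_\nu^* )=\delta_{\mu,\nu}(1-e^{-\beta}d)\sum_{m=0}^\infty e^{-(m+|\mu|)\beta}\sum_{|w|=m}\tau\alpha_{\overline{w}}(a)$. (b) For $\beta>\log d$, $\tau\mapsto\varphi_\tau$ is an affine weak*-homeomorphism from the tracial states of $A$ vanishing on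 $J_{(A,\alpha)}$ onto the $(\sigma,\beta)$-KMS states of $\mathcal{O}(A,\alpha)$, where $\varphi_\tau(S_\mu aS_\nu^* )$ is given by the same formula. (c) If $d>1$ and $(A,\alpha)$ is injective, $\tau\mapsto\psi_\tau$ is an affine weak*-homeomorphism from $AVT(A,\alpha)$ onto the $(\sigma,\log d)$-KMS states of $\mathcal{O}(A,\alpha)$, where $\psi_\tau(S_\mu aS_\nu^* )=\delta_{\mu,\nu}d^{-|\mu|}\tau(a)$. *)

theory Defs
  imports "HOL-Analysis.Analysis" "HOL-Library.Poly_Mapping"
begin

section \<open>Unital C*-algebras\<close>

class cstar_algebra = banach + real_normed_algebra_1 +
  fixes cscale :: "complex \<Rightarrow> 'a \<Rightarrow> 'a" (infixr "*\<^sub>C" 75)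
    and star :: "'a \<Rightarrow> 'a"
  assumes cscale_of_real: "complex_of_real r *\<^sub>C x = r *\<^sub>R x"
    and cscale_add_left: "(b + c) *\<^sub>C x = b *\<^sub>C x + c *\<^sub>C x"
    and cscale_add_right: "c *\<^sub>C (x + y) = c *\<^sub>C x + c *\<^sub>C y"
    and cscale_cscale: "b *\<^sub>C c *\<^sub>C x = (b * c) *\<^sub>C x"
    and norm_cscale: "norm (c *\<^sub>C x) = cmod c * norm x"
    and cscale_mult_left: "(c *\<^sub>C x) * y = c *\<^sub>C (x * y)"
    and cscale_mult_right: "x * (c *\<^sub>C y) = c *\<^sub>C (x * y)"
    and star_star: "star (star x) = x"
    and star_add: "star (x + y) = star x + star y"
    and star_cscale: "star (c *\<^sub>C x) = cnj c *\<^sub>C star x"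
    and star_mult: "star (x * y) = star y * star x"
    and cstar_identity: "norm (star x * x) = (norm x)\<^sup>2"

instantiation complex :: cstar_algebra
begin

definition cscale_complex :: "complex \<Rightarrow> complex \<Rightarrow> complex" where "cscale_complex = (*)"
definition star_complex :: "complex \<Rightarrow> complex" where "star_complex = cnj"

instance
  by standard
    (auto simp: cscale_complex_def star_complex_def scaleR_conv_of_real algebra_simps
      norm_mult power2_eq_square)

end

text \<open>
  For a compact Hausdorff space \<open>X\<close>, given as a type, \<open>C(X)\<close> is the library type of bounded
  continuous functions \<open>X \<Rightarrow>\<^sub>C complex\<close> with the pointwise operations and the supremum norm.
\<close>

instance bcontfun :: (topological_space, complete_space) complete_space
proof
  fix f :: "nat \<Rightarrow> 'a \<Rightarrow>\<^sub>C 'b"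
  assume "Cauchy f"
  then obtain g where "uniform_limit UNIV f g sequentially"
    using uniformly_convergent_eq_cauchy[of "\<lambda>_. True" f]
    unfolding Cauchy_def uniform_limit_sequentially_iff
    by (metis dist_fun_lt_imp_dist_val_lt)
  from uniform_limit_bcontfunE[OF this sequentially_bot]
  obtain l' where "g = apply_bcontfun l'" "(f \<longlonglongrightarrow> l')" by metis
  then show "convergent f"
    by (intro convergentI)
qed

instance bcontfun :: (topological_space, banach) banach ..

instantiation bcontfun :: (topological_space, real_normed_algebra_1) real_normed_algebra_1
begin

definition times_bcontfun :: "'a \<Rightarrow>\<^sub>C 'b \<Rightarrow> 'a \<Rightarrow>\<^sub>C 'b \<Rightarrow> 'a \<Rightarrow>\<^sub>C 'b" where
  "f * g = Bcontfun (\<lambda>x. apply_bcontfun f x * apply_bcontfun g x)"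
definition one_bcontfun :: "'a \<Rightarrow>\<^sub>C 'b" where "1 = const_bcontfun 1"

lemma apply_bcontfun_times [simp]:
  "apply_bcontfun (f * g) x = apply_bcontfun f x * apply_bcontfun g x"
proof -
  have "(\<lambda>x. apply_bcontfun f x * apply_bcontfun g x) \<in> bcontfun"
    by (rule bcontfun_normI[where b = "norm f * norm g"])
      (auto intro!: continuous_intros order_trans[OF norm_mult_ineq] mult_mono norm_bounded)
  then show ?thesis
    by (simp add: times_bcontfun_def Bcontfun_inverse)
qed

lemma apply_bcontfun_one [simp]: "apply_bcontfun 1 x = 1"
  by (simp add: one_bcontfun_def)

instance
proof
  fix f g h :: "'a \<Rightarrow>\<^sub>C 'b" and r :: real
  show "norm (f * g) \<le> norm f * norm g"
    by (rule norm_bound)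
      (auto intro!: order_trans[OF norm_mult_ineq] mult_mono norm_bounded)
  show "norm (1 :: 'a \<Rightarrow>\<^sub>C 'b) = 1"
  proof (rule antisym)
    show "norm (1 :: 'a \<Rightarrow>\<^sub>C 'b) \<le> 1"
      by (rule norm_bound) simp
    show "1 \<le> norm (1 :: 'a \<Rightarrow>\<^sub>C 'b)"
      using norm_bounded[of "1 :: 'a \<Rightarrow>\<^sub>C 'b" undefined] by simp
  qed
  have "apply_bcontfun (0 :: 'a \<Rightarrow>\<^sub>C 'b) undefined \<noteq> apply_bcontfun (1 :: 'a \<Rightarrow>\<^sub>C 'b) undefined"
    by simp
  then show "(0 :: 'a \<Rightarrow>\<^sub>C 'b) \<noteq> 1"
    by metis
qed (auto intro!: bcontfun_eqI simp: algebra_simps)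

end

instantiation bcontfun :: (topological_space, cstar_algebra) cstar_algebra
begin

definition cscale_bcontfun :: "complex \<Rightarrow> 'a \<Rightarrow>\<^sub>C 'b \<Rightarrow> 'a \<Rightarrow>\<^sub>C 'b" where
  "c *\<^sub>C f = Bcontfun (\<lambda>x. c *\<^sub>C apply_bcontfun f x)"
definition star_bcontfun :: "'a \<Rightarrow>\<^sub>C 'b \<Rightarrow> 'a \<Rightarrow>\<^sub>C 'b" where
  "star f = Bcontfun (\<lambda>x. star (apply_bcontfun f x))"

lemma norm_star_aux: "norm (star y) = norm y" for y :: 'b
proof -
  have *: "norm z \<le> norm (star z)" for z :: 'b
  proof (cases "z = 0")
    case False
    have "norm z * norm z \<le> norm (star z) * norm z"
      using norm_mult_ineq[of "star z" z] cstar_identity[of z] by (simp add: power2_eq_square)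
    then show ?thesis
      using False by simp
  qed auto
  show ?thesis
    using *[of y] *[of "star y"] by (simp add: star_star)
qed

lemma bounded_linear_star_aux: "bounded_linear (star :: 'b \<Rightarrow> 'b)"
proof (rule bounded_linear_intro[where K = 1])
  show "star (r *\<^sub>R x) = r *\<^sub>R star x" for r and x :: 'b
    by (metis cscale_of_real star_cscale complex_cnj_complex_of_real)
qed (auto simp: star_add norm_star_aux)

lemma bounded_linear_cscale_aux: "bounded_linear (cscale c :: 'b \<Rightarrow> 'b)"
proof (rule bounded_linear_intro[where K = "cmod c"])
  show "c *\<^sub>C (r *\<^sub>R x) = r *\<^sub>R (c *\<^sub>C x)" for r and x :: 'b
    by (metis cscale_cscale cscale_of_real mult.commute)
qed (auto simp: cscale_add_right norm_cscale)

lemma apply_bcontfun_cscale [simp]: "apply_bcontfun (c *\<^sub>C f) x = c *\<^sub>C apply_bcontfun f x"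
proof -
  have "(\<lambda>x. c *\<^sub>C apply_bcontfun f x) \<in> bcontfun"
    by (rule bcontfun_normI[where b = "cmod c * norm f"])
      (auto intro!: bounded_linear.continuous_on[OF bounded_linear_cscale_aux] mult_left_mono
        norm_bounded simp: norm_cscale)
  then show ?thesis
    by (simp add: cscale_bcontfun_def Bcontfun_inverse)
qed

lemma apply_bcontfun_star [simp]: "apply_bcontfun (star f) x = star (apply_bcontfun f x)"
proof -
  have "(\<lambda>x. star (apply_bcontfun f x)) \<in> bcontfun"
    by (rule bcontfun_normI[where b = "norm f"])
      (auto intro!: bounded_linear.continuous_on[OF bounded_linear_star_aux]
        norm_bounded simp: norm_star_aux)
  then show ?thesis
    by (simp add: star_bcontfun_def Bcontfun_inverse)
qed

instance
proof
  fix f g :: "'a \<Rightarrow>\<^sub>C 'b" and b c :: complex and r :: real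
  show "norm (c *\<^sub>C f) = cmod c * norm f"
  proof (rule antisym)
    show le: "norm (c *\<^sub>C f) \<le> cmod c * norm f" for c and f :: "'a \<Rightarrow>\<^sub>C 'b"
      by (rule norm_bound) (auto simp: norm_cscale intro!: mult_left_mono norm_bounded)
    show "cmod c * norm f \<le> norm (c *\<^sub>C f)"
    proof (cases "c = 0")
      case False
      have one: "1 *\<^sub>C y = y" for y :: 'b
        using cscale_of_real[of 1 y] by simp
      have "f = inverse c *\<^sub>C c *\<^sub>C f"
        using False by (auto intro!: bcontfun_eqI simp: cscale_cscale one)
      then have "norm f \<le> inverse (cmod c) * norm (c *\<^sub>C f)"
        by (metis le norm_inverse)
      then show ?thesis
        using False by (simp add: field_simps)
    qed auto
  qed
  show "norm (star f * f) = (norm f)\<^sup>2"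
  proof (rule antisym)
    show "norm (star f * f) \<le> (norm f)\<^sup>2"
      by (rule norm_bound) (auto simp: cstar_identity intro!: power_mono norm_bounded)
    have "norm (apply_bcontfun f x) \<le> sqrt (norm (star f * f))" for x
      using norm_bounded[of "star f * f" x]
      by (auto simp: cstar_identity intro: real_le_rsqrt)
    then have "norm f \<le> sqrt (norm (star f * f))"
      by (rule norm_bound)
    then show "(norm f)\<^sup>2 \<le> norm (star f * f)"
      using power_mono[of "norm f" "sqrt (norm (star f * f))" 2] by simp
  qed
qed (auto intro!: bcontfun_eqI simp: cscale_of_real cscale_add_left cscale_add_right
    cscale_cscale cscale_mult_left cscale_mult_right star_star star_add star_cscale star_mult)

end

text \<open>
  Boundedness of a unital *-homomorphism between C*-algebras is automatic and is
  listed only for convenience.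
\<close>

definition star_hom :: "('a::cstar_algebra \<Rightarrow> 'b::cstar_algebra) \<Rightarrow> bool" where
  "star_hom f \<longleftrightarrow> bounded_linear f \<and> f 1 = 1 \<and> (\<forall>c x. f (c *\<^sub>C x) = c *\<^sub>C f x) \<and>
     (\<forall>x y. f (x * y) = f x * f y) \<and> (\<forall>x. f (star x) = star (f x))"

definition states :: "('a::cstar_algebra \<Rightarrow> complex) set" where
  "states = {\<psi>. bounded_linear \<psi> \<and> (\<forall>c x. \<psi> (c *\<^sub>C x) = c * \<psi> x) \<and>
     (\<forall>x. \<psi> (star x * x) \<in> \<real>\<^sub>\<ge>\<^sub>0) \<and> \<psi> 1 = 1}"

text \<open>
  The library topology on a function type is the product topology, that is, pointwise
  convergence; on sets of states the induced topology is therefore the weak* topology.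
\<close>

definition affine_weak_star_homeomorphism ::
    "('a \<Rightarrow> complex) set \<Rightarrow> ('b \<Rightarrow> complex) set \<Rightarrow> (('a \<Rightarrow> complex) \<Rightarrow> 'b \<Rightarrow> complex) \<Rightarrow> bool" where
  "affine_weak_star_homeomorphism S T f \<longleftrightarrow> (\<exists>g. homeomorphism S T f g) \<and>
     (\<forall>\<psi>\<in>S. \<forall>\<omega>\<in>S. \<forall>t\<in>{0..1::real}.
        f (\<lambda>x. of_real t * \<psi> x + of_real (1 - t) * \<omega> x) =
          (\<lambda>y. of_real t * f \<psi> y + of_real (1 - t) * f \<omega> y))"

definition closed_ideal :: "'a::cstar_algebra set \<Rightarrow> bool" where
  "closed_ideal I \<longleftrightarrow> closed I \<and> 0 \<in> I \<and> (\<forall>x\<in>I. \<forall>y\<in>I. x + y \<in> I) \<and>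
     (\<forall>x\<in>I. \<forall>a. a * x \<in> I \<and> x * a \<in> I)"

definition closed_ideal_generated :: "'a::cstar_algebra set \<Rightarrow> 'a set" where
  "closed_ideal_generated G = \<Inter>{I. closed_ideal I \<and> G \<subseteq> I}"

text \<open>The target of \<open>q\<close> is the quotient by the closed ideal \<open>I\<close>, with its quotient norm.\<close>

definition is_quotient_map ::
    "'a::cstar_algebra set \<Rightarrow> ('a \<Rightarrow> 'b::cstar_algebra) \<Rightarrow> bool" where
  "is_quotient_map I q \<longleftrightarrow> star_hom q \<and> surj q \<and> (\<forall>x. norm (q x) = infdist x I)"


section \<open>Universal C*-algebras\<close>

text \<open>
  The free unital complex *-algebra on \<open>'g\<close> is the monoid algebra of the free monoid on the
  letters \<open>g\<close> and \<open>g*\<close>. Poly_Mapping multiplies by convolution over an additively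
  written monoid, so concatenation of monomials is written \<open>+\<close>.
\<close>

datatype 'g letter = Gen 'g | Gen_star 'g
datatype 'g monomial = Monomial (letters: "'g letter list")

instantiation monomial :: (type) monoid_add
begin
definition zero_monomial :: "'a monomial" where "0 = Monomial []"
definition plus_monomial :: "'a monomial \<Rightarrow> 'a monomial \<Rightarrow> 'a monomial" where
  "m + n = Monomial (letters m @ letters n)"
instance
  by standard (auto simp: zero_monomial_def plus_monomial_def)
end

type_synonym 'g star_poly = "'g monomial \<Rightarrow>\<^sub>0 complex"

definition gen :: "'g \<Rightarrow> 'g star_poly" where
  "gen g = Poly_Mapping.single (Monomial [Gen g]) 1"

definition poly_scale :: "complex \<Rightarrow> 'g star_poly \<Rightarrow> 'g star_poly" where
  "poly_scale c p = Poly_Mapping.single 0 c * p"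

fun letter_star :: "'g letter \<Rightarrow> 'g letter" where
  "letter_star (Gen g) = Gen_star g"
| "letter_star (Gen_star g) = Gen g"

definition monomial_star :: "'g monomial \<Rightarrow> 'g monomial" where
  "monomial_star m = Monomial (rev (map letter_star (letters m)))"

definition poly_star :: "'g star_poly \<Rightarrow> 'g star_poly" where
  "poly_star p =
     (\<Sum>m\<in>Poly_Mapping.keys p. Poly_Mapping.single (monomial_star m) (cnj (Poly_Mapping.lookup p m)))"

fun eval_letter :: "('g \<Rightarrow> 'a::cstar_algebra) \<Rightarrow> 'g letter \<Rightarrow> 'a" where
  "eval_letter \<theta> (Gen g) = \<theta> g"
| "eval_letter \<theta> (Gen_star g) = star (\<theta> g)"

definition eval_poly :: "('g \<Rightarrow> 'a::cstar_algebra) \<Rightarrow> 'g star_poly \<Rightarrow> 'a" where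
  "eval_poly \<theta> p =
     (\<Sum>m\<in>Poly_Mapping.keys p.
        Poly_Mapping.lookup p m *\<^sub>C prod_list (map (eval_letter \<theta>) (letters m)))"

definition cstar_seminorm :: "('g star_poly \<Rightarrow> real) \<Rightarrow> bool" where
  "cstar_seminorm p \<longleftrightarrow>
     (\<forall>x y. p (x + y) \<le> p x + p y) \<and> (\<forall>c x. p (poly_scale c x) = cmod c * p x) \<and>
     (\<forall>x y. p (x * y) \<le> p x * p y) \<and> (\<forall>x. p (poly_star x * x) = (p x)\<^sup>2)"

text \<open>
  The universal C*-algebra on generators \<open>'g\<close> with relations \<open>r = 0\<close>, \<open>r \<in> R\<close>, is the
  separated completion of the free *-algebra in the largest C*-seminorm that vanishes on \<open>R\<close>.
  A C*-algebra together with the images \<open>\<theta> g\<close> of the generators is a model of it iff the relations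
  hold, the generators generate, and every such C*-seminorm is dominated by the norm. The
  C*-seminorms vanishing on \<open>R\<close> are the norms \<open>x \<mapsto> norm (\<pi> x)\<close> for the representations \<open>\<pi>\<close> of
  the relations in arbitrary C*-algebras, so no quantification over types is needed.
\<close>

definition universal_cstar_algebra ::
    "'g star_poly set \<Rightarrow> ('g \<Rightarrow> 'a::cstar_algebra) \<Rightarrow> bool" where
  "universal_cstar_algebra R \<theta> \<longleftrightarrow>
     (\<forall>r\<in>R. eval_poly \<theta> r = 0) \<and> closure (range (eval_poly \<theta>)) = UNIV \<and>
     (\<forall>p. cstar_seminorm p \<and> (\<forall>r\<in>R. p r = 0) \<longrightarrow> (\<forall>x. p x \<le> norm (eval_poly \<theta> x)))"


section \<open>C*-dynamical systems and their operator algebras\<close>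

text \<open>
  A system of multiplicity \<open>d\<close> is a family indexed by a finite type \<open>'n\<close> with \<open>d = CARD('n)\<close>.
  A word \<open>i\<^sub>m \<dots> i\<^sub>1\<close> is the list \<open>[i\<^sub>m, \<dots>, i\<^sub>1]\<close>; its reversal is \<open>rev\<close>.
\<close>

definition word_map :: "('n \<Rightarrow> 'a \<Rightarrow> 'a) \<Rightarrow> 'n list \<Rightarrow> 'a \<Rightarrow> 'a" where
  "word_map \<alpha> w = foldr (\<circ>) (map \<alpha> w) id"

definition word_prod :: "('n \<Rightarrow> 'a::monoid_mult) \<Rightarrow> 'n list \<Rightarrow> 'a" where
  "word_prod V w = prod_list (map V w)"

definition J_ideal :: "('n \<Rightarrow> 'a::cstar_algebra \<Rightarrow> 'a) \<Rightarrow> 'a set" where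
  "J_ideal \<alpha> = {a. \<forall>b\<in>(\<Inter>i. {b. \<alpha> i b = 0}). a * b = 0}"

definition injective_system :: "('n \<Rightarrow> 'a::cstar_algebra \<Rightarrow> 'a) \<Rightarrow> bool" where
  "injective_system \<alpha> \<longleftrightarrow> (\<Inter>i. {b. \<alpha> i b = 0}) = {0}"

definition AVT :: "('n::finite \<Rightarrow> 'a::cstar_algebra \<Rightarrow> 'a) \<Rightarrow> ('a \<Rightarrow> complex) set" where
  "AVT \<alpha> = {\<tau>\<in>states. \<forall>a. \<tau> a = (1 / of_nat CARD('n)) * (\<Sum>i\<in>UNIV. \<tau> (\<alpha> i a))}"

text \<open>The first five families of relations make the copy of the coefficient algebra a *-homomorphic image.\<close>

definition toeplitz_relations ::
    "('n \<Rightarrow> 'a::cstar_algebra \<Rightarrow> 'a) \<Rightarrow> ('a + 'n) star_poly set" where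
  "toeplitz_relations \<alpha> = (let A = (\<lambda>a. gen (Inl a)); V = (\<lambda>i. gen (Inr i)) in
     {A (a + b) - (A a + A b) | a b. True} \<union>
     {A (c *\<^sub>C a) - poly_scale c (A a) | c a. True} \<union>
     {A (a * b) - A a * A b | a b. True} \<union>
     {A (star a) - poly_star (A a) | a. True} \<union>
     {A 1 - 1} \<union>
     {poly_star (V i) * V j - (if i = j then 1 else 0) | i j. True} \<union>
     {A a * V i - V i * A (\<alpha> i a) | a i. True})"

text \<open>\<open>\<iota>\<close> and \<open>V\<close> exhibit the type \<open>'t\<close> as the Toeplitz algebra of \<open>\<alpha>\<close>.\<close>

definition toeplitz_algebra ::
    "('n \<Rightarrow> 'a::cstar_algebra \<Rightarrow> 'a) \<Rightarrow> ('a \<Rightarrow> 't::cstar_algebra) \<Rightarrow> ('n \<Rightarrow> 't) \<Rightarrow> bool" where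
  "toeplitz_algebra \<alpha> \<iota> V \<longleftrightarrow> universal_cstar_algebra (toeplitz_relations \<alpha>) (case_sum \<iota> V)"

text \<open>\<open>q\<close> exhibits the type \<open>'o\<close> as the Cuntz-Pimsner quotient of the Toeplitz algebra \<open>'t\<close>.\<close>

definition cuntz_pimsner_quotient ::
    "('n::finite \<Rightarrow> 'a::cstar_algebra \<Rightarrow> 'a) \<Rightarrow> ('a \<Rightarrow> 't::cstar_algebra) \<Rightarrow> ('n \<Rightarrow> 't) \<Rightarrow>
      ('t \<Rightarrow> 'o::cstar_algebra) \<Rightarrow> bool" where
  "cuntz_pimsner_quotient \<alpha> \<iota> V q \<longleftrightarrow>
     is_quotient_map
       (closed_ideal_generated {\<iota> a * (1 - (\<Sum>i\<in>UNIV. V i * star (V i))) | a. a \<in> J_ideal \<alpha>}) q"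

definition gauge_action ::
    "('a::cstar_algebra \<Rightarrow> 'b::cstar_algebra) \<Rightarrow> ('n \<Rightarrow> 'b) \<Rightarrow> complex \<Rightarrow> 'b \<Rightarrow> 'b" where
  "gauge_action \<iota> V z =
     (THE g. star_hom g \<and> (\<forall>a. g (\<iota> a) = \<iota> a) \<and> (\<forall>i. g (V i) = z *\<^sub>C V i))"

definition gauge_flow ::
    "('a::cstar_algebra \<Rightarrow> 'b::cstar_algebra) \<Rightarrow> ('n \<Rightarrow> 'b) \<Rightarrow> real \<Rightarrow> 'b \<Rightarrow> 'b" where
  "gauge_flow \<iota> V t = gauge_action \<iota> V (cis t)"


section \<open>KMS states\<close>

text \<open>\<open>F\<close> is the entire extension \<open>z \<mapsto> \<sigma>\<^sub>z(x)\<close> of the orbit \<open>t \<mapsto> \<sigma>\<^sub>t(x)\<close>.\<close>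

definition entire_extension ::
    "(real \<Rightarrow> 'b::cstar_algebra \<Rightarrow> 'b) \<Rightarrow> 'b \<Rightarrow> (complex \<Rightarrow> 'b) \<Rightarrow> bool" where
  "entire_extension \<sigma> x F \<longleftrightarrow>
     (\<forall>z. \<exists>D. ((\<lambda>h. inverse h *\<^sub>C (F (z + h) - F z)) \<longlongrightarrow> D) (at 0)) \<and>
     (\<forall>t. F (of_real t) = \<sigma> t x)"

definition star_subalgebra :: "'b::cstar_algebra set \<Rightarrow> bool" where
  "star_subalgebra D \<longleftrightarrow> 0 \<in> D \<and> (\<forall>x\<in>D. \<forall>y\<in>D. x + y \<in> D \<and> x * y \<in> D) \<and>
     (\<forall>x\<in>D. star x \<in> D \<and> (\<forall>c. c *\<^sub>C x \<in> D))"

definition kms_states ::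
    "(real \<Rightarrow> 'b::cstar_algebra \<Rightarrow> 'b) \<Rightarrow> real \<Rightarrow> ('b \<Rightarrow> complex) set" where
  "kms_states \<sigma> \<beta> = {\<psi>\<in>states. \<exists>D. star_subalgebra D \<and> closure D = UNIV \<and>
     (\<forall>t. \<forall>x\<in>D. \<sigma> t x \<in> D) \<and> (\<forall>x\<in>D. \<exists>F. entire_extension \<sigma> x F) \<and>
     (\<forall>x\<in>D. \<forall>y\<in>D. \<forall>F. entire_extension \<sigma> x F \<longrightarrow> \<psi> (x * y) = \<psi> (y * F (\<i> * of_real \<beta>)))}"

text \<open>The KMS state with prescribed values \<open>v \<mu> \<nu> a\<close> on the elements \<open>V\<^sub>\<mu> a V\<^sub>\<nu>*\<close>.\<close>

definition kms_state_with_values ::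
    "('a::cstar_algebra \<Rightarrow> 'b::cstar_algebra) \<Rightarrow> ('n \<Rightarrow> 'b) \<Rightarrow> real \<Rightarrow>
      ('n list \<Rightarrow> 'n list \<Rightarrow> 'a \<Rightarrow> complex) \<Rightarrow> 'b \<Rightarrow> complex" where
  "kms_state_with_values \<iota> V \<beta> v =
     (THE \<psi>. \<psi> \<in> kms_states (gauge_flow \<iota> V) \<beta> \<and>
        (\<forall>\<mu> \<nu> a. \<psi> (word_prod V \<mu> * \<iota> a * star (word_prod V \<nu>)) = v \<mu> \<nu> a))"

text \<open>
  The parametrization for \<open>\<beta> > log d\<close>; it serves the Toeplitz algebra (with its generators
  \<open>\<iota>\<close>, \<open>V\<close>) and the Cuntz-Pimsner algebra (with the images of these generators) alike.
\<close>

definition kms_of_state ::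
    "('n::finite \<Rightarrow> 'a::cstar_algebra \<Rightarrow> 'a) \<Rightarrow> ('a \<Rightarrow> 'b::cstar_algebra) \<Rightarrow> ('n \<Rightarrow> 'b) \<Rightarrow> real \<Rightarrow>
      ('a \<Rightarrow> complex) \<Rightarrow> 'b \<Rightarrow> complex" where
  "kms_of_state \<alpha> \<iota> V \<beta> \<tau> = kms_state_with_values \<iota> V \<beta>
     (\<lambda>\<mu> \<nu> a. if \<mu> = \<nu> then
        of_real (1 - exp (- \<beta>) * real CARD('n)) *
        suminf (\<lambda>m. of_real (exp (- (real (m + length \<mu>) * \<beta>))) *
           (\<Sum>w | length w = m. \<tau> (word_map \<alpha> (rev w) a)))
      else 0)"

text \<open>The parametrization at \<open>\<beta> = log d\<close>.\<close>

definition critical_kms_of_state ::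
    "('n::finite \<Rightarrow> 'a::cstar_algebra \<Rightarrow> 'a) \<Rightarrow> ('a \<Rightarrow> 'b::cstar_algebra) \<Rightarrow> ('n \<Rightarrow> 'b) \<Rightarrow>
      ('a \<Rightarrow> complex) \<Rightarrow> 'b \<Rightarrow> complex" where
  "critical_kms_of_state \<alpha> \<iota> V \<tau> = kms_state_with_values \<iota> V (ln (real CARD('n)))
     (\<lambda>\<mu> \<nu> a. if \<mu> = \<nu> then \<tau> a / of_nat (CARD('n) ^ length \<mu>) else 0)"

text \<open>
  \<open>\<Phi> : K \<rightarrow> K'\<close> lifts \<open>f : S \<rightarrow> S'\<close> along the parametrizations \<open>\<psi> : S \<rightarrow> K\<close> and \<open>\<psi>' : S' \<rightarrow> K'\<close>.
\<close>

definition lifts_along where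
  "lifts_along S K \<psi> S' K' \<psi>' f \<Phi> \<longleftrightarrow>
     affine_weak_star_homeomorphism S K \<psi> \<and> affine_weak_star_homeomorphism S' K' \<psi>' \<and>
     affine_weak_star_homeomorphism S S' f \<and> affine_weak_star_homeomorphism K K' \<Phi> \<and>
     (\<forall>\<tau>\<in>S. \<Phi> (\<psi> \<tau>) = \<psi>' (f \<tau>))"


section \<open>Classical systems\<close>

definition comp_op ::
    "('x::topological_space \<Rightarrow> 'y::topological_space) \<Rightarrow> ('y \<Rightarrow>\<^sub>C complex) \<Rightarrow> 'x \<Rightarrow>\<^sub>C complex" where
  "comp_op s f = Bcontfun (apply_bcontfun f \<circ> s)"

definition classical_system ::
    "('n \<Rightarrow> 'x::topological_space \<Rightarrow> 'x) \<Rightarrow> 'n \<Rightarrow> ('x \<Rightarrow>\<^sub>C complex) \<Rightarrow> 'x \<Rightarrow>\<^sub>C complex" where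
  "classical_system \<sigma> i = comp_op (\<sigma> i)"

definition piecewise_conjugate ::
    "('n \<Rightarrow> 'x::topological_space \<Rightarrow> 'x) \<Rightarrow> ('n \<Rightarrow> 'y::topological_space \<Rightarrow> 'y) \<Rightarrow> ('x \<Rightarrow> 'y) \<Rightarrow> bool" where
  "piecewise_conjugate \<sigma> \<rho> \<phi> \<longleftrightarrow> (\<exists>\<phi>'. homeomorphism UNIV UNIV \<phi> \<phi>') \<and>
     (\<forall>x. \<exists>U \<pi>. open U \<and> x \<in> U \<and> bij \<pi> \<and> (\<forall>i. \<forall>y\<in>U. \<rho> i (\<phi> y) = \<phi> (\<sigma> (\<pi> i) y)))"

end

theory Submission
  imports Defs "HOL-Complex_Analysis.Complex_Analysis"
begin

text \<open>
  A state on either algebra is a KMS state at \<open>\<beta> \<noteq> 0\<close> iff it vanishes on \<open>V\<^sub>\<mu> a V\<^sub>\<nu>*\<close> for \<open>\<mu> \<noteq> \<nu>\<close> and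
  takes the value \<open>exp (- |\<mu>| \<beta>) \<psi>(a)\<close> for \<open>\<mu> = \<nu>\<close>. Existence of the KMS states on the Toeplitz algebra
  comes from the Fock representations: the vector states of the words of length \<open>m\<close>, as functions of
  the base point, define a positive map \<open>G\<^sub>m\<close> into \<open>C(X)\<close> sending \<open>V\<^sub>\<mu> a V\<^sub>\<mu>*\<close> to \<open>L\<^bsup>m - |\<mu>|\<^esup> a\<close>, where
  \<open>L = \<Sum>\<^sub>i \<alpha>\<^sub>i\<close>; then \<open>\<psi>\<^sub>\<tau> = (1 - exp (- \<beta>) d) \<Sum>\<^sub>m exp (- m \<beta>) \<tau> \<circ> G\<^sub>m\<close>, and at \<open>\<beta> = log d\<close> one takes
  \<open>lim\<^sub>m d\<^bsup>- m\<^esup> \<tau> \<circ> G\<^sub>m\<close>. The parameter is recovered from \<open>\<psi>\<close> by compressing with the defect projection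
  \<open>1 - \<Sum>\<^sub>i V\<^sub>i V\<^sub>i*\<close>, so all the maps are weak*-continuous by inspection, and such a state descends to the
  Cuntz-Pimsner quotient as soon as it kills the generators of the ideal. All values depend on the
  dynamics only through \<open>L\<close>, and \<open>L\<close> is intertwined by \<open>f \<mapsto> f \<circ> \<phi>\<close> because at each point the maps
  \<open>\<rho>\<^sub>i \<circ> \<phi>\<close> are a permutation of the maps \<open>\<phi> \<circ> \<sigma>\<^sub>i\<close>.
\<close>


section \<open>Algebra in C*-algebras\<close>

text \<open>The KMS condition is only given on some dense subalgebra \<open>D\<close>, which need
  not contain the elements \<open>V\<^sub>\<mu> a V\<^sub>\<nu>*\<close>, so their values cannot be
  read off directly. These elements are eigenvectors of a flow of period 2 pi; approximating one of
  them from \<open>D\<close> and comparing Fourier coefficients on two horizontal lines transfers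
  the condition.

  The universal property speaks of C*-seminorms, so the Fock spaces are never completed: finitely
  supported functions suffice for the operator seminorm, which the Toeplitz norm dominates.

  Parameter and state are tied together by \<psi>(a P) = \<psi>(a) - exp(-\<beta>) \<psi>(L a) for
  the defect projection P. When exp(-\<beta>) d < 1, the operator 1 - exp(-\<beta>) L is inverted by
  its Neumann series, so the restriction of \<psi> to A and its compression by P determine each
  other; the factor 1 - exp(-\<beta>) d normalises, because L 1 = d. At \<beta> = log d the series
  diverges on 1, but P vanishes in the quotient of an injective system, and the same identity
  becomes the averaging condition of AVT.\<close>

lemma cscale_zero_left [simp]: "0 *\<^sub>C (x :: 'a::cstar_algebra) = 0"
  using cscale_of_real[of 0 x] by simp

lemma cscale_one [simp]: "1 *\<^sub>C (x :: 'a::cstar_algebra) = x"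
  using cscale_of_real[of 1 x] by simp

lemma bounded_linear_cscale: "bounded_linear (cscale c :: 'a::cstar_algebra \<Rightarrow> 'a)"
  by (rule bounded_linear_cscale_aux)

lemma bounded_linear_star: "bounded_linear (star :: 'a::cstar_algebra \<Rightarrow> 'a)"
  by (rule bounded_linear_star_aux)

lemmas cscale_zero_right [simp] = linear_0[OF bounded_linear.linear[OF bounded_linear_cscale]]
  and cscale_minus_right = linear_neg[OF bounded_linear.linear[OF bounded_linear_cscale]]
  and cscale_diff_right = linear_diff[OF bounded_linear.linear[OF bounded_linear_cscale]]
  and cscale_sum_right = linear_sum[OF bounded_linear.linear[OF bounded_linear_cscale]]

lemmas star_zero [simp] = linear_0[OF bounded_linear.linear[OF bounded_linear_star]]
  and star_minus = linear_neg[OF bounded_linear.linear[OF bounded_linear_star]]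
  and star_diff = linear_diff[OF bounded_linear.linear[OF bounded_linear_star]]
  and star_sum = linear_sum[OF bounded_linear.linear[OF bounded_linear_star]]

lemma cscale_minus_left: "(- c) *\<^sub>C (x :: 'a::cstar_algebra) = - (c *\<^sub>C x)"
  using cscale_add_left[of "-c" c x] by (simp add: eq_neg_iff_add_eq_0)

lemma scaleR_conv_cscale: "r *\<^sub>R (x :: 'a::cstar_algebra) = complex_of_real r *\<^sub>C x"
  by (simp add: cscale_of_real)

lemma cscale_complex_eq [simp]: "c *\<^sub>C (z :: complex) = c * z"
  by (simp add: cscale_complex_def)

lemma star_complex_eq [simp]: "star (z :: complex) = cnj z"
  by (simp add: star_complex_def)

lemma star_one [simp]: "star (1 :: 'a::cstar_algebra) = 1"
  by (metis mult_1_right star_mult star_star mult_1_left)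

declare star_star [simp]

lemma bounded_linear_of_complex_linear:
  fixes f :: "'a::cstar_algebra \<Rightarrow> 'b::cstar_algebra"
  assumes "\<And>x y. f (x + y) = f x + f y" and "\<And>c x. f (c *\<^sub>C x) = c *\<^sub>C f x"
    and "\<And>x. norm (f x) \<le> K * norm x"
  shows "bounded_linear f"
  by (rule bounded_linear_intro[where K = K]) (use assms in \<open>auto simp: scaleR_conv_cscale mult.commute\<close>)


section \<open>Evaluating noncommutative polynomials\<close>

text \<open>Keys outside the support contribute \<open>h m 0 = 0\<close>, which makes the sum additive in the polynomial.\<close>

definition keys_sum :: "('k \<Rightarrow> complex \<Rightarrow> 'b) \<Rightarrow> ('k \<Rightarrow>\<^sub>0 complex) \<Rightarrow> 'b::comm_monoid_add" where
  "keys_sum h p = (\<Sum>m\<in>Poly_Mapping.keys p. h m (Poly_Mapping.lookup p m))"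

lemma poly_mapping_sum_single:
  "(\<Sum>m\<in>Poly_Mapping.keys p. Poly_Mapping.single m (Poly_Mapping.lookup p m)) = p"
  by (rule poly_mapping_eqI)
    (auto simp: lookup_sum lookup_single when_def if_distrib sum.delta' in_keys_iff cong: if_cong)

locale coefficient_additive =
  fixes h :: "'k \<Rightarrow> complex \<Rightarrow> 'b::comm_monoid_add"
  assumes zero [simp]: "h m 0 = 0" and add: "h m (a + b) = h m a + h m b"
begin

lemma keys_sum_superset:
  assumes "finite S" "Poly_Mapping.keys p \<subseteq> S"
  shows "keys_sum h p = (\<Sum>m\<in>S. h m (Poly_Mapping.lookup p m))"
  unfolding keys_sum_def
  by (rule sum.mono_neutral_left) (use assms in \<open>auto simp: in_keys_iff\<close>)

lemma keys_sum_add: "keys_sum h (p + q) = keys_sum h p + keys_sum h q"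
proof -
  let ?S = "Poly_Mapping.keys p \<union> Poly_Mapping.keys q"
  have "keys_sum h (p + q) = (\<Sum>m\<in>?S. h m (Poly_Mapping.lookup (p + q) m))"
    by (rule keys_sum_superset) (auto simp: Poly_Mapping.keys_add)
  also have "\<dots> = keys_sum h p + keys_sum h q"
    by (simp add: keys_sum_superset[where S = ?S] lookup_add add sum.distrib)
  finally show ?thesis .
qed

lemma keys_sum_zero [simp]: "keys_sum h 0 = 0"
  by (simp add: keys_sum_def)

lemma keys_sum_sum: "keys_sum h (sum f I) = (\<Sum>i\<in>I. keys_sum h (f i))"
  by (induction I rule: infinite_finite_induct) (auto simp: keys_sum_add)

lemma keys_sum_single [simp]: "keys_sum h (Poly_Mapping.single m c) = h m c"
  by (subst keys_sum_superset[where S = "{m}"]) auto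

end

text \<open>Convolution lists every pair of keys; pairs with the same product \<open>m + n\<close>
  need not be merged, because \<open>h\<close> is additive in the coefficient.\<close>

lemma keys_sum_mult:
  fixes p q :: "'k::monoid_add \<Rightarrow>\<^sub>0 complex"
  assumes "coefficient_additive h"
  shows "keys_sum h (p * q) =
    (\<Sum>m\<in>Poly_Mapping.keys p. \<Sum>n\<in>Poly_Mapping.keys q.
      h (m + n) (Poly_Mapping.lookup p m * Poly_Mapping.lookup q n))"
proof -
  interpret coefficient_additive h by fact
  have "p * q = (\<Sum>m\<in>Poly_Mapping.keys p. \<Sum>n\<in>Poly_Mapping.keys q.
      Poly_Mapping.single (m + n) (Poly_Mapping.lookup p m * Poly_Mapping.lookup q n))"
    by (subst (1) poly_mapping_sum_single[of p, symmetric],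
        subst (1) poly_mapping_sum_single[of q, symmetric])
      (simp add: sum_product mult_single)
  then show ?thesis
    by (simp add: keys_sum_sum)
qed

lemma letters_zero [simp]: "letters 0 = []"
  by (simp add: zero_monomial_def)

lemma letters_add [simp]: "letters (m + n) = letters m @ letters n"
  by (simp add: plus_monomial_def)

lemma letters_monomial_star [simp]: "letters (monomial_star m) = rev (map letter_star (letters m))"
  by (simp add: monomial_star_def)

definition eval_monomial :: "('g \<Rightarrow> 'a::cstar_algebra) \<Rightarrow> 'g monomial \<Rightarrow> 'a" where
  "eval_monomial \<theta> m = prod_list (map (eval_letter \<theta>) (letters m))"

lemma eval_monomial_zero [simp]: "eval_monomial \<theta> 0 = 1"
  by (simp add: eval_monomial_def)

lemma eval_monomial_add: "eval_monomial \<theta> (m + n) = eval_monomial \<theta> m * eval_monomial \<theta> n"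
  by (simp add: eval_monomial_def)

lemma eval_letter_star [simp]: "eval_letter \<theta> (letter_star l) = star (eval_letter \<theta> l)"
  by (cases l) auto

lemma eval_monomial_star: "eval_monomial \<theta> (monomial_star m) = star (eval_monomial \<theta> m)"
proof -
  have "prod_list (rev (map (eval_letter \<theta> \<circ> letter_star) w)) = star (prod_list (map (eval_letter \<theta>) w))"
    for w
    by (induction w) (auto simp: star_mult)
  then show ?thesis
    by (simp add: eval_monomial_def rev_map)
qed

lemma eval_poly_keys_sum: "eval_poly \<theta> = keys_sum (\<lambda>m c. c *\<^sub>C eval_monomial \<theta> m)"
  by (rule ext) (simp add: eval_poly_def keys_sum_def eval_monomial_def)

interpretation eval_poly: coefficient_additive "\<lambda>m c. c *\<^sub>C eval_monomial \<theta> m" for \<theta>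
  by standard (auto simp: cscale_add_left)

lemma eval_poly_add: "eval_poly \<theta> (p + q) = eval_poly \<theta> p + eval_poly \<theta> q"
  by (simp add: eval_poly_keys_sum eval_poly.keys_sum_add)

lemma eval_poly_zero [simp]: "eval_poly \<theta> 0 = 0"
  by (simp add: eval_poly_keys_sum)

lemma eval_poly_single: "eval_poly \<theta> (Poly_Mapping.single m c) = c *\<^sub>C eval_monomial \<theta> m"
  by (simp add: eval_poly_keys_sum)

lemma eval_poly_sum: "eval_poly \<theta> (sum f I) = (\<Sum>i\<in>I. eval_poly \<theta> (f i))"
  by (simp add: eval_poly_keys_sum eval_poly.keys_sum_sum)

lemma eval_poly_minus: "eval_poly \<theta> (- p) = - eval_poly \<theta> p"
  using eval_poly_add[of \<theta> "-p" p] by (simp add: eq_neg_iff_add_eq_0)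

lemma eval_poly_diff: "eval_poly \<theta> (p - q) = eval_poly \<theta> p - eval_poly \<theta> q"
  using eval_poly_add[of \<theta> "p - q" q] by simp

lemma eval_poly_mult: "eval_poly \<theta> (p * q) = eval_poly \<theta> p * eval_poly \<theta> q"
proof -
  have "eval_poly \<theta> (p * q) = (\<Sum>m\<in>Poly_Mapping.keys p. \<Sum>n\<in>Poly_Mapping.keys q.
      (Poly_Mapping.lookup p m *\<^sub>C eval_monomial \<theta> m) * (Poly_Mapping.lookup q n *\<^sub>C eval_monomial \<theta> n))"
    unfolding eval_poly_keys_sum
    by (subst keys_sum_mult)
      (auto simp: eval_poly.coefficient_additive_axioms eval_monomial_add cscale_mult_left cscale_mult_right
        cscale_cscale mult.commute)
  then show ?thesis
    by (simp add: eval_poly_keys_sum keys_sum_def sum_product)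
qed

lemma eval_poly_one [simp]: "eval_poly \<theta> 1 = 1"
  using eval_poly_single[of \<theta> 0 1] by (simp add: single_one)

lemma eval_poly_scale: "eval_poly \<theta> (poly_scale c p) = c *\<^sub>C eval_poly \<theta> p"
  by (simp add: poly_scale_def eval_poly_mult eval_poly_single cscale_mult_left)

lemma eval_poly_star: "eval_poly \<theta> (poly_star p) = star (eval_poly \<theta> p)"
proof -
  have "eval_poly \<theta> (poly_star p) = (\<Sum>m\<in>Poly_Mapping.keys p.
      star (Poly_Mapping.lookup p m *\<^sub>C eval_monomial \<theta> m))"
    unfolding poly_star_def
    by (simp add: eval_poly_sum eval_poly_single eval_monomial_star star_cscale)
  then show ?thesis
    by (simp add: eval_poly_keys_sum keys_sum_def star_sum)
qed

lemma eval_poly_gen [simp]: "eval_poly \<theta> (gen g) = \<theta> g"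
  by (simp add: gen_def eval_poly_single eval_monomial_def)

lemmas eval_poly_simps = eval_poly_add eval_poly_diff eval_poly_minus eval_poly_mult eval_poly_scale
  eval_poly_star eval_poly_single

lemma cstar_seminorm_norm_eval_poly: "cstar_seminorm (\<lambda>p. norm (eval_poly \<theta> p))"
  by (simp add: cstar_seminorm_def eval_poly_simps norm_triangle_ineq norm_mult_ineq norm_cscale
      cstar_identity)


section \<open>Bounded linear maps on dense subspaces\<close>

text \<open>Since \<open>complex\<close> is itself an instance of \<open>cstar_algebra\<close>, one
  notion covers homomorphisms, functionals and maps into C(X).\<close>

definition cbounded_linear :: "('a::cstar_algebra \<Rightarrow> 'b::cstar_algebra) \<Rightarrow> bool" where
  "cbounded_linear f \<longleftrightarrow> bounded_linear f \<and> (\<forall>c x. f (c *\<^sub>C x) = c *\<^sub>C f x)"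

lemma cbounded_linearD:
  assumes "cbounded_linear f"
  shows "bounded_linear f" "f (x + y) = f x + f y" "f 0 = 0" "f (- x) = - f x" "f (x - y) = f x - f y"
    "f (c *\<^sub>C x) = c *\<^sub>C f x" "f (sum g I) = (\<Sum>i\<in>I. f (g i))" "continuous_on S f"
  using assms unfolding cbounded_linear_def
  by (auto simp: linear_add linear_0 linear_neg linear_diff linear_sum bounded_linear.linear
      linear_continuous_on)

lemma cbounded_linear_id: "cbounded_linear (\<lambda>x. x)"
  by (simp add: cbounded_linear_def bounded_linear_ident)

lemma cbounded_linear_mult_left: "cbounded_linear ((*) a)"
  by (simp add: cbounded_linear_def bounded_linear_mult_right cscale_mult_right)

lemma cbounded_linear_mult_right: "cbounded_linear (\<lambda>x. x * a)"
  by (simp add: cbounded_linear_def bounded_linear_mult_left cscale_mult_left)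

lemma cbounded_linear_compose:
  "cbounded_linear f \<Longrightarrow> cbounded_linear g \<Longrightarrow> cbounded_linear (\<lambda>x. f (g x))"
  by (simp add: cbounded_linear_def bounded_linear_compose)

lemma cbounded_linear_cscale: "cbounded_linear f \<Longrightarrow> cbounded_linear (\<lambda>x. c *\<^sub>C f x)"
  by (auto simp: cbounded_linear_def cscale_cscale mult.commute
      intro: bounded_linear_compose[OF bounded_linear_cscale])

lemma cbounded_linear_sum: "(\<And>i. i \<in> I \<Longrightarrow> cbounded_linear (f i)) \<Longrightarrow> cbounded_linear (\<lambda>x. \<Sum>i\<in>I. f i x)"
  by (simp add: cbounded_linear_def bounded_linear_sum cscale_sum_right)

lemma cbounded_linear_add:
  "cbounded_linear f \<Longrightarrow> cbounded_linear g \<Longrightarrow> cbounded_linear (\<lambda>x. f x + g x)"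
  by (simp add: cbounded_linear_def bounded_linear_add cscale_add_right)

lemma cbounded_linear_diff:
  "cbounded_linear f \<Longrightarrow> cbounded_linear g \<Longrightarrow> cbounded_linear (\<lambda>x. f x - g x)"
  by (simp add: cbounded_linear_def bounded_linear_sub cscale_diff_right)

lemma dense_induct:
  assumes "closure S = UNIV" "closed {x. P x}" "\<And>x. x \<in> S \<Longrightarrow> P x"
  shows "P x"
  using closure_minimal[of S "{x. P x}"] assms by auto

lemma dense_eqI:
  fixes f g :: "'a::topological_space \<Rightarrow> 'b::t2_space"
  assumes "closure S = UNIV" "continuous_on UNIV f" "continuous_on UNIV g" "\<And>x. x \<in> S \<Longrightarrow> f x = g x"
  shows "f = g"
  using dense_induct[OF assms(1) closed_Collect_eq[OF assms(2,3)]] assms(4) by blast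

text \<open>The bound, applied to the difference of two preimages, makes \<open>f\<close> constant
  on the fibres of \<open>eval_poly\<close>; hence \<open>h\<close> is well defined and 1-Lipschitz
  on a dense subspace, and the extension inherits linearity by density.\<close>

lemma extend_from_polynomials:
  fixes \<theta> :: "'g \<Rightarrow> 'b::cstar_algebra" and f :: "'g star_poly \<Rightarrow> 'c::cstar_algebra"
  assumes dense: "closure (range (eval_poly \<theta>)) = UNIV"
    and add: "\<And>p q. f (p + q) = f p + f q"
    and scale: "\<And>c p. f (poly_scale c p) = c *\<^sub>C f p"
    and bound: "\<And>p. norm (f p) \<le> norm (eval_poly \<theta> p)"
  obtains g where "cbounded_linear g" "\<And>p. g (eval_poly \<theta> p) = f p" "\<And>x. norm (g x) \<le> norm x"
proof -
  define R where "R = range (eval_poly \<theta>)"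
  define h where "h y = f (SOME p. eval_poly \<theta> p = y)" for y
  have diff: "f (p - q) = f p - f q" for p q
    using add[of "p - q" q] by (simp add: algebra_simps)
  have h: "h (eval_poly \<theta> p) = f p" for p
  proof -
    have "eval_poly \<theta> (SOME q. eval_poly \<theta> q = eval_poly \<theta> p) = eval_poly \<theta> p"
      by (rule someI) simp
    then show ?thesis
      using bound[of "(SOME q. eval_poly \<theta> q = eval_poly \<theta> p) - p"]
      by (simp add: h_def diff eval_poly_diff)
  qed
  have "uniformly_continuous_on R h"
    unfolding uniformly_continuous_on_def
  proof safe
    fix e :: real
    assume "e > 0"
    have "dist (h x') (h x) < e" if "x \<in> R" "x' \<in> R" "dist x' x < e" for x x'
    proof -
      obtain p p' where "x = eval_poly \<theta> p" "x' = eval_poly \<theta> p'"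
        using \<open>x \<in> R\<close> \<open>x' \<in> R\<close> by (auto simp: R_def)
      then show ?thesis
        using bound[of "p' - p"] that by (simp add: h diff eval_poly_diff dist_norm)
    qed
    then show "\<exists>d>0. \<forall>x\<in>R. \<forall>x'\<in>R. dist x' x < d \<longrightarrow> dist (h x') (h x) < e"
      using \<open>e > 0\<close> by blast
  qed
  then obtain g where g: "uniformly_continuous_on (closure R) g" "\<And>x. x \<in> R \<Longrightarrow> h x = g x"
    by (rule uniformly_continuous_on_extension_on_closure) (rule that)
  have cont: "continuous_on UNIV g"
    using g(1) dense by (simp add: R_def uniformly_continuous_imp_continuous)
  have ge: "g (eval_poly \<theta> p) = f p" for p
    using g(2)[of "eval_poly \<theta> p"] by (simp add: R_def h)
  have norm: "norm (g x) \<le> norm x" for x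
    by (rule dense_induct[OF dense, where P = "\<lambda>x. norm (g x) \<le> norm x"])
      (auto intro!: closed_Collect_le continuous_intros continuous_on_subset[OF cont] simp: ge bound)
  have gscale: "g (c *\<^sub>C x) = c *\<^sub>C g x" for c x
  proof -
    have "(\<lambda>x. g (c *\<^sub>C x)) = (\<lambda>x. c *\<^sub>C g x)"
      by (rule dense_eqI[OF dense])
        (auto intro!: continuous_on_compose2[OF cont]
          continuous_on_compose2[OF linear_continuous_on[OF bounded_linear_cscale] cont]
          linear_continuous_on[OF bounded_linear_cscale] simp flip: eval_poly_scale simp: ge scale)
    then show ?thesis
      by metis
  qed
  \<comment> \<open>Additivity is extended in one variable at a time: first \<open>x\<close>, with
    the other summand a polynomial value, then \<open>y\<close>.\<close>
  have gadd1: "g (x + eval_poly \<theta> q) = g x + g (eval_poly \<theta> q)" for x q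
  proof -
    have "(\<lambda>x. g (x + eval_poly \<theta> q)) = (\<lambda>x. g x + g (eval_poly \<theta> q))"
      by (rule dense_eqI[OF dense])
        (auto intro!: continuous_on_compose2[OF cont] continuous_intros cont simp flip: eval_poly_add simp: ge add)
    then show ?thesis
      by metis
  qed
  have gadd: "g (x + y) = g x + g y" for x y
  proof -
    have "(\<lambda>y. g (x + y)) = (\<lambda>y. g x + g y)"
      by (rule dense_eqI[OF dense])
        (auto intro!: continuous_on_compose2[OF cont] continuous_intros cont simp: gadd1)
    then show ?thesis
      by metis
  qed
  have "bounded_linear g"
    by (rule bounded_linear_of_complex_linear[where K = 1]) (use gadd gscale norm in auto)
  then show ?thesis
    using that[of g] ge norm gscale by (auto simp: cbounded_linear_def)
qed

lemma star_homD:
  assumes "star_hom f"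
  shows "cbounded_linear f" "f 1 = 1" "f (x * y) = f x * f y" "f (star x) = star (f x)"
  using assms by (auto simp: star_hom_def cbounded_linear_def)

lemma star_hom_eval_poly:
  assumes "star_hom f"
  shows "f (eval_poly \<theta> p) = eval_poly (f \<circ> \<theta>) p"
proof -
  note f = star_homD[OF assms] cbounded_linearD[OF star_homD(1)[OF assms]]
  have letter: "f (eval_letter \<theta> l) = eval_letter (f \<circ> \<theta>) l" for l
    by (cases l) (auto simp: f)
  have "f (prod_list (map (eval_letter \<theta>) w)) = prod_list (map (eval_letter (f \<circ> \<theta>)) w)" for w
    by (induction w) (simp_all del: o_apply add: f letter)
  then show ?thesis
    by (simp add: eval_poly_def f)
qed

lemma star_hom_unique:
  assumes "closure (range (eval_poly \<theta>)) = UNIV" "star_hom f" "star_hom g" "f \<circ> \<theta> = g \<circ> \<theta>"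
  shows "f = g"
  by (rule dense_eqI[OF assms(1)])
    (use assms in \<open>auto simp: star_hom_eval_poly intro!: cbounded_linearD(8) star_homD(1)\<close>)

text \<open>The seminorm \<open>norm (eval_poly \<eta> p)\<close> vanishes on the relations, so the
  universal norm dominates it. This converts the definition by seminorms into the usual mapping
  property.\<close>

lemma universal_cstar_algebraE:
  assumes "universal_cstar_algebra R \<theta>" and "\<And>r. r \<in> R \<Longrightarrow> eval_poly \<eta> r = 0"
  obtains f where "star_hom f" "f \<circ> \<theta> = \<eta>" "\<And>x. norm (f x) \<le> norm x"
proof -
  have dense: "closure (range (eval_poly \<theta>)) = UNIV"
    and "norm (eval_poly \<eta> p) \<le> norm (eval_poly \<theta> p)" for p
    using assms cstar_seminorm_norm_eval_poly[of \<eta>] by (auto simp: universal_cstar_algebra_def)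
  then obtain f where f: "cbounded_linear f" "\<And>p. f (eval_poly \<theta> p) = eval_poly \<eta> p"
      "\<And>x. norm (f x) \<le> norm x"
    using extend_from_polynomials[of \<theta> "eval_poly \<eta>"] by (metis eval_poly_add eval_poly_scale)
  note lin = cbounded_linearD[OF f(1)]
  have one: "f 1 = 1"
    using f(2)[of 1] by simp
  have star: "f (star x) = star (f x)" for x
  proof -
    have "(\<lambda>x. f (star x)) = (\<lambda>x. star (f x))"
    proof (rule dense_eqI[OF dense])
      fix x
      assume "x \<in> range (eval_poly \<theta>)"
      then show "f (star x) = star (f x)"
        by (metis eval_poly_star f(2) rangeE)
    qed (intro linear_continuous_on bounded_linear_compose[OF lin(1)] lin(1)
        bounded_linear_compose[OF bounded_linear_star] bounded_linear_star)+
    then show ?thesis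
      by metis
  qed
  have mult1: "f (x * eval_poly \<theta> q) = f x * f (eval_poly \<theta> q)" for x q
  proof -
    have "(\<lambda>x. f (x * eval_poly \<theta> q)) = (\<lambda>x. f x * f (eval_poly \<theta> q))"
    proof (rule dense_eqI[OF dense])
      fix x
      assume "x \<in> range (eval_poly \<theta>)"
      then show "f (x * eval_poly \<theta> q) = f x * f (eval_poly \<theta> q)"
        by (metis eval_poly_mult f(2) rangeE)
    qed (auto intro!: continuous_on_compose2[OF lin(8)] continuous_intros lin(8))
    then show ?thesis
      by metis
  qed
  have mult: "f (x * y) = f x * f y" for x y
  proof -
    have "(\<lambda>y. f (x * y)) = (\<lambda>y. f x * f y)"
      by (rule dense_eqI[OF dense])
        (auto intro!: continuous_on_compose2[OF lin(8)] continuous_intros lin(8) simp: mult1)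
    then show ?thesis
      by metis
  qed
  have "star_hom f"
    using lin(1,6) one star mult by (auto simp: star_hom_def)
  moreover have "f \<circ> \<theta> = \<eta>"
    using f(2)[of "gen _"] by (auto simp: fun_eq_iff)
  ultimately show ?thesis
    using that f(3) by blast
qed


section \<open>Positive functionals\<close>

text \<open>Boundedness is left out on purpose: on C(X) it is a consequence of positivity, and this
  is how new functionals are recognised as states.\<close>

definition positive_functional :: "('a::cstar_algebra \<Rightarrow> complex) \<Rightarrow> bool" where
  "positive_functional \<psi> \<longleftrightarrow> (\<forall>x y. \<psi> (x + y) = \<psi> x + \<psi> y) \<and> (\<forall>c x. \<psi> (c *\<^sub>C x) = c * \<psi> x) \<and>
     (\<forall>x. \<psi> (star x * x) \<in> \<real>\<^sub>\<ge>\<^sub>0)"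

lemma states_cbounded_linear: "\<psi> \<in> states \<Longrightarrow> cbounded_linear \<psi>"
  by (simp add: states_def cbounded_linear_def)

lemma states_positive_functional: "\<psi> \<in> states \<Longrightarrow> positive_functional \<psi>"
  using cbounded_linearD(2)[OF states_cbounded_linear]
  by (auto simp: states_def positive_functional_def)

lemma states_one: "\<psi> \<in> states \<Longrightarrow> \<psi> 1 = 1"
  by (simp add: states_def)

lemma states_iff: "\<psi> \<in> states \<longleftrightarrow> cbounded_linear \<psi> \<and> (\<forall>x. \<psi> (star x * x) \<in> \<real>\<^sub>\<ge>\<^sub>0) \<and> \<psi> 1 = 1"
  by (auto simp: states_def cbounded_linear_def)

lemma Re_of_real_mult: "Re (complex_of_real r * z) = r * Re z"
  by simp

text \<open>Tailored to Cauchy-Schwarz with the perturbation \<open>t * cnj s\<close>, where the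
  linear and the quadratic coefficient both carry the factor \<open>s\<^sup>2\<close>.\<close>

lemma quadratic_discriminant_nonneg:
  fixes a b s :: real
  assumes "\<And>t. a + 2 * t * s\<^sup>2 + t\<^sup>2 * s\<^sup>2 * b \<ge> 0" and "a \<ge> 0" "b \<ge> 0"
  shows "s\<^sup>2 \<le> a * b"
proof (cases "b = 0")
  case True
  have "s = 0"
  proof (rule ccontr)
    assume "s \<noteq> 0"
    then show False
      \<comment> \<open>With \<open>b = 0\<close> this \<open>t\<close> gives the value
        \<open>- a - 2\<close>.\<close>
      using assms(1)[of "- (a + 1) / s\<^sup>2"] assms(2) True by simp
  qed
  then show ?thesis
    using True by simp
next
  case False
  \<comment> \<open>The value at \<open>t = - 1 / b\<close>, where the quadratic is
    smallest.\<close>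
  then have "a - s\<^sup>2 / b \<ge> 0"
    using assms(1)[of "- 1 / b"] by (simp add: power2_eq_square field_simps)
  then show ?thesis
    using False assms(3) by (simp add: field_simps)
qed

text \<open>Polarisation: \<psi> is real on \<open>star (x + c y) * (x + c y)\<close>. The choice
  \<open>c = 1\<close> matches the imaginary parts and \<open>c = \<i>\<close> the real
  parts.\<close>

lemma positive_functional_hermitian:
  assumes "positive_functional \<psi>"
  shows "\<psi> (star y * x) = cnj (\<psi> (star x * y))"
proof -
  have add: "\<psi> (u + v) = \<psi> u + \<psi> v" and scale: "\<psi> (c *\<^sub>C u) = c * \<psi> u"
    and pos: "\<psi> (star u * u) \<in> \<real>\<^sub>\<ge>\<^sub>0" for u v c
    using assms by (auto simp: positive_functional_def)
  have Im: "Im (\<psi> (star u * u)) = 0" for u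
    using pos[of u] by (simp add: complex_nonneg_Reals_iff)
  have expand: "\<psi> (star (x + c *\<^sub>C y) * (x + c *\<^sub>C y)) =
      \<psi> (star x * x) + c * \<psi> (star x * y) + cnj c * \<psi> (star y * x) + cnj c * c * \<psi> (star y * y)" for c
    by (simp add: star_add star_cscale algebra_simps cscale_mult_left cscale_mult_right add scale
        cscale_cscale)
  have "Im (c * \<psi> (star x * y) + cnj c * \<psi> (star y * x)) = 0" for c
    using Im[of "x + c *\<^sub>C y"] Im[of x] Im[of y] expand[of c]
    by (auto simp: algebra_simps)
  from this[of 1] this[of \<i>] show ?thesis
    by (auto simp: complex_eq_iff)
qed

lemma positive_functional_star:
  "positive_functional \<psi> \<Longrightarrow> \<psi> (star x) = cnj (\<psi> x)"
  using positive_functional_hermitian[of \<psi> x 1] by simp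

text \<open>Positivity on \<open>x + c y\<close> with \<open>c = t * cnj s\<close>: this phase turns
  both cross terms into \<open>t * (cmod s)\<^sup>2\<close> and leaves a real quadratic in
  \<open>t\<close>.\<close>

lemma positive_functional_Cauchy_Schwarz:
  assumes "positive_functional \<psi>"
  shows "(cmod (\<psi> (star x * y)))\<^sup>2 \<le> Re (\<psi> (star x * x)) * Re (\<psi> (star y * y))"
proof -
  have add: "\<psi> (u + v) = \<psi> u + \<psi> v" and scale: "\<psi> (c *\<^sub>C u) = c * \<psi> u"
    and pos: "\<psi> (star u * u) \<in> \<real>\<^sub>\<ge>\<^sub>0" for u v c
    using assms by (auto simp: positive_functional_def)
  define s where "s = \<psi> (star x * y)"
  have expand: "\<psi> (star (x + c *\<^sub>C y) * (x + c *\<^sub>C y)) =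
      \<psi> (star x * x) + c * s + cnj c * cnj s + cnj c * c * \<psi> (star y * y)" for c
    using positive_functional_hermitian[OF assms, of y x]
    by (simp add: star_add star_cscale algebra_simps cscale_mult_left cscale_mult_right add scale
        cscale_cscale s_def)
  show ?thesis
    unfolding s_def[symmetric]
  proof (rule quadratic_discriminant_nonneg)
    fix t :: real
    let ?c = "of_real t * cnj s"
    have "?c * s = of_real (t * (cmod s)\<^sup>2)" "cnj ?c * cnj s = of_real (t * (cmod s)\<^sup>2)"
      "cnj ?c * ?c = of_real (t\<^sup>2 * (cmod s)\<^sup>2)"
      by (simp_all only: of_real_mult complex_norm_square)
        (simp_all add: power2_eq_square)
    then have "Re (\<psi> (star (x + ?c *\<^sub>C y) * (x + ?c *\<^sub>C y))) =
        Re (\<psi> (star x * x)) + 2 * t * (cmod s)\<^sup>2 + t\<^sup>2 * (cmod s)\<^sup>2 * Re (\<psi> (star y * y))"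
      unfolding expand by (simp only: plus_complex.simps Re_complex_of_real Re_of_real_mult)
    then show "0 \<le> Re (\<psi> (star x * x)) + 2 * t * (cmod s)\<^sup>2 + t\<^sup>2 * (cmod s)\<^sup>2 * Re (\<psi> (star y * y))"
      using pos[of "x + ?c *\<^sub>C y"] by (simp add: complex_nonneg_Reals_iff)
  qed (use pos[of x] pos[of y] in \<open>auto simp: complex_nonneg_Reals_iff\<close>)
qed

lemma bcontfun_nonneg_eq_star_mult:
  fixes f :: "'x::topological_space \<Rightarrow>\<^sub>C complex"
  assumes "\<And>x. apply_bcontfun f x \<in> \<real>\<^sub>\<ge>\<^sub>0"
  obtains g where "f = star g * g"
proof
  define h where "h x = complex_of_real (sqrt (Re (apply_bcontfun f x)))" for x
  have "h \<in> bcontfun"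
  proof (rule bcontfun_normI)
    show "continuous_on UNIV h"
      unfolding h_def by (intro continuous_intros continuous_on_apply_bcontfun)
    fix x
    have "Re (apply_bcontfun f x) \<le> norm f"
      using norm_bounded[of f x] complex_Re_le_cmod[of "apply_bcontfun f x"] by linarith
    then show "norm (h x) \<le> sqrt (norm f)"
      using assms[of x] by (simp add: h_def complex_nonneg_Reals_iff)
  qed
  then have "apply_bcontfun (Bcontfun h) x = h x" for x
    by (simp add: Bcontfun_inverse)
  then show "f = star (Bcontfun h) * Bcontfun h"
    using assms by (intro bcontfun_eqI) (auto simp: h_def complex_eq_iff complex_nonneg_Reals_iff)
qed

lemma bcontfun_state_nonneg:
  fixes f :: "'x::topological_space \<Rightarrow>\<^sub>C complex"
  assumes "positive_functional \<tau>" "\<And>x. apply_bcontfun f x \<in> \<real>\<^sub>\<ge>\<^sub>0"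
  shows "\<tau> f \<in> \<real>\<^sub>\<ge>\<^sub>0"
  using bcontfun_nonneg_eq_star_mult[of f] assms by (metis positive_functional_def)

text \<open>The function \<open>(norm f)\<^sup>2 - star f * f\<close> is pointwise nonnegative,
  hence of the form \<open>star g * g\<close>. So \<tau> of \<open>star f * f\<close> is at most
  \<open>(norm f)\<^sup>2\<close>, and Cauchy-Schwarz against 1 bounds \<tau>(f).\<close>

lemma
  fixes \<tau> :: "('x::topological_space \<Rightarrow>\<^sub>C complex) \<Rightarrow> complex"
  assumes "positive_functional \<tau>" "\<tau> 1 = 1"
  shows bcontfun_positive_functional_le: "cmod (\<tau> f) \<le> norm f"
    and bcontfun_positive_functional_state: "\<tau> \<in> states"
proof -
  have add: "\<tau> (u + v) = \<tau> u + \<tau> v" and scale: "\<tau> (c *\<^sub>C u) = c * \<tau> u" for u v c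
    using assms by (auto simp: positive_functional_def)
  show bound: "cmod (\<tau> f) \<le> norm f" for f
  proof -
    let ?g = "complex_of_real ((norm f)\<^sup>2) *\<^sub>C 1 + (- 1) *\<^sub>C (star f * f)"
    have "apply_bcontfun ?g x \<in> \<real>\<^sub>\<ge>\<^sub>0" for x
      using power_mono[OF norm_bounded[of f x], of 2]
      by (simp add: complex_nonneg_Reals_iff cmod_power2) (simp add: power2_eq_square)
    then have "\<tau> ?g \<in> \<real>\<^sub>\<ge>\<^sub>0"
      by (rule bcontfun_state_nonneg[OF assms(1)])
    then have "Re (\<tau> (star f * f)) \<le> (norm f)\<^sup>2"
      by (simp only: add scale assms(2)) (simp add: complex_nonneg_Reals_iff)
    moreover have "(cmod (\<tau> f))\<^sup>2 \<le> Re (\<tau> (star f * f))"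
      using positive_functional_Cauchy_Schwarz[OF assms(1), of 1 f] assms(2) by simp
    ultimately show ?thesis
      by (meson norm_ge_zero order_trans power2_le_imp_le)
  qed
  have "bounded_linear \<tau>"
    by (intro bounded_linear_of_complex_linear[where K = 1]) (auto simp: add scale bound)
  then show "\<tau> \<in> states"
    using assms by (auto simp: states_iff cbounded_linear_def positive_functional_def)
qed


section \<open>Finitely supported functions as a pre-Hilbert space\<close>

definition finsupp :: "('k \<Rightarrow> complex) \<Rightarrow> bool" where
  "finsupp f \<longleftrightarrow> finite {k. f k \<noteq> 0}"

definition fs_inner :: "('k \<Rightarrow> complex) \<Rightarrow> ('k \<Rightarrow> complex) \<Rightarrow> complex" where
  "fs_inner f g = (\<Sum>k | f k \<noteq> 0. f k * cnj (g k))"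

definition fs_norm :: "('k \<Rightarrow> complex) \<Rightarrow> real" where
  "fs_norm f = L2_set (\<lambda>k. cmod (f k)) {k. f k \<noteq> 0}"

lemma fs_inner_superset:
  assumes "finite S" "\<And>k. f k \<noteq> 0 \<Longrightarrow> g k \<noteq> 0 \<Longrightarrow> k \<in> S" "finsupp f"
  shows "fs_inner f g = (\<Sum>k\<in>S. f k * cnj (g k))"
proof -
  have "fs_inner f g = (\<Sum>k\<in>S \<union> {k. f k \<noteq> 0}. f k * cnj (g k))"
    unfolding fs_inner_def by (rule sum.mono_neutral_left) (use assms in \<open>auto simp: finsupp_def\<close>)
  also have "\<dots> = (\<Sum>k\<in>S. f k * cnj (g k))"
    by (rule sum.mono_neutral_right) (use assms in \<open>auto simp: finsupp_def\<close>)
  finally show ?thesis .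
qed

lemma fs_norm_superset:
  assumes "finite S" "\<And>k. f k \<noteq> 0 \<Longrightarrow> k \<in> S"
  shows "fs_norm f = L2_set (\<lambda>k. cmod (f k)) S"
  unfolding fs_norm_def L2_set_def
  by (rule arg_cong[where f = sqrt], rule sum.mono_neutral_left) (use assms in auto)

lemma fs_norm_nonneg [simp]: "0 \<le> fs_norm f"
  by (simp add: fs_norm_def)

lemma finsupp_add:
  assumes "finsupp f" "finsupp g"
  shows "finsupp (\<lambda>k. f k + g k)"
  using assms unfolding finsupp_def
  by (rule_tac finite_subset[of _ "{k. f k \<noteq> 0} \<union> {k. g k \<noteq> 0}"]) auto

lemma finsupp_mult: "finsupp f \<Longrightarrow> finsupp (\<lambda>k. c k * f k)"
  unfolding finsupp_def by (erule rev_finite_subset) auto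

lemma finsupp_zero [simp]: "finsupp (\<lambda>k. 0)"
  by (simp add: finsupp_def)

lemma finsupp_sum: "(\<And>i. i \<in> I \<Longrightarrow> finsupp (f i)) \<Longrightarrow> finsupp (\<lambda>k. \<Sum>i\<in>I. f i k)"
  by (induction I rule: infinite_finite_induct) (auto intro: finsupp_add)

lemma fs_inner_commute:
  assumes "finsupp f" "finsupp g"
  shows "fs_inner f g = cnj (fs_inner g f)"
  using assms
  by (simp add: fs_inner_superset[where S = "{k. f k \<noteq> 0}"] finsupp_def mult.commute)

lemma fs_inner_self: "finsupp f \<Longrightarrow> fs_inner f f = complex_of_real ((fs_norm f)\<^sup>2)"
  by (simp add: fs_inner_def fs_norm_def L2_set_def sum_nonneg flip: complex_norm_square)

lemma fs_Cauchy_Schwarz: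
  assumes "finsupp f" "finsupp g"
  shows "cmod (fs_inner f g) \<le> fs_norm f * fs_norm g"
proof -
  let ?S = "{k. f k \<noteq> 0} \<union> {k. g k \<noteq> 0}"
  have S: "finite ?S"
    using assms by (simp add: finsupp_def)
  have "cmod (fs_inner f g) = cmod (\<Sum>k\<in>?S. f k * cnj (g k))"
    using assms S by (subst fs_inner_superset[where S = ?S]) auto
  also have "\<dots> \<le> (\<Sum>k\<in>?S. \<bar>cmod (f k)\<bar> * \<bar>cmod (g k)\<bar>)"
    by (rule order_trans[OF norm_sum]) (simp add: norm_mult)
  also have "\<dots> \<le> L2_set (\<lambda>k. cmod (f k)) ?S * L2_set (\<lambda>k. cmod (g k)) ?S"
    by (rule L2_set_mult_ineq)
  also have "\<dots> = fs_norm f * fs_norm g"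
    using S fs_norm_superset[of ?S f] fs_norm_superset[of ?S g] by simp
  finally show ?thesis .
qed

lemma fs_norm_add:
  assumes "finsupp f" "finsupp g"
  shows "fs_norm (\<lambda>k. f k + g k) \<le> fs_norm f + fs_norm g"
proof -
  let ?S = "{k. f k \<noteq> 0} \<union> {k. g k \<noteq> 0}"
  have S: "finite ?S"
    using assms by (simp add: finsupp_def)
  have "fs_norm (\<lambda>k. f k + g k) = L2_set (\<lambda>k. cmod (f k + g k)) ?S"
    using S by (intro fs_norm_superset) auto
  also have "\<dots> \<le> L2_set (\<lambda>k. cmod (f k) + cmod (g k)) ?S"
    by (rule L2_set_mono) (auto simp: norm_triangle_ineq)
  also have "\<dots> \<le> L2_set (\<lambda>k. cmod (f k)) ?S + L2_set (\<lambda>k. cmod (g k)) ?S"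
    by (rule L2_set_triangle_ineq)
  also have "\<dots> = fs_norm f + fs_norm g"
    using S fs_norm_superset[of ?S f] fs_norm_superset[of ?S g] by simp
  finally show ?thesis .
qed

lemma fs_norm_mult_le:
  assumes "finsupp f" "\<And>k. cmod (c k) \<le> C" "0 \<le> C"
  shows "fs_norm (\<lambda>k. c k * f k) \<le> C * fs_norm f"
proof -
  let ?S = "{k. f k \<noteq> 0}"
  have "fs_norm (\<lambda>k. c k * f k) = L2_set (\<lambda>k. cmod (c k * f k)) ?S"
    using assms by (intro fs_norm_superset) (auto simp: finsupp_def)
  also have "\<dots> \<le> L2_set (\<lambda>k. C * cmod (f k)) ?S"
    by (rule L2_set_mono) (auto simp: norm_mult assms mult_right_mono)
  finally show ?thesis
    using assms(3) by (simp add: L2_set_right_distrib fs_norm_def)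
qed

lemma fs_norm_zero [simp]: "fs_norm (\<lambda>k. 0) = 0"
  by (simp add: fs_norm_def)

lemma fs_norm_sum:
  assumes "\<And>i. i \<in> I \<Longrightarrow> finsupp (f i)"
  shows "fs_norm (\<lambda>k. \<Sum>i\<in>I. f i k) \<le> (\<Sum>i\<in>I. fs_norm (f i))"
  using assms
proof (induction I rule: infinite_finite_induct)
  case (insert i I)
  then show ?case
    using fs_norm_add[of "f i" "\<lambda>k. \<Sum>i\<in>I. f i k"] finsupp_sum[of I f] by auto
qed auto

lemma fs_inner_sum_left:
  assumes "\<And>i. i \<in> I \<Longrightarrow> finsupp (f i)" "finsupp g"
  shows "fs_inner (\<lambda>k. \<Sum>i\<in>I. c i * f i k) g = (\<Sum>i\<in>I. c i * fs_inner (f i) g)"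
proof -
  have "fs_inner (f i) g = (\<Sum>k | g k \<noteq> 0. f i k * cnj (g k))" if "i \<in> I" for i
    using assms that by (subst fs_inner_superset[where S = "{k. g k \<noteq> 0}"]) (auto simp: finsupp_def)
  moreover have "fs_inner (\<lambda>k. \<Sum>i\<in>I. c i * f i k) g =
      (\<Sum>k | g k \<noteq> 0. (\<Sum>i\<in>I. c i * f i k) * cnj (g k))"
    by (rule fs_inner_superset) (use assms in \<open>auto simp: finsupp_def[of g] intro!: finsupp_sum finsupp_mult\<close>)
  ultimately show ?thesis
    by (simp add: sum_distrib_left sum_distrib_right mult.assoc sum.swap[of _ I])
qed

lemma fs_inner_sum_right:
  assumes "\<And>i. i \<in> I \<Longrightarrow> finsupp (g i)" "finsupp f"
  shows "fs_inner f (\<lambda>k. \<Sum>i\<in>I. cnj (c i) * g i k) = (\<Sum>i\<in>I. c i * fs_inner f (g i))"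
proof -
  have "fs_inner f (\<lambda>k. \<Sum>i\<in>I. cnj (c i) * g i k) = cnj (fs_inner (\<lambda>k. \<Sum>i\<in>I. cnj (c i) * g i k) f)"
    by (rule fs_inner_commute) (use assms in \<open>auto intro!: finsupp_sum finsupp_mult\<close>)
  also have "\<dots> = (\<Sum>i\<in>I. c i * cnj (fs_inner (g i) f))"
    using assms by (simp add: fs_inner_sum_left)
  also have "\<dots> = (\<Sum>i\<in>I. c i * fs_inner f (g i))"
    using assms fs_inner_commute[of f] by (intro sum.cong) auto
  finally show ?thesis .
qed


section \<open>The Fock representations\<close>

definition orbit :: "('n \<Rightarrow> 'x \<Rightarrow> 'x) \<Rightarrow> 'n list \<Rightarrow> 'x \<Rightarrow> 'x" where
  "orbit \<sigma> w x = foldr \<sigma> w x"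

lemma orbit_simps [simp]: "orbit \<sigma> [] x = x" "orbit \<sigma> (i # w) x = \<sigma> i (orbit \<sigma> w x)"
  by (simp_all add: orbit_def)

text \<open>
  On the free monoid's \<open>\<ell>\<^sup>2\<close>-space \<open>V i\<close> sends the basis vector of \<open>w\<close> to that of \<open>i # w\<close>, and \<open>a\<close>
  multiplies it by \<open>a (orbit \<sigma> w x)\<close>.
\<close>

fun fock_letter :: "('n \<Rightarrow> 'x::topological_space \<Rightarrow> 'x) \<Rightarrow> 'x \<Rightarrow> (('x \<Rightarrow>\<^sub>C complex) + 'n) letter \<Rightarrow>
    ('n list \<Rightarrow> complex) \<Rightarrow> 'n list \<Rightarrow> complex" where
  "fock_letter \<sigma> x (Gen (Inl a)) f w = apply_bcontfun a (orbit \<sigma> w x) * f w"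
| "fock_letter \<sigma> x (Gen_star (Inl a)) f w = cnj (apply_bcontfun a (orbit \<sigma> w x)) * f w"
| "fock_letter \<sigma> x (Gen (Inr i)) f w = (case w of [] \<Rightarrow> 0 | j # v \<Rightarrow> if j = i then f v else 0)"
| "fock_letter \<sigma> x (Gen_star (Inr i)) f w = f (i # w)"

lemma letter_sum_cases:
  obtains a where "l = Gen (Inl a)" | a where "l = Gen_star (Inl a)"
  | i where "l = Gen (Inr i)" | i where "l = Gen_star (Inr i)"
  by (metis letter.exhaust sum.exhaust)

definition fock_monomial :: "('n \<Rightarrow> 'x::topological_space \<Rightarrow> 'x) \<Rightarrow> 'x \<Rightarrow>
    (('x \<Rightarrow>\<^sub>C complex) + 'n) monomial \<Rightarrow> ('n list \<Rightarrow> complex) \<Rightarrow> 'n list \<Rightarrow> complex" where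
  "fock_monomial \<sigma> x m f = foldr (fock_letter \<sigma> x) (letters m) f"

text \<open>Acting on all functions of words keeps multiplicativity free of support conditions;
  finite support enters with the inner product and the norm.\<close>

definition fock_poly :: "('n \<Rightarrow> 'x::topological_space \<Rightarrow> 'x) \<Rightarrow> 'x \<Rightarrow>
    (('x \<Rightarrow>\<^sub>C complex) + 'n) star_poly \<Rightarrow> ('n list \<Rightarrow> complex) \<Rightarrow> 'n list \<Rightarrow> complex" where
  "fock_poly \<sigma> x p f w = keys_sum (\<lambda>m c. c * fock_monomial \<sigma> x m f w) p"

lemma fock_letter_sum:
  "fock_letter \<sigma> x l (\<lambda>w. \<Sum>i\<in>I. c i * f i w) = (\<lambda>w. \<Sum>i\<in>I. c i * fock_letter \<sigma> x l (f i) w)"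
proof (rule ext)
  fix w
  show "fock_letter \<sigma> x l (\<lambda>w. \<Sum>i\<in>I. c i * f i w) w = (\<Sum>i\<in>I. c i * fock_letter \<sigma> x l (f i) w)"
    by (cases l rule: letter_sum_cases)
      (auto simp: sum_distrib_left algebra_simps split: list.splits)
qed

lemma fock_monomial_sum:
  "fock_monomial \<sigma> x m (\<lambda>w. \<Sum>i\<in>I. c i * f i w) = (\<lambda>w. \<Sum>i\<in>I. c i * fock_monomial \<sigma> x m (f i) w)"
proof -
  have "foldr (fock_letter \<sigma> x) ls (\<lambda>w. \<Sum>i\<in>I. c i * f i w) =
      (\<lambda>w. \<Sum>i\<in>I. c i * foldr (fock_letter \<sigma> x) ls (f i) w)" for ls
    by (induction ls) (simp_all add: fock_letter_sum)
  then show ?thesis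
    by (simp add: fock_monomial_def)
qed

lemma fock_monomial_zero [simp]: "fock_monomial \<sigma> x 0 f = f"
  by (simp add: fock_monomial_def)

lemma fock_monomial_add: "fock_monomial \<sigma> x (m + n) f = fock_monomial \<sigma> x m (fock_monomial \<sigma> x n f)"
  by (simp add: fock_monomial_def)

interpretation fock: coefficient_additive "\<lambda>m c. c * fock_monomial \<sigma> x m f w" for \<sigma> x f w
  by standard (auto simp: algebra_simps)

lemma fock_poly_single: "fock_poly \<sigma> x (Poly_Mapping.single m c) f w = c * fock_monomial \<sigma> x m f w"
  by (simp add: fock_poly_def)

lemma fock_poly_add: "fock_poly \<sigma> x (p + q) f w = fock_poly \<sigma> x p f w + fock_poly \<sigma> x q f w"
  by (simp add: fock_poly_def fock.keys_sum_add)

lemma fock_poly_zero [simp]: "fock_poly \<sigma> x 0 f w = 0"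
  by (simp add: fock_poly_def)

lemma fock_poly_diff: "fock_poly \<sigma> x (p - q) f w = fock_poly \<sigma> x p f w - fock_poly \<sigma> x q f w"
  using fock_poly_add[of \<sigma> x "p - q" q f w] by simp

lemma fock_poly_sum: "fock_poly \<sigma> x (sum g I) f w = (\<Sum>i\<in>I. fock_poly \<sigma> x (g i) f w)"
  by (simp add: fock_poly_def fock.keys_sum_sum)

lemma fock_poly_expand:
  "fock_poly \<sigma> x p f =
    (\<lambda>w. \<Sum>m\<in>Poly_Mapping.keys p. Poly_Mapping.lookup p m * fock_monomial \<sigma> x m f w)"
  by (simp add: fun_eq_iff fock_poly_def keys_sum_def)

lemma fock_poly_mult: "fock_poly \<sigma> x (p * q) f w = fock_poly \<sigma> x p (fock_poly \<sigma> x q f) w"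
  unfolding fock_poly_def[of _ _ "p * q"]
  by (subst keys_sum_mult)
    (auto simp: fock.coefficient_additive_axioms fock_poly_expand fock_monomial_sum fock_monomial_add
      sum_distrib_left mult.assoc)

lemma fock_poly_scale: "fock_poly \<sigma> x (poly_scale c p) f w = c * fock_poly \<sigma> x p f w"
  by (simp add: poly_scale_def fock_poly_mult fock_poly_single)

lemma fock_poly_one [simp]: "fock_poly \<sigma> x 1 f w = f w"
  using fock_poly_single[of \<sigma> x 0 1 f w] by simp

lemma fock_poly_gen [simp]: "fock_poly \<sigma> x (gen g) f w = fock_letter \<sigma> x (Gen g) f w"
  by (simp add: gen_def fock_poly_single fock_monomial_def)

lemma poly_star_gen: "poly_star (gen g) = Poly_Mapping.single (Monomial [Gen_star g]) 1"
  by (simp add: poly_star_def gen_def monomial_star_def)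

lemma fock_poly_star_gen [simp]:
  "fock_poly \<sigma> x (poly_star (gen g)) f w = fock_letter \<sigma> x (Gen_star g) f w"
  by (simp add: poly_star_gen fock_poly_single fock_monomial_def)

lemma finsupp_fock_letter:
  assumes "finsupp f"
  shows "finsupp (fock_letter \<sigma> x l f)"
proof (cases l rule: letter_sum_cases)
  case (3 i)
  have "{w. fock_letter \<sigma> x l f w \<noteq> 0} \<subseteq> Cons i ` {w. f w \<noteq> 0}"
  proof
    fix w
    assume "w \<in> {w. fock_letter \<sigma> x l f w \<noteq> 0}"
    then show "w \<in> Cons i ` {w. f w \<noteq> 0}"
      using 3 by (cases w) (auto split: if_splits)
  qed
  then show ?thesis
    using assms finite_surj unfolding finsupp_def by blast
next
  case (4 i)
  have "{w. fock_letter \<sigma> x l f w \<noteq> 0} \<subseteq> tl ` {w. f w \<noteq> 0}"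
    using 4 by (auto simp: image_iff intro!: exI[of _ "i # _"])
  then show ?thesis
    using assms finite_surj unfolding finsupp_def by blast
next
  case (1 a)
  then have "fock_letter \<sigma> x l f = (\<lambda>w. apply_bcontfun a (orbit \<sigma> w x) * f w)"
    by auto
  then show ?thesis
    using assms by (simp add: finsupp_mult)
next
  case (2 a)
  then have "fock_letter \<sigma> x l f = (\<lambda>w. cnj (apply_bcontfun a (orbit \<sigma> w x)) * f w)"
    by auto
  then show ?thesis
    using assms by (simp add: finsupp_mult)
qed

lemma finsupp_fock_monomial: "finsupp f \<Longrightarrow> finsupp (fock_monomial \<sigma> x m f)"
proof -
  assume "finsupp f"
  then have "finsupp (foldr (fock_letter \<sigma> x) ls f)" for ls
    by (induction ls) (auto intro: finsupp_fock_letter)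
  then show ?thesis
    by (simp add: fock_monomial_def)
qed

lemma finsupp_fock_poly: "finsupp f \<Longrightarrow> finsupp (fock_poly \<sigma> x p f)"
  by (auto simp: fock_poly_expand intro!: finsupp_sum finsupp_mult finsupp_fock_monomial)

text \<open>Coefficients act diagonally; for a generator \<open>Inr i\<close> the substitution
  \<open>w = i # v\<close> moves the shift to the other side of the inner product.\<close>

lemma fs_inner_fock_Gen:
  assumes "finsupp f" "finsupp g"
  shows "fs_inner (fock_letter \<sigma> x (Gen s) f) g = fs_inner f (fock_letter \<sigma> x (Gen_star s) g)"
proof (cases s)
  case (Inl a)
  have S: "finite {w. f w \<noteq> 0}"
    using assms by (simp add: finsupp_def)
  have "fs_inner (fock_letter \<sigma> x (Gen s) f) g =
      (\<Sum>w | f w \<noteq> 0. fock_letter \<sigma> x (Gen s) f w * cnj (g w))"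
    by (rule fs_inner_superset) (use S Inl in \<open>auto intro: finsupp_fock_letter assms\<close>)
  then show ?thesis
    by (simp add: fs_inner_def Inl mult.commute mult.left_commute)
next
  case (Inr i)
  have S: "finite (Cons i ` {w. f w \<noteq> 0})"
    using assms by (simp add: finsupp_def)
  have "fs_inner (fock_letter \<sigma> x (Gen s) f) g =
      (\<Sum>w \<in> Cons i ` {w. f w \<noteq> 0}. fock_letter \<sigma> x (Gen s) f w * cnj (g w))"
    by (rule fs_inner_superset)
      (use S Inr in \<open>auto intro: finsupp_fock_letter assms split: list.splits if_splits\<close>)
  also have "\<dots> = (\<Sum>w | f w \<noteq> 0. f w * cnj (g (i # w)))"
    by (subst sum.reindex) (auto simp: Inr)
  finally show ?thesis
    by (simp add: fs_inner_def Inr)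
qed

lemma fs_inner_fock_letter:
  assumes "finsupp f" "finsupp g"
  shows "fs_inner (fock_letter \<sigma> x l f) g = fs_inner f (fock_letter \<sigma> x (letter_star l) g)"
proof (cases l)
  case (Gen s)
  then show ?thesis
    using fs_inner_fock_Gen[OF assms] by simp
next
  case (Gen_star s)
  then show ?thesis
    using fs_inner_fock_Gen[OF assms(2,1), of \<sigma> x s] assms
    by (metis finsupp_fock_letter fs_inner_commute letter_star.simps(2))
qed

lemma fs_inner_fock_monomial:
  assumes "finsupp f" "finsupp g"
  shows "fs_inner (fock_monomial \<sigma> x m f) g = fs_inner f (fock_monomial \<sigma> x (monomial_star m) g)"
proof -
  have "fs_inner (foldr (fock_letter \<sigma> x) ls f) g =
      fs_inner f (foldr (fock_letter \<sigma> x) (rev (map letter_star ls)) g)" for ls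
    using assms(2)
  proof (induction ls arbitrary: g)
    case (Cons l ls)
    have "finsupp (foldr (fock_letter \<sigma> x) ls f)"
      using finsupp_fock_monomial[OF assms(1), of \<sigma> x "Monomial ls"] by (simp add: fock_monomial_def)
    then show ?case
      using Cons by (simp add: fs_inner_fock_letter finsupp_fock_letter)
  qed auto
  then show ?thesis
    by (simp add: fock_monomial_def)
qed

lemma fs_inner_fock_poly:
  assumes "finsupp f" "finsupp g"
  shows "fs_inner (fock_poly \<sigma> x p f) g = fs_inner f (fock_poly \<sigma> x (poly_star p) g)"
proof -
  have "fock_poly \<sigma> x (poly_star p) g = (\<lambda>w. \<Sum>m\<in>Poly_Mapping.keys p.
      cnj (Poly_Mapping.lookup p m) * fock_monomial \<sigma> x (monomial_star m) g w)"
    by (simp add: fun_eq_iff poly_star_def fock_poly_sum fock_poly_single)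
  then show ?thesis
    using assms
    by (simp add: fock_poly_expand fs_inner_sum_left fs_inner_sum_right finsupp_fock_monomial
        fs_inner_fock_monomial)
qed

text \<open>Creation operators are isometric, since removing the letter undoes prefixing it. For
  \<open>g\<close>, the image of \<open>f\<close> under the adjoint of \<open>V\<close>, adjointness
  gives \<open>|g|^2 = <f, V g> \<le> |f| |g|\<close>. Coefficients act with bound
  \<open>norm a\<close>.\<close>

lemma fs_norm_fock_letter_bound: "\<exists>C\<ge>0. \<forall>f. finsupp f \<longrightarrow> fs_norm (fock_letter \<sigma> x l f) \<le> C * fs_norm f"
proof -
  have iso: "fs_norm (fock_letter \<sigma> x (Gen (Inr i)) f) = fs_norm f" if "finsupp f" for f i
  proof -
    have "fock_letter \<sigma> x (Gen_star (Inr i)) (fock_letter \<sigma> x (Gen (Inr i)) f) = f"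
      by auto
    then have "fs_inner (fock_letter \<sigma> x (Gen (Inr i)) f) (fock_letter \<sigma> x (Gen (Inr i)) f) = fs_inner f f"
      using that by (simp add: fs_inner_fock_letter finsupp_fock_letter)
    then have "(fs_norm (fock_letter \<sigma> x (Gen (Inr i)) f))\<^sup>2 = (fs_norm f)\<^sup>2"
      using that by (simp add: fs_inner_self finsupp_fock_letter flip: of_real_power)
    then show ?thesis
      by simp
  qed
  have coiso: "fs_norm (fock_letter \<sigma> x (Gen_star (Inr i)) f) \<le> fs_norm f" if f: "finsupp f" for f i
  proof -
    let ?g = "fock_letter \<sigma> x (Gen_star (Inr i)) f"
    have "(fs_norm ?g)\<^sup>2 = cmod (fs_inner ?g ?g)"
      using f by (simp add: fs_inner_self finsupp_fock_letter norm_power)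
    also have "\<dots> = cmod (fs_inner f (fock_letter \<sigma> x (Gen (Inr i)) ?g))"
      using f by (simp only: fs_inner_fock_letter finsupp_fock_letter letter_star.simps)
    also have "\<dots> \<le> fs_norm f * fs_norm ?g"
      using fs_Cauchy_Schwarz[OF f finsupp_fock_letter[OF finsupp_fock_letter[OF f]]] iso finsupp_fock_letter[OF f]
      by metis
    finally show ?thesis
      by (cases "fs_norm ?g = 0") (auto simp: power2_eq_square mult_le_cancel_right order.strict_iff_order)
  qed
  show ?thesis
  proof (cases l rule: letter_sum_cases)
    case (1 a)
    then have "fock_letter \<sigma> x l f = (\<lambda>w. apply_bcontfun a (orbit \<sigma> w x) * f w)" for f
      by auto
    then show ?thesis
      by (auto intro!: exI[of _ "norm a"] fs_norm_mult_le norm_bounded)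
  next
    case (2 a)
    then have "fock_letter \<sigma> x l f = (\<lambda>w. cnj (apply_bcontfun a (orbit \<sigma> w x)) * f w)" for f
      by auto
    then show ?thesis
      by (auto intro!: exI[of _ "norm a"] fs_norm_mult_le norm_bounded)
  next
    case (3 i)
    then show ?thesis
      using iso by (auto intro!: exI[of _ 1])
  next
    case (4 i)
    then show ?thesis
      using coiso by (auto intro!: exI[of _ 1])
  qed
qed

lemma fs_norm_fock_monomial_bound:
  "\<exists>C\<ge>0. \<forall>f. finsupp f \<longrightarrow> fs_norm (fock_monomial \<sigma> x m f) \<le> C * fs_norm f"
proof -
  have "\<exists>C\<ge>0. \<forall>f. finsupp f \<longrightarrow> fs_norm (foldr (fock_letter \<sigma> x) ls f) \<le> C * fs_norm f" for ls
  proof (induction ls)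
    case Nil
    show ?case
      by (auto intro!: exI[of _ 1])
  next
    case (Cons l ls)
    then obtain C where C: "C \<ge> 0" "\<And>f. finsupp f \<Longrightarrow> fs_norm (foldr (fock_letter \<sigma> x) ls f) \<le> C * fs_norm f"
      by blast
    obtain K where K: "K \<ge> 0" "\<And>f. finsupp f \<Longrightarrow> fs_norm (fock_letter \<sigma> x l f) \<le> K * fs_norm f"
      using fs_norm_fock_letter_bound by blast
    have "fs_norm (foldr (fock_letter \<sigma> x) (l # ls) f) \<le> (K * C) * fs_norm f" if "finsupp f" for f
      using K(2)[of "foldr (fock_letter \<sigma> x) ls f"] mult_left_mono[OF C(2)[OF that] K(1)]
        finsupp_fock_monomial[OF that, of \<sigma> x "Monomial ls"] by (simp add: fock_monomial_def mult.assoc)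
    then show ?case
      using C(1) K(1) by (intro exI[of _ "K * C"]) auto
  qed
  then show ?thesis
    by (simp add: fock_monomial_def)
qed

lemma fs_norm_fock_poly_bound:
  "\<exists>C\<ge>0. \<forall>f. finsupp f \<longrightarrow> fs_norm (fock_poly \<sigma> x p f) \<le> C * fs_norm f"
proof -
  have "\<exists>C. \<forall>m. C m \<ge> 0 \<and> (\<forall>f. finsupp f \<longrightarrow> fs_norm (fock_monomial \<sigma> x m f) \<le> C m * fs_norm f)"
    using fs_norm_fock_monomial_bound[of \<sigma> x] by (intro choice) blast
  then obtain C where C: "C m \<ge> 0" "\<And>f. finsupp f \<Longrightarrow> fs_norm (fock_monomial \<sigma> x m f) \<le> C m * fs_norm f" for m
    by blast
  show ?thesis
  proof (intro exI[of _ "\<Sum>m\<in>Poly_Mapping.keys p. cmod (Poly_Mapping.lookup p m) * C m"] conjI allI impI)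
    show "0 \<le> (\<Sum>m\<in>Poly_Mapping.keys p. cmod (Poly_Mapping.lookup p m) * C m)"
      using C by (auto intro!: sum_nonneg)
    fix f :: "'a list \<Rightarrow> complex"
    assume f: "finsupp f"
    have "fs_norm (fock_poly \<sigma> x p f) \<le>
        (\<Sum>m\<in>Poly_Mapping.keys p. fs_norm (\<lambda>w. Poly_Mapping.lookup p m * fock_monomial \<sigma> x m f w))"
      unfolding fock_poly_expand by (intro fs_norm_sum finsupp_mult finsupp_fock_monomial f)
    also have "\<dots> \<le> (\<Sum>m\<in>Poly_Mapping.keys p. cmod (Poly_Mapping.lookup p m) * (C m * fs_norm f))"
    proof (rule sum_mono)
      fix m
      have "fs_norm (\<lambda>w. Poly_Mapping.lookup p m * fock_monomial \<sigma> x m f w) \<le>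
          cmod (Poly_Mapping.lookup p m) * fs_norm (fock_monomial \<sigma> x m f)"
        by (rule fs_norm_mult_le) (auto intro: finsupp_fock_monomial f)
      also have "\<dots> \<le> cmod (Poly_Mapping.lookup p m) * (C m * fs_norm f)"
        by (intro mult_left_mono C f) auto
      finally show "fs_norm (\<lambda>w. Poly_Mapping.lookup p m * fock_monomial \<sigma> x m f w) \<le>
          cmod (Poly_Mapping.lookup p m) * (C m * fs_norm f)" .
    qed
    also have "\<dots> = (\<Sum>m\<in>Poly_Mapping.keys p. cmod (Poly_Mapping.lookup p m) * C m) * fs_norm f"
      by (simp add: sum_distrib_right mult.assoc)
    finally show "fs_norm (fock_poly \<sigma> x p f) \<le>
        (\<Sum>m\<in>Poly_Mapping.keys p. cmod (Poly_Mapping.lookup p m) * C m) * fs_norm f" .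
  qed
qed

section \<open>The operator seminorm of a Fock representation\<close>

definition fock_norm :: "('n \<Rightarrow> 'x::topological_space \<Rightarrow> 'x) \<Rightarrow> 'x \<Rightarrow>
    (('x \<Rightarrow>\<^sub>C complex) + 'n) star_poly \<Rightarrow> real" where
  "fock_norm \<sigma> x p = Inf {C. C \<ge> 0 \<and> (\<forall>f. finsupp f \<longrightarrow> fs_norm (fock_poly \<sigma> x p f) \<le> C * fs_norm f)}"

lemma fock_norm_least:
  assumes "C \<ge> 0" "\<And>f. finsupp f \<Longrightarrow> fs_norm (fock_poly \<sigma> x p f) \<le> C * fs_norm f"
  shows "fock_norm \<sigma> x p \<le> C"
  unfolding fock_norm_def by (rule cInf_lower) (use assms in auto)

lemma fock_norm_nonneg: "0 \<le> fock_norm \<sigma> x p"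
  unfolding fock_norm_def by (rule cInf_greatest) (use fs_norm_fock_poly_bound in auto)

lemma fock_norm_bound:
  assumes f: "finsupp f"
  shows "fs_norm (fock_poly \<sigma> x p f) \<le> fock_norm \<sigma> x p * fs_norm f"
proof (cases "fs_norm f = 0")
  case True
  then show ?thesis
    using fs_norm_fock_poly_bound[of \<sigma> x p] f by fastforce
next
  case False
  then have pos: "fs_norm f > 0"
    using fs_norm_nonneg[of f] by linarith
  have "fs_norm (fock_poly \<sigma> x p f) / fs_norm f \<le> fock_norm \<sigma> x p"
    unfolding fock_norm_def
    by (rule cInf_greatest) (use fs_norm_fock_poly_bound f pos in \<open>auto simp: field_simps\<close>)
  then show ?thesis
    using pos by (simp add: field_simps)
qed

text \<open>For \<open>g\<close>, the image of \<open>f\<close> under the adjoint of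
  \<open>p\<close>, adjointness gives \<open>|g|^2 = <p g, f> \<le> |p| |g| |f|\<close>. This one
  inequality is what the C*-identity requires.\<close>

lemma fock_norm_star_le: "fock_norm \<sigma> x (poly_star p) \<le> fock_norm \<sigma> x p"
proof (rule fock_norm_least[OF fock_norm_nonneg])
  fix f :: "'a list \<Rightarrow> complex"
  assume f: "finsupp f"
  let ?g = "fock_poly \<sigma> x (poly_star p) f"
  have g: "finsupp ?g"
    using f by (rule finsupp_fock_poly)
  have "(fs_norm ?g)\<^sup>2 = cmod (fs_inner ?g ?g)"
    using g by (simp add: fs_inner_self norm_power)
  also have "\<dots> = cmod (fs_inner (fock_poly \<sigma> x p ?g) f)"
    using f g by (simp add: fs_inner_fock_poly)
  also have "\<dots> \<le> fs_norm (fock_poly \<sigma> x p ?g) * fs_norm f"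
    by (intro fs_Cauchy_Schwarz finsupp_fock_poly f)
  also have "\<dots> \<le> (fock_norm \<sigma> x p * fs_norm ?g) * fs_norm f"
    by (intro mult_right_mono fock_norm_bound g) auto
  finally have "fs_norm ?g * fs_norm ?g \<le> (fock_norm \<sigma> x p * fs_norm f) * fs_norm ?g"
    by (simp add: power2_eq_square algebra_simps)
  then show "fs_norm ?g \<le> fock_norm \<sigma> x p * fs_norm f"
    using fs_norm_nonneg[of ?g] fock_norm_nonneg[of \<sigma> x p] fs_norm_nonneg[of f]
    by (cases "fs_norm ?g = 0") (auto simp: mult_le_cancel_right)
qed

text \<open>This makes the Fock seminorm a competitor in the definition of the universal
  norm.\<close>

lemma cstar_seminorm_fock_norm:
  fixes \<sigma> :: "'n \<Rightarrow> 'x::topological_space \<Rightarrow> 'x"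
  shows "cstar_seminorm (fock_norm \<sigma> x)"
  unfolding cstar_seminorm_def
proof safe
  fix p q and c :: complex
  show "fock_norm \<sigma> x (p + q) \<le> fock_norm \<sigma> x p + fock_norm \<sigma> x q"
  proof (rule fock_norm_least)
    fix f :: "'n list \<Rightarrow> complex"
    assume f: "finsupp f"
    have "fock_poly \<sigma> x (p + q) f = (\<lambda>w. fock_poly \<sigma> x p f w + fock_poly \<sigma> x q f w)"
      by (simp add: fun_eq_iff fock_poly_add)
    then have "fs_norm (fock_poly \<sigma> x (p + q) f) \<le> fs_norm (fock_poly \<sigma> x p f) + fs_norm (fock_poly \<sigma> x q f)"
      using fs_norm_add[OF finsupp_fock_poly[OF f] finsupp_fock_poly[OF f]] by simp
    then show "fs_norm (fock_poly \<sigma> x (p + q) f) \<le> (fock_norm \<sigma> x p + fock_norm \<sigma> x q) * fs_norm f"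
      using fock_norm_bound[OF f, of \<sigma> x p] fock_norm_bound[OF f, of \<sigma> x q] by (simp add: distrib_right)
  qed (simp add: fock_norm_nonneg)
  have scale_le: "fock_norm \<sigma> x (poly_scale c p) \<le> cmod c * fock_norm \<sigma> x p" for c p
  proof (rule fock_norm_least)
    fix f :: "'n list \<Rightarrow> complex"
    assume f: "finsupp f"
    have "fock_poly \<sigma> x (poly_scale c p) f = (\<lambda>w. c * fock_poly \<sigma> x p f w)"
      by (simp add: fun_eq_iff fock_poly_scale)
    then have "fs_norm (fock_poly \<sigma> x (poly_scale c p) f) \<le> cmod c * fs_norm (fock_poly \<sigma> x p f)"
      using fs_norm_mult_le[OF finsupp_fock_poly[OF f], of "\<lambda>_. c" "cmod c" \<sigma> x p] by simp
    also have "\<dots> \<le> cmod c * (fock_norm \<sigma> x p * fs_norm f)"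
      by (intro mult_left_mono fock_norm_bound f) auto
    finally show "fs_norm (fock_poly \<sigma> x (poly_scale c p) f) \<le> cmod c * fock_norm \<sigma> x p * fs_norm f"
      by (simp add: mult.assoc)
  qed (simp add: fock_norm_nonneg)
  show "fock_norm \<sigma> x (poly_scale c p) = cmod c * fock_norm \<sigma> x p"
  proof (cases "c = 0")
    case True
    then show ?thesis
      using scale_le[of c p] fock_norm_nonneg[of \<sigma> x "poly_scale c p"] by simp
  next
    case False
    \<comment> \<open>The reverse inequality is the same estimate for
      \<open>inverse c\<close>.\<close>
    have "poly_scale (inverse c) (poly_scale c p) = p"
      using False by (simp add: poly_scale_def mult_single flip: mult.assoc)
    then have "fock_norm \<sigma> x p \<le> inverse (cmod c) * fock_norm \<sigma> x (poly_scale c p)"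
      using scale_le[of "inverse c" "poly_scale c p"] by (simp add: norm_inverse)
    then show ?thesis
      using False scale_le[of c p] by (auto simp: field_simps intro: antisym)
  qed
  show mult: "fock_norm \<sigma> x (p * q) \<le> fock_norm \<sigma> x p * fock_norm \<sigma> x q" for p q
  proof (rule fock_norm_least)
    fix f :: "'n list \<Rightarrow> complex"
    assume f: "finsupp f"
    have "fock_poly \<sigma> x (p * q) f = fock_poly \<sigma> x p (fock_poly \<sigma> x q f)"
      by (simp add: fun_eq_iff fock_poly_mult)
    then have "fs_norm (fock_poly \<sigma> x (p * q) f) \<le> fock_norm \<sigma> x p * fs_norm (fock_poly \<sigma> x q f)"
      by (simp add: fock_norm_bound finsupp_fock_poly f)
    also have "\<dots> \<le> fock_norm \<sigma> x p * (fock_norm \<sigma> x q * fs_norm f)"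
      by (intro mult_left_mono fock_norm_bound f fock_norm_nonneg)
    finally show "fs_norm (fock_poly \<sigma> x (p * q) f) \<le> fock_norm \<sigma> x p * fock_norm \<sigma> x q * fs_norm f"
      by (simp add: mult.assoc)
  qed (simp add: fock_norm_nonneg)
  show "fock_norm \<sigma> x (poly_star p * p) = (fock_norm \<sigma> x p)\<^sup>2"
  proof (rule antisym)
    have "fock_norm \<sigma> x (poly_star p) * fock_norm \<sigma> x p \<le> fock_norm \<sigma> x p * fock_norm \<sigma> x p"
      by (intro mult_right_mono fock_norm_star_le fock_norm_nonneg)
    then show "fock_norm \<sigma> x (poly_star p * p) \<le> (fock_norm \<sigma> x p)\<^sup>2"
      using mult[of "poly_star p" p] by (simp add: power2_eq_square)
    \<comment> \<open>By adjointness \<open>|p f|^2\<close> is the inner product of \<open>f\<close>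
      with \<open>star p * p\<close> applied to \<open>f\<close>, which Cauchy-Schwarz
      bounds.\<close>
    have "fock_norm \<sigma> x p \<le> sqrt (fock_norm \<sigma> x (poly_star p * p))"
    proof (rule fock_norm_least)
      fix f :: "'n list \<Rightarrow> complex"
      assume f: "finsupp f"
      let ?g = "fock_poly \<sigma> x p f"
      have "fock_poly \<sigma> x (poly_star p) ?g = fock_poly \<sigma> x (poly_star p * p) f"
        by (simp add: fun_eq_iff fock_poly_mult)
      then have "complex_of_real ((fs_norm ?g)\<^sup>2) = fs_inner f (fock_poly \<sigma> x (poly_star p * p) f)"
        using f fs_inner_fock_poly[OF f finsupp_fock_poly[OF f], of \<sigma> x p \<sigma> x p]
        by (simp add: fs_inner_self finsupp_fock_poly)
      then have "(fs_norm ?g)\<^sup>2 = cmod (fs_inner f (fock_poly \<sigma> x (poly_star p * p) f))"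
        by (metis abs_of_nonneg norm_of_real zero_le_power2)
      also have "\<dots> \<le> fs_norm f * fs_norm (fock_poly \<sigma> x (poly_star p * p) f)"
        by (intro fs_Cauchy_Schwarz finsupp_fock_poly f)
      also have "\<dots> \<le> fs_norm f * (fock_norm \<sigma> x (poly_star p * p) * fs_norm f)"
        by (intro mult_left_mono fock_norm_bound f) auto
      finally have "fs_norm ?g \<le> sqrt (fs_norm f * (fock_norm \<sigma> x (poly_star p * p) * fs_norm f))"
        by (rule real_le_rsqrt)
      then show "fs_norm ?g \<le> sqrt (fock_norm \<sigma> x (poly_star p * p)) * fs_norm f"
        using fs_norm_nonneg[of f] by (simp add: real_sqrt_mult mult.left_commute mult.commute flip: mult.assoc)
    qed (simp add: fock_norm_nonneg)
    then show "(fock_norm \<sigma> x p)\<^sup>2 \<le> fock_norm \<sigma> x (poly_star p * p)"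
      using fock_norm_nonneg[of \<sigma> x] sqrt_ge_absD by fastforce
  qed
qed

lemma apply_comp_op:
  assumes "continuous_on UNIV s"
  shows "apply_bcontfun (comp_op s f) x = apply_bcontfun f (s x)"
proof -
  have "apply_bcontfun f \<circ> s \<in> bcontfun"
    by (rule bcontfun_normI[where b = "norm f"])
      (auto simp: norm_bounded comp_def intro!: continuous_on_compose2[OF continuous_on_apply_bcontfun assms])
  then show ?thesis
    by (simp add: comp_op_def Bcontfun_inverse)
qed

lemma toeplitz_relationsE:
  assumes "r \<in> toeplitz_relations \<alpha>"
  obtains (add) a b where "r = gen (Inl (a + b)) - (gen (Inl a) + gen (Inl b))"
  | (scale) c a where "r = gen (Inl (c *\<^sub>C a)) - poly_scale c (gen (Inl a))"
  | (mult) a b where "r = gen (Inl (a * b)) - gen (Inl a) * gen (Inl b)"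
  | (star) a where "r = gen (Inl (star a)) - poly_star (gen (Inl a))"
  | (one) "r = gen (Inl 1) - 1"
  | (isometry) i j where "r = poly_star (gen (Inr i)) * gen (Inr j) - (if i = j then 1 else 0)"
  | (covariance) a i where "r = gen (Inl a) * gen (Inr i) - gen (Inr i) * gen (Inl (\<alpha> i a))"
  using assms unfolding toeplitz_relations_def Let_def Un_iff mem_Collect_eq singleton_iff by metis

text \<open>Covariance is \<open>orbit \<sigma> (i # w) x = \<sigma> i (orbit \<sigma> w x)\<close>;
  the isometry relations say that prefixing a letter and removing one restores the vector or gives
  0. The other relations hold coordinatewise.\<close>

lemma fock_poly_toeplitz_relations:
  assumes "\<And>i. continuous_on UNIV (\<sigma> i)" "r \<in> toeplitz_relations (classical_system \<sigma>)"
  shows "fock_poly \<sigma> x r f w = 0"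
proof -
  have gen: "fock_poly \<sigma> x (gen g) f = fock_letter \<sigma> x (Gen g) f" for g f
    by auto
  show ?thesis
    using assms(2)
    by (cases rule: toeplitz_relationsE)
      (auto simp: fock_poly_diff fock_poly_add fock_poly_mult fock_poly_scale gen distrib_right mult.assoc
        classical_system_def apply_comp_op[OF assms(1)] simp del: fock_poly_gen split: list.splits)
qed


section \<open>KMS states of periodic flows\<close>

text \<open>Pairing with functionals turns norm-differentiable extensions into scalar entire
  functions, to which the identity theorem and primitives apply.\<close>

lemma entire_extension_holomorphic:
  assumes "entire_extension \<sigma> x F" and f: "cbounded_linear (f :: 'b::cstar_algebra \<Rightarrow> complex)"
  shows "(\<lambda>z. f (F z)) holomorphic_on UNIV"
  unfolding holomorphic_on_def
proof
  fix z
  obtain D where D: "((\<lambda>h. inverse h *\<^sub>C (F (z + h) - F z)) \<longlongrightarrow> D) (at 0)"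
    using assms(1) by (auto simp: entire_extension_def)
  note lin = cbounded_linearD[OF f]
  have "((\<lambda>h. f (inverse h *\<^sub>C (F (z + h) - F z))) \<longlongrightarrow> f D) (at 0)"
    by (rule bounded_linear.tendsto[OF lin(1) D])
  then have "((\<lambda>h. (f (F (z + h)) - f (F z)) / h) \<longlongrightarrow> f D) (at 0)"
    by (simp add: lin divide_inverse mult.commute)
  then have "((\<lambda>z. f (F z)) has_field_derivative f D) (at z)"
    by (simp add: DERIV_def)
  then show "(\<lambda>z. f (F z)) field_differentiable (at z within UNIV)"
    using field_differentiable_def by blast
qed

text \<open>Identity theorem: the zeros of \<open>f - g\<close> contain the reals, which accumulate
  at 0.\<close>

lemma entire_eqI:
  fixes f g :: "complex \<Rightarrow> complex"
  assumes "f holomorphic_on UNIV" "g holomorphic_on UNIV" "\<And>t. f (of_real t) = g (of_real t)"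
  shows "f z = g z"
proof -
  have "(\<lambda>z. f z - g z) holomorphic_on UNIV"
    by (intro holomorphic_intros assms)
  moreover have "(0 :: complex) islimpt \<real>"
  proof (rule islimptI)
    fix T :: "complex set"
    assume "0 \<in> T" "open T"
    then obtain e where "e > 0" "ball 0 e \<subseteq> T"
      using open_contains_ball by blast
    then have "complex_of_real (e / 2) \<in> T"
      by (auto simp: dist_norm subset_iff)
    then show "\<exists>y\<in>\<real>. y \<in> T \<and> y \<noteq> 0"
      using \<open>e > 0\<close> by (intro bexI[of _ "complex_of_real (e / 2)"]) auto
  qed
  ultimately have "f z - g z = 0"
    using analytic_continuation[of "\<lambda>z. f z - g z" UNIV \<real> 0 z] assms(3) by (auto elim!: Reals_cases)
  then show ?thesis
    by simp
qed

text \<open>On the convex line \<open>Im z = s\<close> the function \<open>H z - c z\<close> has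
  derivative of size at most \<open>e\<close>, and the two points are 2 pi apart. Increments of a
  primitive thus replace integrals over a period.\<close>

lemma primitive_increment_bound:
  assumes "\<And>z. (H has_field_derivative h z) (at z)" "\<And>z. Im z = s \<Longrightarrow> cmod (h z - c) \<le> e"
  shows "cmod (H (of_real (2 * pi) + \<i> * of_real s) - H (\<i> * of_real s) - of_real (2 * pi) * c) \<le> 2 * pi * e"
proof -
  let ?S = "{z. Im z = s}"
  have "convex ?S"
    by (auto intro!: convexI simp flip: distrib_right)
  have "cmod ((H (of_real (2 * pi) + \<i> * of_real s) - c * (of_real (2 * pi) + \<i> * of_real s)) -
      (H (\<i> * of_real s) - c * (\<i> * of_real s))) \<le>
      e * cmod ((of_real (2 * pi) + \<i> * of_real s) - \<i> * of_real s)"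
  proof (rule field_differentiable_bound[OF \<open>convex ?S\<close>, where f' = "\<lambda>z. h z - c" and f = "\<lambda>z. H z - c * z"])
    fix z
    have "((\<lambda>z. H z - c * z) has_field_derivative h z - c) (at z)"
      using DERIV_diff[OF assms(1)[of z] DERIV_cmult_Id[of c z]] .
    then show "((\<lambda>z. H z - c * z) has_field_derivative h z - c) (at z within ?S)"
      by (rule has_field_derivative_at_within)
  qed (use assms(2) in auto)
  then show ?thesis
    by (simp add: algebra_simps)
qed

text \<open>
  By periodicity the increment of a primitive of \<open>z \<mapsto> exp (- \<i> k z) \<psi> (y F z)\<close> over \<open>[z, z + 2\<pi>]\<close>
  does not depend on \<open>z\<close>; comparing the lines \<open>Im z = 0\<close> and \<open>Im z = \<beta>\<close> extends the KMS condition to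
  spectral elements outside the dense subalgebra on which it is assumed.
\<close>

lemma kms_state_spectral:
  fixes \<sigma> :: "real \<Rightarrow> 'b::cstar_algebra \<Rightarrow> 'b" and k :: int
  assumes \<psi>: "\<psi> \<in> kms_states \<sigma> \<beta>"
    and lin: "\<And>t. cbounded_linear (\<sigma> t)" and contr: "\<And>t x. norm (\<sigma> t x) \<le> norm x"
    and group: "\<And>s t x. \<sigma> s (\<sigma> t x) = \<sigma> (s + t) x" and period: "\<And>x. \<sigma> (2 * pi) x = x"
    and x: "\<And>t. \<sigma> t x = cis (of_int k * t) *\<^sub>C x"
  shows "\<psi> (x * y) = of_real (exp (- (of_int k * \<beta>))) * \<psi> (y * x)"
proof -
  obtain D where D: "closure D = UNIV" "\<And>t x. x \<in> D \<Longrightarrow> \<sigma> t x \<in> D"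
      "\<And>x. x \<in> D \<Longrightarrow> \<exists>F. entire_extension \<sigma> x F"
      "\<And>x y F. x \<in> D \<Longrightarrow> y \<in> D \<Longrightarrow> entire_extension \<sigma> x F \<Longrightarrow> \<psi> (x * y) = \<psi> (y * F (\<i> * of_real \<beta>))"
    using \<psi> unfolding kms_states_def by blast
  have st: "cbounded_linear \<psi>"
    using \<psi> by (auto simp: kms_states_def intro: states_cbounded_linear)
  note \<psi>lin = cbounded_linearD[OF st]
  obtain K where K: "K > 0" "\<And>x. cmod (\<psi> x) \<le> norm x * K"
    using bounded_linear.pos_bounded[OF \<psi>lin(1)] by blast
  have bound: "2 * pi * cmod (\<psi> (y * x) - of_real (exp (of_int k * \<beta>)) * \<psi> (x * y)) \<le>
      2 * pi * ((1 + exp (of_int k * \<beta>)) * (norm y * K)) * norm (x' - x)" if x': "x' \<in> D" for x'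
  proof -
    obtain F where F: "entire_extension \<sigma> x' F"
      using D(3)[OF x'] by blast
    have Freal: "F (of_real t) = \<sigma> t x'" for t
      using F by (simp add: entire_extension_def)
    \<comment> \<open>The orbit of \<open>x'\<close> stays in \<open>D\<close>, and a translate of
      \<open>F\<close> extends the orbit of each of its points.\<close>
    have shift: "entire_extension \<sigma> (\<sigma> t x') (\<lambda>z. F (of_real t + z))" for t
      unfolding entire_extension_def
    proof safe
      fix z
      show "\<exists>D. ((\<lambda>h. inverse h *\<^sub>C (F (of_real t + (z + h)) - F (of_real t + z))) \<longlongrightarrow> D) (at 0)"
        using F unfolding entire_extension_def add.assoc[symmetric] by blast
      fix s
      show "F (of_real t + of_real s) = \<sigma> s (\<sigma> t x')"
        by (simp add: Freal group add.commute flip: of_real_add)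
    qed
    \<comment> \<open>The KMS condition asks for both arguments in \<open>D\<close>; density removes
      this restriction for \<open>y\<close>.\<close>
    have kms: "\<psi> (\<sigma> t x' * y) = \<psi> (y * F (of_real t + \<i> * of_real \<beta>))" for t y
    proof -
      have "(\<lambda>y. \<psi> (\<sigma> t x' * y)) = (\<lambda>y. \<psi> (y * F (of_real t + \<i> * of_real \<beta>)))"
        by (rule dense_eqI[OF D(1)])
          (auto intro!: continuous_on_compose2[OF \<psi>lin(8)] continuous_intros D(4)[OF D(2)[OF x'] _ shift])
      then show ?thesis
        by metis
    qed
    define f where "f z = \<psi> (y * F z)" for z
    have hol: "f holomorphic_on UNIV"
      unfolding f_def
      by (rule entire_extension_holomorphic[OF F cbounded_linear_compose[OF st cbounded_linear_mult_left]])
    have per: "f (z + of_real (2 * pi)) = f z" for z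
    proof (rule entire_eqI[of "\<lambda>z. f (z + of_real (2 * pi))" f])
      show "(\<lambda>z. f (z + of_real (2 * pi))) holomorphic_on UNIV"
        using holomorphic_on_compose[of "\<lambda>z. z + of_real (2 * pi)" UNIV f]
          holomorphic_on_subset[OF hol subset_UNIV]
        by (simp add: comp_def holomorphic_on_add)
      fix t
      show "f (of_real t + of_real (2 * pi)) = f (of_real t)"
        using group[of t "2 * pi" x'] Freal[of "t + 2 * pi"] by (simp add: f_def Freal period)
    qed (rule hol)
    \<comment> \<open>For \<open>x' = x\<close> this function would be constant on each of the two
      lines: \<open>\<psi> (y * x)\<close> where \<open>Im z = 0\<close> and
      \<open>exp (k * \<beta>) * \<psi> (x * y)\<close> where \<open>Im z = \<beta>\<close>.\<close>
    define h where "h z = exp (- \<i> * of_int k * z) * f z" for z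
    have h_hol: "h holomorphic_on UNIV"
      unfolding h_def by (intro holomorphic_intros hol)
    have h_per: "h (z + of_real (2 * pi)) = h z" for z
    proof -
      have "exp (- \<i> * of_int k * (z + of_real (2 * pi))) = exp (- \<i> * of_int k * z)"
        by (rule exp_eq[THEN iffD2], rule exI[of _ "- k"]) (simp add: algebra_simps)
      then show ?thesis
        by (simp only: h_def per)
    qed
    obtain H where H: "(H has_field_derivative h z) (at z)" for z
      using holomorphic_convex_primitive'[OF convex_UNIV open_UNIV h_hol] by auto
    \<comment> \<open>The integral of \<open>h\<close> from \<open>z\<close> to
      \<open>z + 2 * pi\<close>; its derivative \<open>h (z + 2 * pi) - h z\<close> vanishes by
      periodicity.\<close>
    define \<Delta> where "\<Delta> z = H (z + of_real (2 * pi)) - H z" for z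
    have "(\<Delta> has_field_derivative 0) (at z)" for z
    proof -
      have "((\<lambda>z. H (z + of_real (2 * pi))) has_field_derivative h (z + of_real (2 * pi))) (at z)"
        using DERIV_shift[of H "h (z + of_real (2 * pi))" z "of_real (2 * pi)"] H by simp
      then show ?thesis
        unfolding \<Delta>_def using DERIV_diff[OF _ H[of z]] h_per[of z] by fastforce
    qed
    then obtain c where c: "\<Delta> z = c" for z
      using has_field_derivative_zero_constant[of UNIV \<Delta>] by auto
    \<comment> \<open>The deviation from the constant is linear in \<open>x' - x\<close> because the
      flow is contractive.\<close>
    have lower: "cmod (h z - \<psi> (y * x)) \<le> norm y * K * norm (x' - x)" if "Im z = 0" for z
    proof -
      obtain t where t: "z = of_real t"
        using \<open>Im z = 0\<close> by (metis complex_is_Real_iff Reals_cases)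
      have e: "exp (- \<i> * of_int k * z) = cis (- (of_int k * t))"
        by (simp add: t cis_conv_exp algebra_simps)
      have "h z - \<psi> (y * x) = cis (- (of_int k * t)) * \<psi> (y * \<sigma> t (x' - x))"
        unfolding h_def e f_def
        by (simp add: t Freal cbounded_linearD(5)[OF lin] x \<psi>lin(5,6) right_diff_distrib cscale_mult_right
            cis_mult flip: mult.assoc)
      moreover have "norm (y * \<sigma> t (x' - x)) * K \<le> (norm y * norm (x' - x)) * K"
        using K(1) contr[of t "x' - x"]
        by (intro mult_right_mono order_trans[OF norm_mult_ineq] mult_left_mono) auto
      ultimately show ?thesis
        using K(2)[of "y * \<sigma> t (x' - x)"] by (simp add: norm_mult algebra_simps)
    qed
    have upper: "cmod (h z - of_real (exp (of_int k * \<beta>)) * \<psi> (x * y)) \<le>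
        exp (of_int k * \<beta>) * (norm y * K) * norm (x' - x)" if "Im z = \<beta>" for z
    proof -
      define t where "t = Re z"
      have z: "z = of_real t + \<i> * of_real \<beta>"
        using \<open>Im z = \<beta>\<close> by (simp add: t_def complex_eq_iff)
      have e: "exp (- \<i> * of_int k * z) = of_real (exp (of_int k * \<beta>)) * cis (- (of_int k * t))"
        by (simp add: z cis_conv_exp exp_of_real[symmetric] algebra_simps flip: exp_add)
      have "h z - of_real (exp (of_int k * \<beta>)) * \<psi> (x * y) =
          of_real (exp (of_int k * \<beta>)) * (cis (- (of_int k * t)) * \<psi> (\<sigma> t (x' - x) * y))"
        unfolding h_def e f_def
        by (simp add: z kms[symmetric] cbounded_linearD(5)[OF lin] x \<psi>lin(5,6) left_diff_distrib
            right_diff_distrib cscale_mult_left)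
          (simp add: cis_mult flip: mult.assoc)
      moreover have "norm (\<sigma> t (x' - x) * y) * K \<le> (norm (x' - x) * norm y) * K"
        using K(1) contr[of t "x' - x"]
        by (intro mult_right_mono order_trans[OF norm_mult_ineq] mult_mono) auto
      ultimately show ?thesis
        using K(2)[of "\<sigma> t (x' - x) * y"] by (simp add: norm_mult algebra_simps)
    qed
    let ?a = "H (of_real (2 * pi)) - H 0" and ?P = "complex_of_real (2 * pi)"
    have a0: "cmod (c - ?P * \<psi> (y * x)) \<le> 2 * pi * (norm y * K * norm (x' - x))"
      using primitive_increment_bound[OF H lower, of 0] c[of 0] by (simp add: \<Delta>_def)
    have a1: "cmod (c - ?P * (of_real (exp (of_int k * \<beta>)) * \<psi> (x * y))) \<le>
        2 * pi * (exp (of_int k * \<beta>) * (norm y * K) * norm (x' - x))"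
      using primitive_increment_bound[OF H upper, of \<beta>] c[of "\<i> * of_real \<beta>"]
      by (simp only: \<Delta>_def add.commute)
    have "2 * pi * cmod (\<psi> (y * x) - of_real (exp (of_int k * \<beta>)) * \<psi> (x * y)) =
        cmod ((c - ?P * (of_real (exp (of_int k * \<beta>)) * \<psi> (x * y))) - (c - ?P * \<psi> (y * x)))"
      by (simp add: norm_mult flip: right_diff_distrib)
    also have "\<dots> \<le> 2 * pi * (exp (of_int k * \<beta>) * (norm y * K) * norm (x' - x)) +
        2 * pi * (norm y * K * norm (x' - x))"
      using norm_triangle_ineq4 a0 a1 by (smt (verit))
    finally show ?thesis
      by (simp add: algebra_simps)
  qed
  \<comment> \<open>The estimate is a closed condition on \<open>x'\<close> and holds on the dense
    set \<open>D\<close>; so \<open>x' = x\<close> is allowed, where the right-hand side is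
    0.\<close>
  have "2 * pi * cmod (\<psi> (y * x) - of_real (exp (of_int k * \<beta>)) * \<psi> (x * y)) \<le>
      2 * pi * ((1 + exp (of_int k * \<beta>)) * (norm y * K)) * norm (x - x)"
    by (rule dense_induct[OF D(1), where P = "\<lambda>x'. 2 * pi *
        cmod (\<psi> (y * x) - of_real (exp (of_int k * \<beta>)) * \<psi> (x * y)) \<le>
      2 * pi * ((1 + exp (of_int k * \<beta>)) * (norm y * K)) * norm (x' - x)"])
      (intro closed_Collect_le continuous_intros, rule bound)
  then have "\<psi> (y * x) = of_real (exp (of_int k * \<beta>)) * \<psi> (x * y)"
    using pi_gt_zero by (auto simp: mult_le_0_iff simp del: pi_gt_zero)
  then show ?thesis
    by (simp add: exp_minus field_simps)
qed


section \<open>Covariant representations\<close>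

locale commutative_system =
  fixes \<alpha> :: "'n::finite \<Rightarrow> 'a::cstar_algebra \<Rightarrow> 'a"
  assumes hom: "star_hom (\<alpha> i)" and comm: "(a :: 'a) * b = b * a"
begin

lemma word_map_simps [simp]: "word_map \<alpha> [] = id" "word_map \<alpha> (i # w) = \<alpha> i \<circ> word_map \<alpha> w"
  by (simp_all add: word_map_def)

lemma word_map_append: "word_map \<alpha> (v @ w) = word_map \<alpha> v \<circ> word_map \<alpha> w"
  by (induction v) auto

lemma star_hom_word_map: "star_hom (word_map \<alpha> w)"
proof (induction w)
  case Nil
  show ?case
    by (simp add: star_hom_def bounded_linear_ident id_def)
next
  case (Cons i w)
  then show ?case
    using hom[of i] by (auto simp: star_hom_def o_def intro: bounded_linear_compose)
qed

lemmas word_map = star_homD[OF star_hom_word_map] cbounded_linearD[OF star_homD(1)[OF star_hom_word_map]]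

text \<open>The operator \<open>L\<close> of the overview.\<close>

definition transfer :: "'a \<Rightarrow> 'a" where
  "transfer a = (\<Sum>i\<in>UNIV. \<alpha> i a)"

lemma cbounded_linear_transfer: "cbounded_linear transfer"
  unfolding transfer_def by (intro cbounded_linear_sum star_homD(1) hom)

lemma words_Suc: "{w :: 'n list. length w = Suc m} = (\<lambda>(i, w). i # w) ` (UNIV \<times> {w. length w = m})"
  by (auto simp: image_iff length_Suc_conv)

lemma finite_words [simp]: "finite {w :: 'n list. length w = m}"
  using finite_lists_length_eq[of "UNIV :: 'n set" m] by simp

lemma sum_words_Suc:
  "(\<Sum>w | length w = Suc m. f w) = (\<Sum>w | length w = m. \<Sum>i\<in>UNIV. f (i # w :: 'n list))"
proof -
  have "inj_on (\<lambda>(i, w). i # w) (UNIV \<times> {w :: 'n list. length w = m})"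
    by (auto simp: inj_on_def)
  then show ?thesis
    unfolding words_Suc by (subst sum.reindex) (auto simp: sum.cartesian_product' sum.swap[of _ UNIV])
qed

text \<open>Reversal makes the head letter act innermost, so peeling it off and summing over it
  replaces \<open>a\<close> by \<open>transfer a\<close>.\<close>

lemma sum_word_map_rev: "(\<Sum>w | length w = m. word_map \<alpha> (rev w) a) = (transfer ^^ m) a"
proof (induction m arbitrary: a)
  case (Suc m)
  have "(\<Sum>w | length w = Suc m. word_map \<alpha> (rev w) a) =
      (\<Sum>w | length w = m. \<Sum>i\<in>UNIV. word_map \<alpha> (rev w) (\<alpha> i a))"
    by (simp add: sum_words_Suc word_map_append)
  also have "\<dots> = (\<Sum>w | length w = m. word_map \<alpha> (rev w) (transfer a))"
    by (simp add: transfer_def word_map)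
  finally show ?case
    by (simp add: Suc funpow_swap1)
qed simp

lemma card_words: "card {w :: 'n list. length w = m} = CARD('n) ^ m"
  using card_lists_length_eq[of "UNIV :: 'n set" m] by simp

lemma transfer_pow_one: "(transfer ^^ m) 1 = of_nat (CARD('n) ^ m)"
  by (simp add: word_map card_words flip: sum_word_map_rev)

end

text \<open>The relations and density without universality, so that the Toeplitz algebra and its
  quotient are both instances.\<close>

locale covariant_rep = commutative_system \<alpha>
  for \<alpha> :: "'n::finite \<Rightarrow> 'a::cstar_algebra \<Rightarrow> 'a" +
  fixes \<iota> :: "'a \<Rightarrow> 'b::cstar_algebra" and V :: "'n \<Rightarrow> 'b"
  assumes \<iota>_add: "\<iota> (a + b) = \<iota> a + \<iota> b" and \<iota>_scale: "\<iota> (c *\<^sub>C a) = c *\<^sub>C \<iota> a"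
    and \<iota>_mult: "\<iota> (a * b) = \<iota> a * \<iota> b" and \<iota>_star: "\<iota> (star a) = star (\<iota> a)"
    and \<iota>_one [simp]: "\<iota> 1 = 1"
    and isometry: "star (V i) * V j = (if i = j then 1 else 0)"
    and covariance: "\<iota> a * V i = V i * \<iota> (\<alpha> i a)"
    and dense: "closure (range (eval_poly (case_sum \<iota> V))) = UNIV"
begin

lemma \<iota>_zero [simp]: "\<iota> 0 = 0"
  using \<iota>_scale[of 0 0] by simp

lemma \<iota>_sum: "\<iota> (sum f I) = (\<Sum>i\<in>I. \<iota> (f i))"
  by (induction I rule: infinite_finite_induct) (auto simp: \<iota>_add)

lemma covariance': "star (V i) * \<iota> a = \<iota> (\<alpha> i a) * star (V i)"
proof -
  have "star (\<iota> (star a) * V i) = star (V i * \<iota> (\<alpha> i (star a)))"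
    by (simp add: covariance)
  then show ?thesis
    by (simp add: star_mult star_homD(4)[OF hom] flip: \<iota>_star)
qed

lemma word_prod_simps [simp]: "word_prod V [] = 1" "word_prod V (i # w) = V i * word_prod V w"
  by (simp_all add: word_prod_def)

lemma word_covariance: "\<iota> a * word_prod V \<mu> = word_prod V \<mu> * \<iota> (word_map \<alpha> (rev \<mu>) a)"
proof (induction \<mu> arbitrary: a)
  case (Cons i \<mu>)
  have "\<iota> a * word_prod V (i # \<mu>) = V i * (\<iota> (\<alpha> i a) * word_prod V \<mu>)"
    by (simp add: covariance flip: mult.assoc)
  then show ?case
    by (simp add: Cons word_map_append mult.assoc)
qed simp

lemma word_covariance':
  "star (word_prod V \<mu>) * \<iota> a = \<iota> (word_map \<alpha> (rev \<mu>) a) * star (word_prod V \<mu>)"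
proof -
  have "star (\<iota> (star a) * word_prod V \<mu>) = star (word_prod V \<mu> * \<iota> (word_map \<alpha> (rev \<mu>) (star a)))"
    by (simp add: word_covariance)
  then show ?thesis
    by (simp add: star_mult word_map flip: \<iota>_star)
qed

lemma word_isometry:
  "length \<mu> = length \<nu> \<Longrightarrow> star (word_prod V \<nu>) * word_prod V \<mu> = (if \<mu> = \<nu> then 1 else 0)"
proof (induction \<mu> \<nu> rule: list_induct2)
  case (Cons i \<mu> j \<nu>)
  have "star (word_prod V (j # \<nu>)) * word_prod V (i # \<mu>) =
      star (word_prod V \<nu>) * (star (V j) * V i) * word_prod V \<mu>"
    by (simp add: star_mult mult.assoc)
  then show ?case
    using Cons by (auto simp: isometry)
qed simp

definition elem :: "'n list \<Rightarrow> 'a \<Rightarrow> 'n list \<Rightarrow> 'b" where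
  "elem \<mu> a \<nu> = word_prod V \<mu> * \<iota> a * star (word_prod V \<nu>)"

lemma elem_zero [simp]: "elem \<mu> 0 \<nu> = 0"
  by (simp add: elem_def)

lemma elem_Nil [simp]: "elem [] a [] = \<iota> a"
  by (simp add: elem_def)

lemma V_elem: "V i * elem \<mu> a \<nu> = elem (i # \<mu>) a \<nu>"
  by (simp add: elem_def mult.assoc)

lemma \<iota>_elem: "\<iota> b * elem \<mu> a \<nu> = elem \<mu> (word_map \<alpha> (rev \<mu>) b * a) \<nu>"
  by (simp add: elem_def word_covariance \<iota>_mult flip: mult.assoc)

lemma elem_\<iota>: "elem \<mu> a \<nu> * \<iota> b = elem \<mu> (a * word_map \<alpha> (rev \<nu>) b) \<nu>"
  by (simp add: elem_def word_covariance' \<iota>_mult mult.assoc)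

lemma star_V_elem_Nil: "star (V i) * elem [] a \<nu> = elem [] (\<alpha> i a) (\<nu> @ [i])"
proof -
  have "word_prod V (\<nu> @ [i]) = word_prod V \<nu> * V i"
    by (simp add: word_prod_def)
  then show ?thesis
    by (simp add: elem_def covariance' star_mult flip: mult.assoc)
qed

lemma star_V_elem_Cons: "star (V i) * elem (j # \<mu>) a \<nu> = (if i = j then elem \<mu> a \<nu> else 0)"
  by (simp add: elem_def isometry flip: mult.assoc)

lemma elem_Cons_V: "elem \<mu> a (j # \<nu>) * V i = (if i = j then elem \<mu> a \<nu> else 0)"
  by (simp add: elem_def star_mult isometry mult.assoc)

lemma elem_Nil_V: "elem \<mu> a [] * V i = elem (\<mu> @ [i]) (\<alpha> i a) []"
  by (simp add: elem_def covariance word_prod_def mult.assoc)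

text \<open>Left multiplication by a letter preserves the form \<open>elem\<close>:
  \<open>star (V i)\<close> either meets the head of \<mu> or, if \<mu> is empty, passes through the
  coefficient and joins the word on the right.\<close>

lemma eval_monomial_elem: "\<exists>\<mu> a \<nu>. eval_monomial (case_sum \<iota> V) m = elem \<mu> a \<nu>"
proof -
  have "\<exists>\<mu> a \<nu>. prod_list (map (eval_letter (case_sum \<iota> V)) ls) = elem \<mu> a \<nu>" for ls
  proof (induction ls)
    case Nil
    show ?case
      by (metis \<iota>_one elem_Nil list.map(1) prod_list.Nil)
  next
    case (Cons l ls)
    then obtain \<mu> a \<nu> where *: "prod_list (map (eval_letter (case_sum \<iota> V)) ls) = elem \<mu> a \<nu>"
      by blast
    show ?case
    proof (cases l rule: letter_sum_cases)
      case (1 b)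
      then show ?thesis
        using * \<iota>_elem by auto
    next
      case (2 b)
      then show ?thesis
        using * \<iota>_elem by (auto simp flip: \<iota>_star)
    next
      case (3 i)
      then show ?thesis
        using * V_elem by auto
    next
      case (4 i)
      show ?thesis
      proof (cases \<mu>)
        case Nil
        then show ?thesis
          using 4 * star_V_elem_Nil by auto
      next
        case (Cons j \<mu>')
        \<comment> \<open>For different letters the product is 0, which is again an
          \<open>elem\<close>, with coefficient 0.\<close>
        then have "star (V i) * elem \<mu> a \<nu> = elem \<mu>' (if i = j then a else 0) \<nu>"
          by (simp add: star_V_elem_Cons)
        then have "prod_list (map (eval_letter (case_sum \<iota> V)) (l # ls)) = elem \<mu>' (if i = j then a else 0) \<nu>"
          using 4 * by (simp only: list.map prod_list.Cons eval_letter.simps sum.case)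
        then show ?thesis
          by blast
      qed
    qed
  qed
  then show ?thesis
    by (simp add: eval_monomial_def)
qed

lemma elem_expansionE:
  assumes "x \<in> range (eval_poly (case_sum \<iota> V))"
  obtains I :: "('a + 'n) monomial set" and c \<mu> a \<nu> where "finite I"
    "x = (\<Sum>m\<in>I. c m *\<^sub>C elem (\<mu> m) (a m) (\<nu> m))"
proof -
  obtain p where p: "x = eval_poly (case_sum \<iota> V) p"
    using assms by blast
  obtain \<mu> a \<nu> where "eval_monomial (case_sum \<iota> V) m = elem (\<mu> m) (a m) (\<nu> m)" for m
    using eval_monomial_elem by metis
  then have "x = (\<Sum>m\<in>Poly_Mapping.keys p. Poly_Mapping.lookup p m *\<^sub>C elem (\<mu> m) (a m) (\<nu> m))"
    by (simp add: p eval_poly_keys_sum keys_sum_def)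
  then show ?thesis
    using that[of "Poly_Mapping.keys p"] by simp
qed

lemma elem_in_range: "elem \<mu> a \<nu> \<in> range (eval_poly (case_sum \<iota> V))"
proof -
  have "prod_list (map V w) = eval_poly (case_sum \<iota> V) (prod_list (map (\<lambda>i. gen (Inr i)) w))" for w
    by (induction w) (auto simp: eval_poly_mult)
  then have "elem \<mu> a \<nu> = eval_poly (case_sum \<iota> V) (prod_list (map (\<lambda>i. gen (Inr i)) \<mu>) * gen (Inl a) *
      poly_star (prod_list (map (\<lambda>i. gen (Inr i)) \<nu>)))"
    by (simp add: elem_def word_prod_def eval_poly_mult eval_poly_star)
  then show ?thesis
    by simp
qed

lemma elem_induct:
  assumes "closed {x. P x}" "\<And>\<mu> a \<nu>. P (elem \<mu> a \<nu>)" "\<And>x y. P x \<Longrightarrow> P y \<Longrightarrow> P (x + y)"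
    "\<And>c x. P x \<Longrightarrow> P (c *\<^sub>C x)"
  shows "P x"
proof (rule dense_induct[OF dense assms(1)])
  fix x
  assume "x \<in> range (eval_poly (case_sum \<iota> V))"
  then obtain I :: "('a + 'n) monomial set" and c \<mu> a \<nu> where "finite I"
      and x: "x = (\<Sum>m\<in>I. c m *\<^sub>C elem (\<mu> m) (a m) (\<nu> m))"
    by (rule elem_expansionE)
  then show "P x"
    unfolding x
  proof (induction I)
    case empty
    show ?case
      using assms(2)[of "[]" 0 "[]"] by simp
  qed (auto intro: assms)
qed

lemma elem_eqI:
  assumes "cbounded_linear f" "cbounded_linear g" "\<And>\<mu> a \<nu>. f (elem \<mu> a \<nu>) = g (elem \<mu> a \<nu>)"
  shows "f = g"
proof
  fix x
  show "f x = g x"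
    by (rule elem_induct[where P = "\<lambda>x. f x = g x"])
      (use assms in \<open>auto intro!: closed_Collect_eq cbounded_linearD(8) simp: cbounded_linearD\<close>)
qed

text \<open>The KMS condition for an element of gauge degree \<open>k\<close>: its entire orbit has
  the value \<open>exp (- k \<beta>) x\<close> at \<open>\<i> \<beta>\<close>.\<close>

definition scaled_trace :: "('b \<Rightarrow> complex) \<Rightarrow> real \<Rightarrow> real \<Rightarrow> 'b \<Rightarrow> bool" where
  "scaled_trace \<psi> \<beta> k x \<longleftrightarrow> (\<forall>y. \<psi> (x * y) = of_real (exp (- (k * \<beta>))) * \<psi> (y * x))"

text \<open>First \<open>x\<close> and then \<open>y\<close> is carried cyclically around the
  product, so the degrees add.\<close>

lemma scaled_trace_mult:
  "scaled_trace \<psi> \<beta> k x \<Longrightarrow> scaled_trace \<psi> \<beta> l y \<Longrightarrow> scaled_trace \<psi> \<beta> (k + l) (x * y)"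
  unfolding scaled_trace_def
proof
  fix z
  assume x: "\<forall>z. \<psi> (x * z) = of_real (exp (- (k * \<beta>))) * \<psi> (z * x)"
    and y: "\<forall>z. \<psi> (y * z) = of_real (exp (- (l * \<beta>))) * \<psi> (z * y)"
  have "\<psi> (x * y * z) = of_real (exp (- (k * \<beta>))) * \<psi> (y * (z * x))"
    using x[rule_format, of "y * z"] by (simp add: mult.assoc)
  also have "\<dots> = of_real (exp (- (k * \<beta>)) * exp (- (l * \<beta>))) * \<psi> (z * (x * y))"
    using y[rule_format, of "z * x"] by (simp add: mult.assoc)
  also have "exp (- (k * \<beta>)) * exp (- (l * \<beta>)) = exp (- ((k + l) * \<beta>))"
    by (simp add: algebra_simps flip: exp_add)
  finally show "\<psi> (x * y * z) = of_real (exp (- ((k + l) * \<beta>))) * \<psi> (z * (x * y))" .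
qed

lemma scaled_trace_star:
  assumes "scaled_trace \<psi> \<beta> k x" "\<psi> \<in> states"
  shows "scaled_trace \<psi> \<beta> (- k) (star x)"
  unfolding scaled_trace_def
proof
  fix y
  note star = positive_functional_star[OF states_positive_functional[OF assms(2)]]
  have "\<psi> (x * star y) = of_real (exp (- (k * \<beta>))) * \<psi> (star y * x)"
    using assms(1) by (simp add: scaled_trace_def)
  then have "cnj (\<psi> (y * star x)) = of_real (exp (- (k * \<beta>))) * cnj (\<psi> (star x * y))"
    by (simp add: star_mult flip: star)
  then have "\<psi> (y * star x) = of_real (exp (- (k * \<beta>))) * \<psi> (star x * y)"
    by (metis complex_cnj_cnj complex_cnj_complex_of_real complex_cnj_mult)
  then show "\<psi> (star x * y) = of_real (exp (- (- k * \<beta>))) * \<psi> (y * star x)"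
    by (simp add: exp_minus field_simps)
qed

text \<open>Together with the restriction to the coefficient algebra these values determine a state,
  as the \<open>elem\<close>s span a dense subspace. For \<beta> \<noteq> 0 they single out the KMS
  states.\<close>

definition gauge_invariant_values :: "('b \<Rightarrow> complex) \<Rightarrow> real \<Rightarrow> bool" where
  "gauge_invariant_values \<psi> \<beta> \<longleftrightarrow> (\<forall>\<mu> \<nu> a. \<psi> (elem \<mu> a \<nu>) =
     (if \<mu> = \<nu> then of_real (exp (- (real (length \<mu>) * \<beta>))) * \<psi> (\<iota> a) else 0))"

text \<open>The property is stable under products and adjoints, so the generators suffice. For
  \<open>V i\<close> both sides compare the same pair of words, once with and once without the
  common letter \<open>i\<close> in front, which accounts for one factor
  \<open>exp (- \<beta>)\<close>.\<close>

lemma scaled_trace_elem: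
  assumes "\<psi> \<in> states" "gauge_invariant_values \<psi> \<beta>"
  shows "scaled_trace \<psi> \<beta> (real (length \<mu>) - real (length \<nu>)) (elem \<mu> a \<nu>)"
proof -
  note lin = cbounded_linearD[OF states_cbounded_linear[OF assms(1)]]
  note val = assms(2)[unfolded gauge_invariant_values_def, rule_format]
  have scaled_traceI: "scaled_trace \<psi> \<beta> k x"
    if "\<And>\<mu> a \<nu>. \<psi> (x * elem \<mu> a \<nu>) = of_real (exp (- (k * \<beta>))) * \<psi> (elem \<mu> a \<nu> * x)" for k x
    unfolding scaled_trace_def
  proof
    fix y
    have "(\<lambda>y. \<psi> (x * y)) = (\<lambda>y. of_real (exp (- (k * \<beta>))) *\<^sub>C \<psi> (y * x))"
      by (rule elem_eqI)
        (auto intro!: cbounded_linear_cscale cbounded_linear_compose[OF states_cbounded_linear[OF assms(1)]]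
          cbounded_linear_mult_left cbounded_linear_mult_right that simp del: cscale_complex_eq,
         simp add: that)
    then show "\<psi> (x * y) = of_real (exp (- (k * \<beta>))) * \<psi> (y * x)"
      by (metis cscale_complex_eq)
  qed
  have V: "scaled_trace \<psi> \<beta> 1 (V i)" for i
  proof (rule scaled_traceI)
    fix \<kappa> b \<xi>
    show "\<psi> (V i * elem \<kappa> b \<xi>) = of_real (exp (- (1 * \<beta>))) * \<psi> (elem \<kappa> b \<xi> * V i)"
      by (cases \<xi>) (auto simp: V_elem elem_Nil_V elem_Cons_V val lin exp_add distrib_right exp_diff
          exp_minus field_simps)
  qed
  \<comment> \<open>On the diagonal, the image of the coefficient multiplies the middle entry from
    the left or from the right; commutativity identifies the two.\<close>
  have A: "scaled_trace \<psi> \<beta> 0 (\<iota> a)" for a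
    by (rule scaled_traceI) (auto simp: \<iota>_elem elem_\<iota> val comm)
  have W: "scaled_trace \<psi> \<beta> (real (length w)) (word_prod V w)" for w
  proof (induction w)
    case Nil
    show ?case
      using A[of 1] by simp
  next
    case (Cons i w)
    then show ?case
      using scaled_trace_mult[OF V[of i] Cons] by simp
  qed
  show ?thesis
    using scaled_trace_mult[OF scaled_trace_mult[OF W[of \<mu>] A[of a]]
        scaled_trace_star[OF W[of \<nu>] assms(1)]]
    by (simp add: elem_def)
qed

end

text \<open>Existence of the gauge maps is an assumption here because it has two sources:
  universality for the Toeplitz algebra, descent for the quotient.\<close>

locale gauge_rep = covariant_rep \<alpha> \<iota> V
  for \<alpha> :: "'n::finite \<Rightarrow> 'a::cstar_algebra \<Rightarrow> 'a" and \<iota> :: "'a \<Rightarrow> 'b::cstar_algebra" and V +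
  assumes gauge_ex: "cmod z = 1 \<Longrightarrow>
    \<exists>g. star_hom g \<and> (\<forall>a. g (\<iota> a) = \<iota> a) \<and> (\<forall>i. g (V i) = z *\<^sub>C V i) \<and> (\<forall>x. norm (g x) \<le> norm x)"
begin

text \<open>The definite description is justified because a *-homomorphism is determined by its
  values on the generators.\<close>

lemma gauge_action:
  assumes "cmod z = 1"
  shows "star_hom (gauge_action \<iota> V z)" "gauge_action \<iota> V z (\<iota> a) = \<iota> a"
    "gauge_action \<iota> V z (V i) = z *\<^sub>C V i" "norm (gauge_action \<iota> V z x) \<le> norm x"
proof -
  obtain g where g: "star_hom g" "\<And>a. g (\<iota> a) = \<iota> a" "\<And>i. g (V i) = z *\<^sub>C V i"
      "\<And>x. norm (g x) \<le> norm x"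
    using gauge_ex[OF assms] by blast
  have "gauge_action \<iota> V z = g"
    unfolding gauge_action_def
  proof (rule the_equality)
    fix g'
    assume g': "star_hom g' \<and> (\<forall>a. g' (\<iota> a) = \<iota> a) \<and> (\<forall>i. g' (V i) = z *\<^sub>C V i)"
    then have "g' \<circ> case_sum \<iota> V = g \<circ> case_sum \<iota> V"
      using g by (auto simp: fun_eq_iff split: sum.splits)
    then show "g' = g"
      using star_hom_unique[OF dense] g g' by blast
  qed (use g in auto)
  then show "star_hom (gauge_action \<iota> V z)" "gauge_action \<iota> V z (\<iota> a) = \<iota> a"
    "gauge_action \<iota> V z (V i) = z *\<^sub>C V i" "norm (gauge_action \<iota> V z x) \<le> norm x"
    using g by auto
qed

lemma gauge_flow_hom: "star_hom (gauge_flow \<iota> V t)"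
  by (simp add: gauge_flow_def gauge_action)

lemma gauge_flow_contractive: "norm (gauge_flow \<iota> V t x) \<le> norm x"
  by (simp add: gauge_flow_def gauge_action)

lemma gauge_flow_elem:
  "gauge_flow \<iota> V t (elem \<mu> a \<nu>) = cis (of_int (int (length \<mu>) - int (length \<nu>)) * t) *\<^sub>C elem \<mu> a \<nu>"
proof -
  note g = star_homD[OF gauge_flow_hom[of t]]
  have W: "gauge_flow \<iota> V t (word_prod V w) = cis (real (length w) * t) *\<^sub>C word_prod V w" for w
  proof (induction w)
    case Nil
    show ?case
      by (simp add: g)
  next
    case (Cons i w)
    have "gauge_flow \<iota> V t (V i) = cis t *\<^sub>C V i"
      by (simp add: gauge_flow_def gauge_action)
    then show ?case
      by (simp add: g Cons cscale_mult_left cscale_mult_right cscale_cscale cis_mult algebra_simps)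
  qed
  have "gauge_flow \<iota> V t (\<iota> a) = \<iota> a"
    by (simp add: gauge_flow_def gauge_action)
  then show ?thesis
    by (simp add: elem_def g W star_cscale cscale_mult_left cscale_mult_right cscale_cscale cis_cnj cis_mult
        left_diff_distrib)
qed

lemma gauge_flow_add: "gauge_flow \<iota> V s (gauge_flow \<iota> V t x) = gauge_flow \<iota> V (s + t) x"
proof -
  have "(\<lambda>x. gauge_flow \<iota> V s (gauge_flow \<iota> V t x)) = gauge_flow \<iota> V (s + t)"
    by (rule elem_eqI)
      (auto intro!: cbounded_linear_compose[of "gauge_flow \<iota> V s"] star_homD(1)[OF gauge_flow_hom]
        simp: gauge_flow_elem cbounded_linearD(6)[OF star_homD(1)[OF gauge_flow_hom]] cscale_cscale cis_mult
          algebra_simps)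
  then show ?thesis
    by metis
qed

lemma gauge_flow_period: "gauge_flow \<iota> V (2 * pi) x = x"
proof -
  have "gauge_flow \<iota> V (2 * pi) = (\<lambda>x. x)"
  proof (rule elem_eqI[OF star_homD(1)[OF gauge_flow_hom] cbounded_linear_id])
    fix \<mu> \<nu> :: "'n list" and a
    have "cis (of_int (int (length \<mu>) - int (length \<nu>)) * (2 * pi)) = 1"
      using cis_multiple_2pi[OF Ints_of_int] by (metis mult.commute)
    then show "gauge_flow \<iota> V (2 * pi) (elem \<mu> a \<nu>) = elem \<mu> a \<nu>"
      by (simp only: gauge_flow_elem cscale_one)
  qed
  then show ?thesis
    by simp
qed

lemma kms_states_values:
  assumes "\<psi> \<in> kms_states (gauge_flow \<iota> V) \<beta>" "\<beta> \<noteq> 0"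
  shows "gauge_invariant_values \<psi> \<beta>"
proof -
  have spectral: "\<psi> (elem \<mu> a \<nu> * y) =
      of_real (exp (- (of_int (int (length \<mu>) - int (length \<nu>)) * \<beta>))) * \<psi> (y * elem \<mu> a \<nu>)" for \<mu> a \<nu> y
    by (rule kms_state_spectral[OF assms(1)])
      (rule star_homD(1)[OF gauge_flow_hom] gauge_flow_contractive gauge_flow_add gauge_flow_period
        gauge_flow_elem)+
  have "\<psi> (elem \<mu> a \<nu>) = (if \<mu> = \<nu> then of_real (exp (- (real (length \<mu>) * \<beta>))) * \<psi> (\<iota> a) else 0)"
    for \<mu> a \<nu>
  proof (cases "length \<mu> = length \<nu>")
    case True
    have "\<psi> (elem \<mu> a \<nu>) = \<psi> (elem \<mu> 1 [] * elem [] a \<nu>)"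
      by (simp add: elem_def mult.assoc)
    also have "\<dots> = of_real (exp (- (real (length \<mu>) * \<beta>))) * \<psi> (elem [] a \<nu> * elem \<mu> 1 [])"
      by (subst spectral) simp
    also have "elem [] a \<nu> * elem \<mu> 1 [] = (if \<mu> = \<nu> then \<iota> a else 0)"
      using word_isometry[OF True] by (simp add: elem_def mult.assoc)
    finally show ?thesis
      using assms(1) cbounded_linearD(3)[OF states_cbounded_linear[of \<psi>]] by (auto simp: kms_states_def)
  next
    case False
    have "exp (- (of_int (int (length \<mu>) - int (length \<nu>)) * \<beta>)) \<noteq> 1"
      using False assms(2) by simp
    moreover have "\<psi> (elem \<mu> a \<nu>) =
        of_real (exp (- (of_int (int (length \<mu>) - int (length \<nu>)) * \<beta>))) * \<psi> (elem \<mu> a \<nu>)"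
      using spectral[of \<mu> a \<nu> 1] by simp
    ultimately have "\<psi> (elem \<mu> a \<nu>) = 0"
      by (metis mult_cancel_right1 of_real_eq_1_iff)
    then show ?thesis
      using False by auto
  qed
  then show ?thesis
    by (simp add: gauge_invariant_values_def)
qed

lemma entire_extension_elem_sum:
  "entire_extension (gauge_flow \<iota> V) (\<Sum>m\<in>I. c m *\<^sub>C elem (\<mu> m) (a m) (\<nu> m))
    (\<lambda>z. \<Sum>m\<in>I. (exp (\<i> * of_real (real (length (\<mu> m)) - real (length (\<nu> m))) * z) * c m) *\<^sub>C
      elem (\<mu> m) (a m) (\<nu> m))"
  unfolding entire_extension_def
proof safe
  let ?k = "\<lambda>m. \<i> * complex_of_real (real (length (\<mu> m)) - real (length (\<nu> m)))"
  let ?e = "\<lambda>m. elem (\<mu> m) (a m) (\<nu> m)"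
  fix z
  have "((\<lambda>h. \<Sum>m\<in>I. (((exp (?k m * (z + h)) - exp (?k m * z)) / h) * c m) *\<^sub>C ?e m) \<longlongrightarrow>
      (\<Sum>m\<in>I. ((exp (?k m * z) * ?k m) * c m) *\<^sub>C ?e m)) (at 0)"
  proof (rule tendsto_sum)
    fix m
    have bl: "bounded_linear (\<lambda>c. c *\<^sub>C ?e m)"
      by (rule bounded_linear_intro[where K = "norm (?e m)"])
        (auto simp: cscale_add_left norm_cscale scaleR_conv_cscale cscale_cscale scaleR_conv_of_real
          simp flip: cscale_of_real)
    have "((\<lambda>z. exp (?k m * z)) has_field_derivative exp (?k m * z) * ?k m) (at z)"
      by (auto intro!: derivative_eq_intros)
    then have "((\<lambda>h. (exp (?k m * (z + h)) - exp (?k m * z)) / h) \<longlongrightarrow> exp (?k m * z) * ?k m) (at 0)"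
      by (simp add: DERIV_def)
    then have "((\<lambda>h. (exp (?k m * (z + h)) - exp (?k m * z)) / h * c m) \<longlongrightarrow> exp (?k m * z) * ?k m * c m) (at 0)"
      by (intro tendsto_mult tendsto_const)
    then show "((\<lambda>h. ((exp (?k m * (z + h)) - exp (?k m * z)) / h * c m) *\<^sub>C ?e m) \<longlongrightarrow>
        (exp (?k m * z) * ?k m * c m) *\<^sub>C ?e m) (at 0)"
      by (rule bounded_linear.tendsto[OF bl])
  qed
  moreover have "inverse h *\<^sub>C ((\<Sum>m\<in>I. (exp (?k m * (z + h)) * c m) *\<^sub>C ?e m) -
        (\<Sum>m\<in>I. (exp (?k m * z) * c m) *\<^sub>C ?e m)) =
      (\<Sum>m\<in>I. (((exp (?k m * (z + h)) - exp (?k m * z)) / h) * c m) *\<^sub>C ?e m)" for h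
  proof -
    have diff: "(b - d) *\<^sub>C x = b *\<^sub>C x - d *\<^sub>C x" for b d and x :: 'b
      using cscale_add_left[of b "-d" x] by (simp add: cscale_minus_left)
    have "inverse h *\<^sub>C ((exp (?k m * (z + h)) * c m) *\<^sub>C ?e m - (exp (?k m * z) * c m) *\<^sub>C ?e m) =
        (((exp (?k m * (z + h)) - exp (?k m * z)) / h) * c m) *\<^sub>C ?e m" for m
      unfolding diff[symmetric] cscale_cscale by (simp only: divide_inverse algebra_simps)
    then show ?thesis
      by (simp only: cscale_sum_right flip: sum_subtractf)
  qed
  ultimately show "\<exists>D. ((\<lambda>h. inverse h *\<^sub>C ((\<Sum>m\<in>I. (exp (?k m * (z + h)) * c m) *\<^sub>C ?e m) -
        (\<Sum>m\<in>I. (exp (?k m * z) * c m) *\<^sub>C ?e m))) \<longlongrightarrow> D) (at 0)"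
    by auto
next
  fix t :: real
  show "(\<Sum>m\<in>I. (exp (\<i> * of_real (real (length (\<mu> m)) - real (length (\<nu> m))) * of_real t) * c m) *\<^sub>C
      elem (\<mu> m) (a m) (\<nu> m)) = gauge_flow \<iota> V t (\<Sum>m\<in>I. c m *\<^sub>C elem (\<mu> m) (a m) (\<nu> m))"
    by (simp add: cbounded_linearD(6,7)[OF star_homD(1)[OF gauge_flow_hom]] gauge_flow_elem cscale_cscale
        cis_conv_exp mult.commute mult.left_commute)
qed

text \<open>The polynomial values serve as dense subalgebra: orbits there have explicit entire
  extensions, which at \<open>\<i> \<beta>\<close> multiply \<open>elem \<mu> a \<nu>\<close> by the
  factor of \<open>scaled_trace_elem\<close>.\<close>

lemma values_kms_states:
  assumes \<psi>: "\<psi> \<in> states" and val: "gauge_invariant_values \<psi> \<beta>"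
  shows "\<psi> \<in> kms_states (gauge_flow \<iota> V) \<beta>"
proof -
  let ?D = "range (eval_poly (case_sum \<iota> V))"
  note lin = cbounded_linearD[OF states_cbounded_linear[OF \<psi>]]
  have "star_subalgebra ?D"
    unfolding star_subalgebra_def
    by (auto simp flip: eval_poly_simps(1,4-6) intro: range_eqI[of _ _ 0])
  moreover have "gauge_flow \<iota> V t x \<in> ?D" if xD: "x \<in> ?D" for t x
  proof -
    obtain I :: "('a + 'n) monomial set" and c \<mu> a \<nu> where I: "finite I"
        and x: "x = (\<Sum>m\<in>I. c m *\<^sub>C elem (\<mu> m) (a m) (\<nu> m))"
      using xD by (rule elem_expansionE)
    have "gauge_flow \<iota> V t x =
        (\<Sum>m\<in>I. (c m * cis (of_int (int (length (\<mu> m)) - int (length (\<nu> m))) * t)) *\<^sub>C elem (\<mu> m) (a m) (\<nu> m))"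
      by (simp add: x cbounded_linearD(6,7)[OF star_homD(1)[OF gauge_flow_hom]] gauge_flow_elem cscale_cscale)
    moreover have "(\<Sum>m\<in>I. d m *\<^sub>C elem (\<mu> m) (a m) (\<nu> m)) \<in> ?D" for d
    proof -
      have "\<forall>m. \<exists>p. elem (\<mu> m) (a m) (\<nu> m) = eval_poly (case_sum \<iota> V) p"
        using elem_in_range by blast
      then obtain p where "elem (\<mu> m) (a m) (\<nu> m) = eval_poly (case_sum \<iota> V) (p m)" for m
        by metis
      then have "(\<Sum>m\<in>I. d m *\<^sub>C elem (\<mu> m) (a m) (\<nu> m)) =
          eval_poly (case_sum \<iota> V) (\<Sum>m\<in>I. poly_scale (d m) (p m))"
        by (simp add: eval_poly_sum eval_poly_scale)
      then show ?thesis
        by simp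
    qed
    ultimately show ?thesis
      by simp
  qed
  moreover have "\<exists>F. entire_extension (gauge_flow \<iota> V) x F" if xD: "x \<in> ?D" for x
  proof -
    obtain I :: "('a + 'n) monomial set" and c \<mu> a \<nu> where "finite I"
        "x = (\<Sum>m\<in>I. c m *\<^sub>C elem (\<mu> m) (a m) (\<nu> m))"
      using xD by (rule elem_expansionE)
    then show ?thesis
      using entire_extension_elem_sum by blast
  qed
  moreover have "\<psi> (x * y) = \<psi> (y * F (\<i> * of_real \<beta>))"
    if xD: "x \<in> ?D" and F: "entire_extension (gauge_flow \<iota> V) x F" for x y F
  proof -
    obtain I :: "('a + 'n) monomial set" and c \<mu> a \<nu> where I: "finite I"
        and x: "x = (\<Sum>m\<in>I. c m *\<^sub>C elem (\<mu> m) (a m) (\<nu> m))"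
      using xD by (rule elem_expansionE)
    let ?G = "\<lambda>z. \<Sum>m\<in>I. (exp (\<i> * of_real (real (length (\<mu> m)) - real (length (\<nu> m))) * z) * c m) *\<^sub>C
      elem (\<mu> m) (a m) (\<nu> m)"
    have G: "entire_extension (gauge_flow \<iota> V) x ?G"
      unfolding x by (rule entire_extension_elem_sum)
    have cb: "cbounded_linear (\<lambda>z. \<psi> (y * z))"
      by (intro cbounded_linear_compose[OF states_cbounded_linear[OF \<psi>]] cbounded_linear_mult_left)
    \<comment> \<open>The condition concerns every entire extension \<open>F\<close>; after pairing
      with \<psi> it agrees with the explicit one on the reals, hence everywhere.\<close>
    have "\<psi> (y * F z) = \<psi> (y * ?G z)" for z
      by (rule entire_eqI[OF entire_extension_holomorphic[OF F cb] entire_extension_holomorphic[OF G cb]])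
        (use F G in \<open>simp add: entire_extension_def\<close>)
    also have "\<psi> (y * ?G (\<i> * of_real \<beta>)) = (\<Sum>m\<in>I. c m * \<psi> (elem (\<mu> m) (a m) (\<nu> m) * y))"
    proof -
      have "exp (\<i> * of_real (real (length (\<mu> m)) - real (length (\<nu> m))) * (\<i> * of_real \<beta>)) =
          complex_of_real (exp (- ((real (length (\<mu> m)) - real (length (\<nu> m))) * \<beta>)))" for m
        by (simp add: exp_of_real[symmetric] algebra_simps)
      then show ?thesis
        using scaled_trace_elem[OF \<psi> val]
        by (simp add: sum_distrib_left cscale_mult_right lin scaled_trace_def mult.commute mult.left_commute)
    qed
    finally show ?thesis
      by (simp add: x sum_distrib_right cscale_mult_left lin)
  qed
  ultimately show ?thesis
    using \<psi> dense unfolding kms_states_def by blast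
qed

lemma kms_states_iff:
  "\<beta> \<noteq> 0 \<Longrightarrow> \<psi> \<in> kms_states (gauge_flow \<iota> V) \<beta> \<longleftrightarrow> \<psi> \<in> states \<and> gauge_invariant_values \<psi> \<beta>"
  using kms_states_values values_kms_states by (auto simp: kms_states_def)

end


section \<open>The Toeplitz algebra\<close>

lemma toeplitz_relations_intros:
  "gen (Inl (a + b)) - (gen (Inl a) + gen (Inl b)) \<in> toeplitz_relations \<alpha>"
  "gen (Inl (c *\<^sub>C a)) - poly_scale c (gen (Inl a)) \<in> toeplitz_relations \<alpha>"
  "gen (Inl (a * b)) - gen (Inl a) * gen (Inl b) \<in> toeplitz_relations \<alpha>"
  "gen (Inl (star a)) - poly_star (gen (Inl a)) \<in> toeplitz_relations \<alpha>"
  "gen (Inl 1) - 1 \<in> toeplitz_relations \<alpha>"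
  "poly_star (gen (Inr i)) * gen (Inr j) - (if i = j then 1 else 0) \<in> toeplitz_relations \<alpha>"
  "gen (Inl a) * gen (Inr i) - gen (Inr i) * gen (Inl (\<alpha> i a)) \<in> toeplitz_relations \<alpha>"
  unfolding toeplitz_relations_def Let_def by blast+

locale toeplitz_rep = commutative_system \<alpha>
  for \<alpha> :: "'n::finite \<Rightarrow> 'a::cstar_algebra \<Rightarrow> 'a" +
  fixes \<iota> :: "'a \<Rightarrow> 'b::cstar_algebra" and V :: "'n \<Rightarrow> 'b"
  assumes toeplitz: "toeplitz_algebra \<alpha> \<iota> V"
begin

sublocale covariant_rep \<alpha> \<iota> V
proof
  have rel: "eval_poly (case_sum \<iota> V) r = 0" if "r \<in> toeplitz_relations \<alpha>" for r
    using toeplitz that by (simp add: toeplitz_algebra_def universal_cstar_algebra_def)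
  note rels = toeplitz_relations_intros[where \<alpha> = \<alpha>, THEN rel]
  fix a b c i j
  show "\<iota> (a + b) = \<iota> a + \<iota> b"
    using rels(1)[of a b] by (simp add: eval_poly_simps)
  show "\<iota> (c *\<^sub>C a) = c *\<^sub>C \<iota> a"
    using rels(2)[of c a] by (simp add: eval_poly_simps)
  show "\<iota> (a * b) = \<iota> a * \<iota> b"
    using rels(3)[of a b] by (simp add: eval_poly_simps)
  show "\<iota> (star a) = star (\<iota> a)"
    using rels(4)[of a] by (simp add: eval_poly_simps)
  show "\<iota> 1 = 1"
    using rels(5) by (simp add: eval_poly_simps)
  show "star (V i) * V j = (if i = j then 1 else 0)"
    using rels(6)[of i j] by (auto simp: eval_poly_simps)
  show "\<iota> a * V i = V i * \<iota> (\<alpha> i a)"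
    using rels(7)[of a i] by (simp add: eval_poly_simps)
  show "closure (range (eval_poly (case_sum \<iota> V))) = UNIV"
    using toeplitz by (simp add: toeplitz_algebra_def universal_cstar_algebra_def)
qed

text \<open>For \<open>cmod z = 1\<close> the elements \<open>z *\<^sub>C V i\<close> satisfy the
  same relations as the \<open>V i\<close>, so universality provides the gauge map.\<close>

sublocale gauge_rep \<alpha> \<iota> V
proof
  fix z :: complex
  assume z: "cmod z = 1"
  then have zz: "z * cnj z = 1"
    by (simp flip: complex_norm_square)
  have "eval_poly (case_sum \<iota> (\<lambda>i. z *\<^sub>C V i)) r = 0" if "r \<in> toeplitz_relations \<alpha>" for r
    using that
    by (cases rule: toeplitz_relationsE)
      (auto simp: eval_poly_simps \<iota>_add \<iota>_scale \<iota>_mult \<iota>_star star_cscale cscale_mult_left cscale_mult_right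
        cscale_cscale isometry covariance zz mult.commute[of "cnj z"])
  then obtain g where "star_hom g" "g \<circ> case_sum \<iota> V = case_sum \<iota> (\<lambda>i. z *\<^sub>C V i)" "\<And>x. norm (g x) \<le> norm x"
    using universal_cstar_algebraE[OF toeplitz[unfolded toeplitz_algebra_def]] by blast
  moreover from this(2) have "g (\<iota> a) = \<iota> a" "g (V i) = z *\<^sub>C V i" for a i
    by (auto dest: fun_cong[of _ _ "Inl a"] fun_cong[of _ _ "Inr i"])
  ultimately show "\<exists>g. star_hom g \<and> (\<forall>a. g (\<iota> a) = \<iota> a) \<and> (\<forall>i. g (V i) = z *\<^sub>C V i) \<and> (\<forall>x. norm (g x) \<le> norm x)"
    by blast
qed

end


section \<open>Diagonal compressions of the Fock representations\<close>

lemma cbounded_linear_apply_bcontfun: "cbounded_linear (\<lambda>f :: 'x::topological_space \<Rightarrow>\<^sub>C complex. apply_bcontfun f x)"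
proof -
  have "bounded_linear (\<lambda>f :: 'x \<Rightarrow>\<^sub>C complex. apply_bcontfun f x)"
    by (rule bounded_linear_of_complex_linear[where K = 1]) (auto simp: norm_bounded)
  then show ?thesis
    by (simp add: cbounded_linear_def)
qed

lemma apply_bcontfun_sum: "apply_bcontfun (sum f I) x = (\<Sum>i\<in>I. apply_bcontfun (f i) x)"
  for f :: "_ \<Rightarrow> 'x::topological_space \<Rightarrow>\<^sub>C complex"
  by (rule cbounded_linearD(7)[OF cbounded_linear_apply_bcontfun])

lemma norm_comp_op_le:
  fixes f :: "'y::topological_space \<Rightarrow>\<^sub>C complex"
  assumes "continuous_on UNIV s"
  shows "norm (comp_op s f) \<le> norm f"
  by (rule norm_bound) (simp add: apply_comp_op[OF assms] norm_bounded)

lemma star_hom_comp_op: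
  assumes "continuous_on UNIV s"
  shows "star_hom (comp_op s)"
proof -
  note [simp] = apply_comp_op[OF assms]
  have "bounded_linear (comp_op s)"
    by (rule bounded_linear_of_complex_linear[where K = 1])
      (auto intro!: bcontfun_eqI simp: norm_comp_op_le[OF assms])
  then show ?thesis
    by (auto simp: star_hom_def intro!: bcontfun_eqI)
qed

lemma bcontfun_mult_commute: "(f :: 'x::topological_space \<Rightarrow>\<^sub>C complex) * g = g * f"
  by (rule bcontfun_eqI) simp

locale classical =
  fixes \<sigma> :: "'n::finite \<Rightarrow> 'x::topological_space \<Rightarrow> 'x"
  assumes cont: "continuous_on UNIV (\<sigma> i)"
begin

abbreviation \<alpha> :: "'n \<Rightarrow> ('x \<Rightarrow>\<^sub>C complex) \<Rightarrow> ('x \<Rightarrow>\<^sub>C complex)" where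
  "\<alpha> \<equiv> classical_system \<sigma>"

lemma apply_\<alpha>: "apply_bcontfun (\<alpha> i a) x = apply_bcontfun a (\<sigma> i x)"
  by (simp add: classical_system_def apply_comp_op cont)

sublocale commutative_system \<alpha>
  by standard (auto simp: classical_system_def star_hom_comp_op cont bcontfun_mult_commute)

lemma orbit_append: "orbit \<sigma> (v @ w) x = orbit \<sigma> v (orbit \<sigma> w x)"
  by (simp add: orbit_def)

text \<open>Composition operators compose in the opposite order to the maps; this is the origin of
  the reversed words in the parametrization.\<close>

lemma apply_word_map: "apply_bcontfun (word_map \<alpha> w a) x = apply_bcontfun a (orbit \<sigma> (rev w) x)"
  by (induction w arbitrary: x) (auto simp: orbit_append apply_\<alpha>)

lemma norm_transfer_pow: "norm ((transfer ^^ m) a) \<le> real CARD('n) ^ m * norm a"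
proof (induction m)
  case (Suc m)
  have "norm (transfer b) \<le> (\<Sum>i\<in>(UNIV :: 'n set). norm b)" for b
    unfolding transfer_def
    by (rule order_trans[OF norm_sum sum_mono]) (simp add: classical_system_def norm_comp_op_le cont)
  from this[of "(transfer ^^ m) a"] show ?case
    using order_trans[OF _ mult_left_mono[OF Suc, of "real CARD('n)"]] by (simp add: mult.assoc)
qed simp

lemma continuous_orbit: "continuous_on UNIV (orbit \<sigma> w)"
proof (induction w)
  case (Cons i w)
  have "orbit \<sigma> (i # w) = (\<lambda>x. \<sigma> i (orbit \<sigma> w x))"
    by auto
  then show ?case
    using continuous_on_compose2[OF cont Cons] by simp
qed (simp add: orbit_def)

text \<open>Each letter reads a single coordinate of the vector, so continuity in the base point
  passes through coordinatewise. This is what places diagonal coefficients in C(X).\<close>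

lemma continuous_fock_letter:
  assumes "\<And>w. continuous_on UNIV (\<lambda>x. f x w)"
  shows "continuous_on UNIV (\<lambda>x. fock_letter \<sigma> x l (f x) w)"
proof (cases l rule: letter_sum_cases)
  case (3 i)
  then have "(\<lambda>x. fock_letter \<sigma> x l (f x) w) =
      (if w \<noteq> [] \<and> hd w = i then (\<lambda>x. f x (tl w)) else (\<lambda>x. 0))"
    by (cases w) auto
  then show ?thesis
    using assms[of "tl w"] by (metis continuous_on_const)
qed (auto intro!: continuous_intros assms continuous_on_compose2[OF continuous_on_apply_bcontfun continuous_orbit])

lemma continuous_fock_poly: "continuous_on UNIV (\<lambda>x. fock_poly \<sigma> x p f w)"
proof -
  have "continuous_on UNIV (\<lambda>x. foldr (fock_letter \<sigma> x) ls f w)" for ls w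
    by (induction ls arbitrary: w) (auto intro: continuous_fock_letter)
  then show ?thesis
    by (simp add: fock_poly_expand fock_monomial_def continuous_intros)
qed

end

definition unit_vec :: "'k \<Rightarrow> 'k \<Rightarrow> complex" where
  "unit_vec w v = (if v = w then 1 else 0)"

lemma finsupp_unit_vec [simp]: "finsupp (unit_vec w)"
  by (simp add: finsupp_def unit_vec_def)

lemma fs_norm_unit_vec [simp]: "fs_norm (unit_vec w) = 1"
  by (subst fs_norm_superset[where S = "{w}"]) (auto simp: unit_vec_def split: if_splits)

lemma fs_inner_unit_vec: "finsupp f \<Longrightarrow> fs_inner f (unit_vec w) = f w"
  by (subst fs_inner_superset[where S = "{w}"]) (auto simp: unit_vec_def split: if_splits)

locale classical_toeplitz = classical \<sigma>
  for \<sigma> :: "'n::finite \<Rightarrow> 'x::topological_space \<Rightarrow> 'x" +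
  fixes \<iota> :: "('x \<Rightarrow>\<^sub>C complex) \<Rightarrow> 'b::cstar_algebra" and V :: "'n \<Rightarrow> 'b"
  assumes toeplitz_algebra: "toeplitz_algebra (classical_system \<sigma>) \<iota> V"
begin

sublocale toeplitz_rep \<alpha> \<iota> V
  by standard (rule toeplitz_algebra)

text \<open>The Fock seminorm vanishes on the Toeplitz relations, so maximality of the universal
  norm applies.\<close>

lemma fock_norm_le: "fock_norm \<sigma> x p \<le> norm (eval_poly (case_sum \<iota> V) p)"
proof -
  have "fock_norm \<sigma> x r = 0" if "r \<in> toeplitz_relations \<alpha>" for r
  proof -
    have "fock_norm \<sigma> x r \<le> 0"
      using fock_poly_toeplitz_relations[OF cont that]
      by (intro fock_norm_least) (auto simp: fs_norm_def)
    then show ?thesis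
      using fock_norm_nonneg[of \<sigma> x r] by simp
  qed
  then show ?thesis
    using toeplitz_algebra cstar_seminorm_fock_norm[of \<sigma> x]
    by (auto simp: toeplitz_algebra_def universal_cstar_algebra_def)
qed

lemma fock_diagonal_le: "cmod (fock_poly \<sigma> x p (unit_vec w) w) \<le> norm (eval_poly (case_sum \<iota> V) p)"
proof -
  let ?f = "fock_poly \<sigma> x p (unit_vec w)"
  have "cmod (?f w) \<le> fs_norm ?f * fs_norm (unit_vec w)"
    using fs_Cauchy_Schwarz[OF finsupp_fock_poly[OF finsupp_unit_vec] finsupp_unit_vec, of \<sigma> x p w w]
    by (simp add: fs_inner_unit_vec finsupp_fock_poly)
  also have "\<dots> \<le> fock_norm \<sigma> x p"
    using fock_norm_bound[of "unit_vec w" \<sigma> x p] by simp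
  finally show ?thesis
    using fock_norm_le[of x p] by simp
qed

text \<open>A diagonal coefficient is continuous in \<open>x\<close> and bounded by the norm
  uniformly in \<open>x\<close>; so it is an element of C(X), and the map extends from
  polynomials.\<close>

lemma diag_exists:
  "\<exists>g. cbounded_linear g \<and> (\<forall>x. norm (g x) \<le> norm x) \<and>
    (\<forall>p x. apply_bcontfun (g (eval_poly (case_sum \<iota> V) p)) x = fock_poly \<sigma> x p (unit_vec w) w)"
proof -
  define f where "f p = Bcontfun (\<lambda>x. fock_poly \<sigma> x p (unit_vec w) w)" for p
  have "(\<lambda>x. fock_poly \<sigma> x p (unit_vec w) w) \<in> bcontfun" for p
    by (rule bcontfun_normI[OF continuous_fock_poly fock_diagonal_le])
  then have f: "apply_bcontfun (f p) x = fock_poly \<sigma> x p (unit_vec w) w" for p x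
    by (simp add: f_def Bcontfun_inverse)
  obtain g where "cbounded_linear g" "\<And>p. g (eval_poly (case_sum \<iota> V) p) = f p" "\<And>x. norm (g x) \<le> norm x"
  proof (rule extend_from_polynomials[OF dense])
    show "norm (f p) \<le> norm (eval_poly (case_sum \<iota> V) p)" for p
      by (rule norm_bound) (simp add: f fock_diagonal_le)
  qed (auto intro!: bcontfun_eqI simp: f fock_poly_add fock_poly_scale)
  then show ?thesis
    using f by auto
qed

text \<open>The vector states of the basis vector of \<open>w\<close>, one for each base point,
  collected into a single map with values in C(X).\<close>

definition diag :: "'n list \<Rightarrow> 'b \<Rightarrow> 'x \<Rightarrow>\<^sub>C complex" where
  "diag w = (SOME g. cbounded_linear g \<and> (\<forall>x. norm (g x) \<le> norm x) \<and>
    (\<forall>p x. apply_bcontfun (g (eval_poly (case_sum \<iota> V) p)) x = fock_poly \<sigma> x p (unit_vec w) w))"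

lemma cbounded_linear_diag: "cbounded_linear (diag w)"
  and norm_diag_le: "norm (diag w b) \<le> norm b"
  and diag_eval_poly: "apply_bcontfun (diag w (eval_poly (case_sum \<iota> V) p)) x = fock_poly \<sigma> x p (unit_vec w) w"
  using someI_ex[OF diag_exists[of w]] unfolding diag_def[symmetric] by auto

text \<open>On polynomial values the coefficient of \<open>star b * b\<close> is the squared norm of
  the image of \<open>unit_vec w\<close>, and the nonnegative reals are closed.\<close>

lemma diag_positive: "apply_bcontfun (diag w (star b * b)) x \<in> \<real>\<^sub>\<ge>\<^sub>0"
proof (rule dense_induct[OF dense, where P = "\<lambda>b. apply_bcontfun (diag w (star b * b)) x \<in> \<real>\<^sub>\<ge>\<^sub>0"])
  have "continuous_on UNIV (\<lambda>b. apply_bcontfun (diag w (star b * b)) x)"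
    by (intro continuous_on_compose2[OF cbounded_linearD(8)[OF cbounded_linear_apply_bcontfun]]
        continuous_on_compose2[OF cbounded_linearD(8)[OF cbounded_linear_diag]] continuous_intros
        linear_continuous_on bounded_linear_star subset_UNIV) auto
  then have "closed ((\<lambda>b. apply_bcontfun (diag w (star b * b)) x) -` \<real>\<^sub>\<ge>\<^sub>0)"
    by (rule closed_vimage[OF closed_nonneg_Reals_complex])
  then show "closed {b. apply_bcontfun (diag w (star b * b)) x \<in> \<real>\<^sub>\<ge>\<^sub>0}"
    by (simp add: vimage_def)
next
  fix b
  assume "b \<in> range (eval_poly (case_sum \<iota> V))"
  then obtain p where b: "b = eval_poly (case_sum \<iota> V) p"
    by blast
  let ?f = "fock_poly \<sigma> x p (unit_vec w)"
  have f: "finsupp ?f"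
    by (simp add: finsupp_fock_poly)
  have "star b * b = eval_poly (case_sum \<iota> V) (poly_star p * p)"
    by (simp add: b eval_poly_simps)
  then have "apply_bcontfun (diag w (star b * b)) x = fock_poly \<sigma> x (poly_star p) ?f w"
    by (simp add: diag_eval_poly fock_poly_mult)
  also have "\<dots> = fs_inner (fock_poly \<sigma> x (poly_star p) ?f) (unit_vec w)"
    by (simp add: fs_inner_unit_vec finsupp_fock_poly)
  also have "\<dots> = cnj (fs_inner ?f ?f)"
    using f by (metis finsupp_fock_poly finsupp_unit_vec fs_inner_commute fs_inner_fock_poly)
  also have "\<dots> \<in> \<real>\<^sub>\<ge>\<^sub>0"
    using f by (simp add: fs_inner_self)
  finally show "apply_bcontfun (diag w (star b * b)) x \<in> \<real>\<^sub>\<ge>\<^sub>0" .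
qed

text \<open>\<open>V\<^sub>\<nu>*\<close> strips the prefix \<nu> from \<open>w\<close>, the
  coefficient reads the orbit of the remaining word, and \<open>V\<^sub>\<mu>\<close> restores
  \<open>w\<close> only for \<mu> = \<nu>.\<close>

lemma diag_elem:
  "apply_bcontfun (diag w (elem \<mu> a \<nu>)) x =
    (if \<mu> = \<nu> \<and> take (length \<mu>) w = \<mu> then apply_bcontfun a (orbit \<sigma> (drop (length \<mu>) w) x) else 0)"
proof -
  define p where "p \<mu> = prod_list (map (\<lambda>i. gen (Inr i) :: (('x \<Rightarrow>\<^sub>C complex) + 'n) star_poly) \<mu>)" for \<mu>
  \<comment> \<open>Reversed, since the adjoint of a product reverses its factors.\<close>
  define q where "q \<nu> = prod_list (map (\<lambda>i. poly_star (gen (Inr i)) :: (('x \<Rightarrow>\<^sub>C complex) + 'n) star_poly) (rev \<nu>))" for \<nu>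
  have "eval_poly (case_sum \<iota> V) (p \<mu>) = word_prod V \<mu>" for \<mu>
    by (induction \<mu>) (auto simp: p_def eval_poly_mult)
  moreover have "eval_poly (case_sum \<iota> V) (q \<nu>) = star (word_prod V \<nu>)" for \<nu>
    by (induction \<nu>) (auto simp: q_def eval_poly_mult eval_poly_star star_mult)
  ultimately have elem: "elem \<mu> a \<nu> = eval_poly (case_sum \<iota> V) (p \<mu> * (gen (Inl a) * q \<nu>))"
    by (simp add: elem_def eval_poly_mult mult.assoc)
  have P: "fock_poly \<sigma> x (p \<mu>) f v = (if take (length \<mu>) v = \<mu> then f (drop (length \<mu>) v) else 0)" for f v \<mu>
  proof (induction \<mu> arbitrary: v)
    case (Cons i \<mu>)
    have "fock_poly \<sigma> x (p (i # \<mu>)) f v = fock_poly \<sigma> x (gen (Inr i)) (fock_poly \<sigma> x (p \<mu>) f) v"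
      by (simp add: p_def fock_poly_mult)
    then show ?case
      by (cases v) (auto simp: Cons)
  qed (simp add: p_def)
  have Q: "fock_poly \<sigma> x (q \<nu>) f v = f (\<nu> @ v)" for f v \<nu>
    by (induction \<nu> arbitrary: f) (auto simp: q_def fock_poly_mult)
  have "apply_bcontfun (diag w (elem \<mu> a \<nu>)) x =
      (if take (length \<mu>) w = \<mu> then apply_bcontfun a (orbit \<sigma> (drop (length \<mu>) w) x) *
        unit_vec w (\<nu> @ drop (length \<mu>) w) else 0)"
    by (simp add: elem diag_eval_poly fock_poly_mult P Q)
  moreover have "\<nu> @ drop (length \<mu>) w = w \<longleftrightarrow> \<mu> = \<nu>" if "take (length \<mu>) w = \<mu>"
    using that append_take_drop_id[of "length \<mu>" w] by (metis append_same_eq)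
  ultimately show ?thesis
    by (auto simp: unit_vec_def)
qed

text \<open>The map \<open>G\<^sub>m\<close> of the overview: a trace over the level of words of
  length \<open>m\<close>.\<close>

definition compress :: "nat \<Rightarrow> 'b \<Rightarrow> 'x \<Rightarrow>\<^sub>C complex" where
  "compress m b = (\<Sum>w | length w = m. diag w b)"

lemma cbounded_linear_compress: "cbounded_linear (compress m)"
  unfolding compress_def by (intro cbounded_linear_sum cbounded_linear_diag)

lemma norm_compress_le: "norm (compress m b) \<le> real CARD('n) ^ m * norm b"
proof -
  have "norm (compress m b) \<le> (\<Sum>w\<in>{w :: 'n list. length w = m}. norm b)"
    unfolding compress_def by (rule order_trans[OF norm_sum sum_mono]) (auto simp: norm_diag_le)
  then show ?thesis
    by (simp add: card_words)
qed

lemma compress_positive: "apply_bcontfun (compress m (star b * b)) x \<in> \<real>\<^sub>\<ge>\<^sub>0"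
proof -
  have "(\<Sum>w\<in>W. apply_bcontfun (diag w (star b * b)) x) \<in> \<real>\<^sub>\<ge>\<^sub>0" for W
    by (induction W rule: infinite_finite_induct) (auto simp: diag_positive)
  then show ?thesis
    by (simp add: compress_def apply_bcontfun_sum)
qed

lemma compress_elem_eq_0: "\<mu> \<noteq> \<nu> \<or> m < length \<mu> \<Longrightarrow> compress m (elem \<mu> a \<nu>) = 0"
proof (rule bcontfun_eqI)
  fix x
  assume *: "\<mu> \<noteq> \<nu> \<or> m < length \<mu>"
  have "\<not> (\<mu> = \<nu> \<and> take (length \<mu>) w = \<mu>)" if "length w = m" for w
  proof
    assume "\<mu> = \<nu> \<and> take (length \<mu>) w = \<mu>"
    then show False
      using * that arg_cong[of "take (length \<mu>) w" \<mu> length] by auto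
  qed
  then show "apply_bcontfun (compress m (elem \<mu> a \<nu>)) x = apply_bcontfun 0 x"
    by (auto simp: compress_def apply_bcontfun_sum diag_elem intro!: sum.neutral)
qed

text \<open>Only the words \<open>\<mu> @ u\<close> with \<open>length u = m\<close> contribute. The
  offset \<open>length \<mu>\<close> later turns into the factor
  \<open>exp (- |\<mu>| \<beta>)\<close>.\<close>

lemma compress_elem: "compress (m + length \<mu>) (elem \<mu> a \<mu>) = (transfer ^^ m) a"
proof (rule bcontfun_eqI)
  fix x
  have "{w. length w = m + length \<mu> \<and> take (length \<mu>) w = \<mu>} = (@) \<mu> ` {u. length u = m}"
  proof (intro equalityI subsetI)
    fix w
    assume "w \<in> {w. length w = m + length \<mu> \<and> take (length \<mu>) w = \<mu>}"
    then show "w \<in> (@) \<mu> ` {u. length u = m}"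
      using append_take_drop_id[of "length \<mu>" w] by (intro image_eqI[of _ _ "drop (length \<mu>) w"]) auto
  qed auto
  moreover have "apply_bcontfun (compress (m + length \<mu>) (elem \<mu> a \<mu>)) x =
      (\<Sum>w | length w = m + length \<mu> \<and> take (length \<mu>) w = \<mu>. apply_bcontfun a (orbit \<sigma> (drop (length \<mu>) w) x))"
    unfolding compress_def apply_bcontfun_sum diag_elem
    by (rule sum.mono_neutral_cong_right) auto
  ultimately have "apply_bcontfun (compress (m + length \<mu>) (elem \<mu> a \<mu>)) x =
      (\<Sum>u | length u = m. apply_bcontfun a (orbit \<sigma> u x))"
    by (simp add: sum.reindex inj_on_def)
  then show "apply_bcontfun (compress (m + length \<mu>) (elem \<mu> a \<mu>)) x = apply_bcontfun ((transfer ^^ m) a) x"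
    by (simp add: apply_bcontfun_sum apply_word_map flip: sum_word_map_rev)
qed

end


section \<open>Parametrization of the KMS states\<close>

text \<open>In the product topology continuity is tested at each argument separately, so both
  directions reduce to continuity of scalar functions.\<close>

lemma affine_weak_star_homeomorphismI:
  assumes "\<And>\<tau>. \<tau> \<in> S \<Longrightarrow> f \<tau> \<in> K" "\<And>\<psi>. \<psi> \<in> K \<Longrightarrow> g \<psi> \<in> S"
    and "\<And>\<tau>. \<tau> \<in> S \<Longrightarrow> g (f \<tau>) = \<tau>" "\<And>\<psi>. \<psi> \<in> K \<Longrightarrow> f (g \<psi>) = \<psi>"
    and "\<And>b. continuous_on S (\<lambda>\<tau>. f \<tau> b)" "\<And>a. continuous_on K (\<lambda>\<psi>. g \<psi> a)"
    and "\<And>\<tau> \<omega> t. \<tau> \<in> S \<Longrightarrow> \<omega> \<in> S \<Longrightarrow> t \<in> {0..1} \<Longrightarrow>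
      f (\<lambda>a. of_real t * \<tau> a + of_real (1 - t) * \<omega> a) =
        (\<lambda>b. of_real t * f \<tau> b + of_real (1 - t) * f \<omega> b)"
  shows "affine_weak_star_homeomorphism S K f"
proof -
  have "homeomorphism S K f g"
    by (rule homeomorphismI) (use assms in \<open>auto intro: continuous_on_coordinatewise_then_product\<close>)
  then show ?thesis
    using assms(7) by (auto simp: affine_weak_star_homeomorphism_def)
qed

lemma nonneg_Reals_sums:
  fixes f :: "nat \<Rightarrow> complex"
  assumes "f sums s" "\<And>m. f m \<in> \<real>\<^sub>\<ge>\<^sub>0"
  shows "s \<in> \<real>\<^sub>\<ge>\<^sub>0"
proof -
  have "sum f I \<in> \<real>\<^sub>\<ge>\<^sub>0" for I
    by (induction I rule: infinite_finite_induct) (auto simp: assms)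
  then show ?thesis
    using assms(1) closed_sequentially[OF closed_nonneg_Reals_complex, of "\<lambda>n. sum f {..<n}" s]
    by (simp add: sums_def)
qed

lemma states_convex:
  assumes "\<psi> \<in> states" "\<omega> \<in> states" "t \<in> {0..1}"
  shows "(\<lambda>b. of_real t * \<psi> b + of_real (1 - t) * \<omega> b) \<in> states"
  unfolding states_iff
proof (intro conjI allI)
  have "cbounded_linear (\<lambda>b. of_real t *\<^sub>C \<psi> b + of_real (1 - t) *\<^sub>C \<omega> b)"
    using assms by (intro cbounded_linear_add cbounded_linear_cscale states_cbounded_linear)
  then show "cbounded_linear (\<lambda>b. of_real t * \<psi> b + of_real (1 - t) * \<omega> b)"
    by simp
next
  show "of_real t * \<psi> (star x * x) + of_real (1 - t) * \<omega> (star x * x) \<in> \<real>\<^sub>\<ge>\<^sub>0" for x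
    using assms by (intro nonneg_Reals_add_I nonneg_Reals_mult_I) (auto simp: states_iff simp del: of_real_diff)
qed (use assms in \<open>simp add: states_one\<close>)

section \<open>The defect projection\<close>

context covariant_rep
begin

text \<open>In a Fock representation this is the projection onto the basis vector of the empty
  word.\<close>

definition defect :: 'b where
  "defect = 1 - (\<Sum>i\<in>UNIV. V i * star (V i))"

lemma \<iota>_defect: "\<iota> a * defect = \<iota> a - (\<Sum>i\<in>UNIV. elem [i] (\<alpha> i a) [i])"
  by (simp add: defect_def right_diff_distrib sum_distrib_left elem_def covariance flip: mult.assoc)

lemma defect_\<iota>: "defect * \<iota> a = \<iota> a * defect"
  by (simp add: \<iota>_defect) (simp add: defect_def left_diff_distrib sum_distrib_right elem_def covariance' mult.assoc)

lemma star_defect: "star defect = defect"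
  by (simp add: defect_def star_diff star_sum star_mult)

lemma V_defect: "star (V i) * defect = 0"
proof -
  have "(\<Sum>j\<in>UNIV. star (V i) * (V j * star (V j))) = (\<Sum>j\<in>UNIV. if i = j then star (V i) else 0)"
    by (rule sum.cong) (auto simp: isometry simp flip: mult.assoc)
  then show ?thesis
    by (simp add: defect_def right_diff_distrib sum_distrib_left)
qed

lemma defect_idem: "defect * defect = defect"
proof -
  have "defect * defect = defect - (\<Sum>i\<in>UNIV. V i * star (V i)) * defect"
    by (subst (1) defect_def) (simp add: left_diff_distrib)
  then show ?thesis
    by (simp add: sum_distrib_right mult.assoc V_defect)
qed

text \<open>The defect is a projection commuting with the coefficients. This yields positivity of
  the compressed functional and evaluates \<open>star g * g\<close> for the generators
  \<open>g\<close> of the Cuntz-Pimsner ideal.\<close>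

lemma star_\<iota>_defect: "star (\<iota> a * defect) * (\<iota> a * defect) = \<iota> (star a * a) * defect"
proof -
  have "star (\<iota> a * defect) * (\<iota> a * defect) = defect * \<iota> (star a * a) * defect"
    by (simp add: star_mult star_defect \<iota>_mult \<iota>_star mult.assoc)
  then show ?thesis
    by (simp add: defect_\<iota> defect_idem mult.assoc)
qed

text \<open>Covariance rewrites \<open>\<iota> a * V i * star (V i)\<close> as
  \<open>elem [i] (\<alpha> i a) [i]\<close>; words of length one contribute a single factor
  \<open>exp (- \<beta>)\<close>.\<close>

lemma values_defect:
  assumes "\<psi> \<in> states" "gauge_invariant_values \<psi> \<beta>"
  shows "\<psi> (\<iota> a * defect) = \<psi> (\<iota> a) - of_real (exp (- \<beta>)) * \<psi> (\<iota> (transfer a))"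
  using assms
  by (simp add: \<iota>_defect cbounded_linearD[OF states_cbounded_linear] gauge_invariant_values_def
      transfer_def \<iota>_sum sum_distrib_left)

lemma gauge_invariant_values_convex:
  assumes "gauge_invariant_values \<psi> \<beta>" "gauge_invariant_values \<omega> \<beta>"
  shows "gauge_invariant_values (\<lambda>b. s * \<psi> b + t * \<omega> b) \<beta>"
  using assms by (auto simp: gauge_invariant_values_def algebra_simps)

lemma state_\<iota>:
  assumes "\<psi> \<in> states"
  shows "positive_functional (\<lambda>a. \<psi> (\<iota> a))" "\<psi> (\<iota> 1) = 1"
  using states_positive_functional[OF assms] assms
  by (auto simp: positive_functional_def states_one \<iota>_add \<iota>_scale \<iota>_mult \<iota>_star)

end

context gauge_rep
begin

lemma kms_state_with_values_eq:
  assumes "\<psi> \<in> kms_states (gauge_flow \<iota> V) \<beta>" "\<And>\<mu> \<nu> a. \<psi> (elem \<mu> a \<nu>) = v \<mu> \<nu> a"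
  shows "kms_state_with_values \<iota> V \<beta> v = \<psi>"
  unfolding kms_state_with_values_def
proof (rule the_equality)
  fix \<omega>
  assume \<omega>: "\<omega> \<in> kms_states (gauge_flow \<iota> V) \<beta> \<and>
    (\<forall>\<mu> \<nu> a. \<omega> (word_prod V \<mu> * \<iota> a * star (word_prod V \<nu>)) = v \<mu> \<nu> a)"
  show "\<omega> = \<psi>"
    by (rule elem_eqI) (use \<omega> assms in \<open>auto simp: kms_states_def states_cbounded_linear elem_def\<close>)
qed (use assms in \<open>auto simp: elem_def\<close>)

text \<open>The factor \<open>exp (- |\<mu>| \<beta>)\<close> splits off the series, and summing
  over the words of length \<open>m\<close> gives the \<open>m\<close>-th power of
  \<open>transfer\<close>; what remains is the value on the coefficient algebra.\<close>

lemma kms_of_state_eq: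
  assumes "\<psi> \<in> states" "gauge_invariant_values \<psi> \<beta>" "\<beta> \<noteq> 0" "\<tau> \<in> states"
    and sums: "\<And>a. (\<lambda>m. of_real (exp (- \<beta>) ^ m) * \<tau> ((transfer ^^ m) a)) sums s a"
    and val: "\<And>a. \<psi> (\<iota> a) = of_real (1 - exp (- \<beta>) * real CARD('n)) * s a"
  shows "kms_of_state \<alpha> \<iota> V \<beta> \<tau> = \<psi>"
  unfolding kms_of_state_def
proof (rule kms_state_with_values_eq)
  show "\<psi> \<in> kms_states (gauge_flow \<iota> V) \<beta>"
    using assms by (simp add: kms_states_iff)
  fix \<mu> \<nu> :: "'n list" and a
  have "complex_of_real (exp (- (real (m + length \<mu>) * \<beta>))) * (\<Sum>w | length w = m. \<tau> (word_map \<alpha> (rev w) a)) =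
      of_real (exp (- (real (length \<mu>) * \<beta>))) * (of_real (exp (- \<beta>) ^ m) * \<tau> ((transfer ^^ m) a))" for m
  proof -
    have "exp (- (real (m + length \<mu>) * \<beta>)) = exp (- (real (length \<mu>) * \<beta>)) * exp (- \<beta>) ^ m"
      by (simp add: algebra_simps flip: exp_add exp_of_nat_mult)
    then show ?thesis
      using assms(4) by (simp add: cbounded_linearD(7)[OF states_cbounded_linear] flip: sum_word_map_rev)
  qed
  then have "suminf (\<lambda>m. complex_of_real (exp (- (real (m + length \<mu>) * \<beta>))) *
        (\<Sum>w | length w = m. \<tau> (word_map \<alpha> (rev w) a))) =
      of_real (exp (- (real (length \<mu>) * \<beta>))) * s a"
    using sums_unique[OF sums_mult[OF sums[of a], of "of_real (exp (- (real (length \<mu>) * \<beta>)))"]] by simp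
  then show "\<psi> (elem \<mu> a \<nu>) =
      (if \<mu> = \<nu> then of_real (1 - exp (- \<beta>) * real CARD('n)) *
        suminf (\<lambda>m. complex_of_real (exp (- (real (m + length \<mu>) * \<beta>))) *
          (\<Sum>w | length w = m. \<tau> (word_map \<alpha> (rev w) a))) else 0)"
    using assms(2) by (auto simp: gauge_invariant_values_def val)
qed

lemma critical_kms_of_state_eq:
  assumes "\<psi> \<in> states" "gauge_invariant_values \<psi> (ln (real CARD('n)))" "ln (real CARD('n)) \<noteq> 0"
    and val: "\<And>a. \<psi> (\<iota> a) = \<tau> a"
  shows "critical_kms_of_state \<alpha> \<iota> V \<tau> = \<psi>"
  unfolding critical_kms_of_state_def
proof (rule kms_state_with_values_eq)
  show "\<psi> \<in> kms_states (gauge_flow \<iota> V) (ln (real CARD('n)))"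
    using assms by (simp add: kms_states_iff)
  have "exp (- (real k * ln (real CARD('n)))) = 1 / real CARD('n) ^ k" for k
    by (simp add: exp_minus exp_of_nat_mult divide_inverse)
  then show "\<psi> (elem \<mu> a \<nu>) = (if \<mu> = \<nu> then \<tau> a / of_nat (CARD('n) ^ length \<mu>) else 0)" for \<mu> \<nu> a
    using assms(2) by (auto simp: gauge_invariant_values_def val)
qed

end

context classical
begin

lemma AVT_states: "\<tau> \<in> AVT \<alpha> \<Longrightarrow> \<tau> \<in> states"
  unfolding AVT_def by blast

lemma AVT_convex:
  assumes \<tau>: "\<tau> \<in> AVT \<alpha>" and \<omega>: "\<omega> \<in> AVT \<alpha>" and t: "t \<in> {0..1}"
  shows "(\<lambda>a. of_real t * \<tau> a + of_real (1 - t) * \<omega> a) \<in> AVT \<alpha>"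
proof -
  have "of_real t * \<tau> a + of_real (1 - t) * \<omega> a =
      (1 / of_nat CARD('n)) * (\<Sum>i\<in>UNIV. of_real t * \<tau> (\<alpha> i a) + of_real (1 - t) * \<omega> (\<alpha> i a))" for a
  proof -
    have "\<tau> a = (1 / of_nat CARD('n)) * (\<Sum>i\<in>UNIV. \<tau> (\<alpha> i a))"
      "\<omega> a = (1 / of_nat CARD('n)) * (\<Sum>i\<in>UNIV. \<omega> (\<alpha> i a))"
      using \<tau> \<omega> unfolding AVT_def by blast+
    then show ?thesis
      by (simp only: sum.distrib flip: sum_distrib_left) (simp only: distrib_left mult.left_commute)
  qed
  then show ?thesis
    unfolding AVT_def using states_convex[OF AVT_states[OF \<tau>] AVT_states[OF \<omega>] t] by blast
qed

text \<open>The prescribed values written through powers of \<open>transfer\<close> alone, the form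
  in which a piecewise conjugacy can act on them.\<close>

definition kms_value :: "real \<Rightarrow> (('x \<Rightarrow>\<^sub>C complex) \<Rightarrow> complex) \<Rightarrow> 'n list \<Rightarrow> 'n list \<Rightarrow> ('x \<Rightarrow>\<^sub>C complex) \<Rightarrow> complex" where
  "kms_value \<beta> \<tau> \<mu> \<nu> a = (if \<mu> = \<nu> then of_real (exp (- (real (length \<mu>) * \<beta>))) *
     (of_real (1 - exp (- \<beta>) * real CARD('n)) * suminf (\<lambda>m. of_real (exp (- \<beta>) ^ m) * \<tau> ((transfer ^^ m) a))) else 0)"

end

section \<open>Recovering the parameter from a KMS state\<close>

locale classical_rep = classical \<sigma> + gauge_rep "classical_system \<sigma>" \<iota> V
  for \<sigma> :: "'n::finite \<Rightarrow> 'x::topological_space \<Rightarrow> 'x" and \<iota> :: "('x \<Rightarrow>\<^sub>C complex) \<Rightarrow> 'b::cstar_algebra" and V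
begin

lemma state_\<iota>_state: "\<psi> \<in> states \<Longrightarrow> (\<lambda>a. \<psi> (\<iota> a)) \<in> states"
  using bcontfun_positive_functional_state[OF state_\<iota>(1)] state_\<iota>(2) by simp

lemma state_\<iota>_le: "\<psi> \<in> states \<Longrightarrow> cmod (\<psi> (\<iota> a)) \<le> norm a"
  using bcontfun_positive_functional_le[OF state_\<iota>(1)] state_\<iota>(2) by simp

text \<open>For a KMS state the denominator is the value on \<open>defect\<close>, because
  \<open>transfer 1\<close> is the number of letters.\<close>

definition defect_state :: "real \<Rightarrow> ('b \<Rightarrow> complex) \<Rightarrow> ('x \<Rightarrow>\<^sub>C complex) \<Rightarrow> complex" where
  "defect_state \<beta> \<psi> a = \<psi> (\<iota> a * defect) / of_real (1 - exp (- \<beta>) * real CARD('n))"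

context
  fixes \<beta> :: real
  assumes subcritical: "ln (real CARD('n)) < \<beta>"
begin

lemma beta_pos: "\<beta> > 0"
proof -
  have "ln (real CARD('n)) \<ge> 0"
    by (simp add: Suc_leI)
  then show ?thesis
    using subcritical by linarith
qed

lemma ratio_less_1: "exp (- \<beta>) * real CARD('n) < 1"
proof -
  have "real CARD('n) < exp \<beta>"
    using subcritical ln_less_cancel_iff[of "real CARD('n)" "exp \<beta>"] by simp
  then show ?thesis
    by (simp add: exp_minus field_simps)
qed

lemma ratio_neq_1: "complex_of_real (exp (- \<beta>)) * of_nat CARD('n) \<noteq> 1"
  using ratio_less_1 by (metis less_irrefl of_real_1 of_real_eq_iff of_real_mult of_real_of_nat_eq)

lemma defect_state_state:
  assumes "\<psi> \<in> states" "gauge_invariant_values \<psi> \<beta>"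
  shows "defect_state \<beta> \<psi> \<in> states"
proof (rule bcontfun_positive_functional_state)
  note lin = cbounded_linearD[OF states_cbounded_linear[OF assms(1)]]
  show "positive_functional (defect_state \<beta> \<psi>)"
    unfolding positive_functional_def
  proof (intro conjI allI)
    fix a b c
    show "defect_state \<beta> \<psi> (a + b) = defect_state \<beta> \<psi> a + defect_state \<beta> \<psi> b"
      by (simp add: defect_state_def \<iota>_add distrib_right lin add_divide_distrib)
    show "defect_state \<beta> \<psi> (c *\<^sub>C a) = c * defect_state \<beta> \<psi> a"
      by (simp add: defect_state_def \<iota>_scale cscale_mult_left lin)
    have "\<psi> (\<iota> (star a * a) * defect) \<in> \<real>\<^sub>\<ge>\<^sub>0"
      using assms(1) by (simp add: states_iff flip: star_\<iota>_defect)
    then show "defect_state \<beta> \<psi> (star a * a) \<in> \<real>\<^sub>\<ge>\<^sub>0"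
      unfolding defect_state_def using ratio_less_1
      by (intro nonneg_Reals_divide_I) (auto simp del: of_real_diff of_real_mult)
  qed
  have "\<iota> (transfer 1) = of_nat CARD('n) *\<^sub>C 1"
  proof -
    have "transfer 1 = of_nat CARD('n) *\<^sub>C 1"
      by (rule bcontfun_eqI) (simp add: transfer_def apply_bcontfun_sum apply_\<alpha>)
    then show ?thesis
      by (simp add: \<iota>_scale)
  qed
  then show "defect_state \<beta> \<psi> 1 = 1"
    using ratio_neq_1 assms
    by (simp add: defect_state_def values_defect[OF assms, of 1, simplified] states_one lin)
qed

text \<open>By \<open>values_defect\<close> the terms are, up to the normalisation, differences of
  consecutive \<open>?c m\<close>. The series telescopes, and \<open>?c\<close> tends to 0 because
  \<open>exp (- \<beta>) * CARD('n) < 1\<close>.\<close>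

lemma defect_state_sums:
  assumes "\<psi> \<in> states" "gauge_invariant_values \<psi> \<beta>"
  shows "(\<lambda>m. of_real (exp (- \<beta>) ^ m) * defect_state \<beta> \<psi> ((transfer ^^ m) a)) sums
    (\<psi> (\<iota> a) / of_real (1 - exp (- \<beta>) * real CARD('n)))"
proof -
  let ?c = "\<lambda>m. of_real (exp (- \<beta>) ^ m) * \<psi> (\<iota> ((transfer ^^ m) a))"
  have "?c \<longlonglongrightarrow> 0"
  proof (rule Lim_null_comparison)
    show "\<forall>\<^sub>F m in sequentially. norm (?c m) \<le> (exp (- \<beta>) * real CARD('n)) ^ m * norm a"
    proof (intro always_eventually allI)
      fix m
      have "norm (?c m) \<le> exp (- \<beta>) ^ m * (real CARD('n) ^ m * norm a)"
        unfolding norm_mult using order_trans[OF state_\<iota>_le[OF assms(1)] norm_transfer_pow]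
        by (auto intro!: mult_mono simp: norm_power)
      then show "norm (?c m) \<le> (exp (- \<beta>) * real CARD('n)) ^ m * norm a"
        by (simp add: power_mult_distrib mult.assoc)
    qed
    show "(\<lambda>m. (exp (- \<beta>) * real CARD('n)) ^ m * norm a) \<longlonglongrightarrow> 0"
      using ratio_less_1 by (intro tendsto_mult_left_zero LIMSEQ_power_zero) auto
  qed
  then have "(\<lambda>m. ?c m - ?c (Suc m)) sums \<psi> (\<iota> a)"
    using telescope_sums'[of ?c 0] by simp
  then show ?thesis
    using sums_divide[of "\<lambda>m. ?c m - ?c (Suc m)" "\<psi> (\<iota> a)" "of_real (1 - exp (- \<beta>) * real CARD('n))"]
    by (simp add: defect_state_def values_defect[OF assms] algebra_simps)
qed

text \<open>Dropping the first term of the series gives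
  \<open>s a - exp (- \<beta>) * s (transfer a) = \<tau> a\<close>, and the left side is what
  \<open>values_defect\<close> computes, up to the normalisation.\<close>

lemma defect_state_eq:
  assumes \<psi>: "\<psi> \<in> states" "gauge_invariant_values \<psi> \<beta>"
    and sums: "\<And>a. (\<lambda>m. of_real (exp (- \<beta>) ^ m) * \<tau> ((transfer ^^ m) a)) sums s a"
    and val: "\<And>a. \<psi> (\<iota> a) = of_real (1 - exp (- \<beta>) * real CARD('n)) * s a"
  shows "defect_state \<beta> \<psi> = \<tau>"
proof
  fix a
  have "(\<lambda>m. of_real (exp (- \<beta>) ^ Suc m) * \<tau> ((transfer ^^ Suc m) a)) sums
      (of_real (exp (- \<beta>)) * s (transfer a))"
    using sums_mult[OF sums[of "transfer a"], of "of_real (exp (- \<beta>))"]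
    by (simp add: funpow_swap1 mult.assoc)
  moreover have "(\<lambda>m. of_real (exp (- \<beta>) ^ Suc m) * \<tau> ((transfer ^^ Suc m) a)) sums (s a - \<tau> a)"
    using sums[of a] by (subst sums_Suc_iff) simp
  ultimately have "of_real (exp (- \<beta>)) * s (transfer a) = s a - \<tau> a"
    by (rule sums_unique2)
  then have "s a - of_real (exp (- \<beta>)) * s (transfer a) = \<tau> a"
    by simp
  moreover have "\<psi> (\<iota> a * defect) =
      of_real (1 - exp (- \<beta>) * real CARD('n)) * (s a - of_real (exp (- \<beta>)) * s (transfer a))"
    by (simp only: values_defect[OF \<psi>] val algebra_simps)
  ultimately show "defect_state \<beta> \<psi> a = \<tau> a"
    using ratio_neq_1 by (simp add: defect_state_def)
qed

lemma kms_of_state_defect_state: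
  assumes "\<psi> \<in> states" "gauge_invariant_values \<psi> \<beta>"
  shows "kms_of_state \<alpha> \<iota> V \<beta> (defect_state \<beta> \<psi>) = \<psi>"
  by (rule kms_of_state_eq[OF assms _ defect_state_state[OF assms] defect_state_sums[OF assms]])
    (use beta_pos ratio_neq_1 in auto)

text \<open>Given KMS states \<Psi> \<tau> with the right restriction to the coefficients,
  \<open>defect_state\<close> is a weak*-continuous inverse. The parameter set \<open>S\<close> is
  kept abstract: all states for the Toeplitz algebra, those vanishing on \<open>J_ideal\<close> for
  the quotient.\<close>

lemma subcritical_parametrization:
  assumes S: "S \<subseteq> states"
      "\<And>\<tau> \<omega> t. \<tau> \<in> S \<Longrightarrow> \<omega> \<in> S \<Longrightarrow> t \<in> {0..1} \<Longrightarrow> (\<lambda>a. of_real t * \<tau> a + of_real (1 - t) * \<omega> a) \<in> S"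
      "\<And>\<psi>. \<psi> \<in> states \<Longrightarrow> gauge_invariant_values \<psi> \<beta> \<Longrightarrow> defect_state \<beta> \<psi> \<in> S"
    and \<Psi>: "\<And>\<tau>. \<tau> \<in> S \<Longrightarrow> \<Psi> \<tau> \<in> states" "\<And>\<tau>. \<tau> \<in> S \<Longrightarrow> gauge_invariant_values (\<Psi> \<tau>) \<beta>"
      "\<And>b. continuous_on S (\<lambda>\<tau>. \<Psi> \<tau> b)"
    and sums: "\<And>\<tau> a. \<tau> \<in> S \<Longrightarrow> (\<lambda>m. of_real (exp (- \<beta>) ^ m) * \<tau> ((transfer ^^ m) a)) sums s \<tau> a"
    and val: "\<And>\<tau> a. \<tau> \<in> S \<Longrightarrow> \<Psi> \<tau> (\<iota> a) = of_real (1 - exp (- \<beta>) * real CARD('n)) * s \<tau> a"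
  shows "affine_weak_star_homeomorphism S (kms_states (gauge_flow \<iota> V) \<beta>) (kms_of_state \<alpha> \<iota> V \<beta>)"
    and "\<And>\<tau> \<mu> a \<nu>. \<tau> \<in> S \<Longrightarrow> kms_of_state \<alpha> \<iota> V \<beta> \<tau> (elem \<mu> a \<nu>) = kms_value \<beta> \<tau> \<mu> \<nu> a"
proof -
  have \<beta>: "\<beta> \<noteq> 0"
    using beta_pos by simp
  have eq: "kms_of_state \<alpha> \<iota> V \<beta> \<tau> = \<Psi> \<tau>" if "\<tau> \<in> S" for \<tau>
    by (rule kms_of_state_eq[where s = "s \<tau>"]) (use that assms \<beta> in auto)
  show "kms_of_state \<alpha> \<iota> V \<beta> \<tau> (elem \<mu> a \<nu>) = kms_value \<beta> \<tau> \<mu> \<nu> a" if "\<tau> \<in> S" for \<tau> \<mu> a \<nu>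
  proof -
    have "suminf (\<lambda>m. of_real (exp (- \<beta>) ^ m) * \<tau> ((transfer ^^ m) a)) = s \<tau> a"
      using sums_unique[OF sums[OF that, of a]] by simp
    then have "kms_value \<beta> \<tau> \<mu> \<nu> a =
        (if \<mu> = \<nu> then of_real (exp (- (real (length \<mu>) * \<beta>))) * \<Psi> \<tau> (\<iota> a) else 0)"
      by (simp only: kms_value_def val[OF that])
    then show ?thesis
      using \<Psi>(2)[OF that] by (simp add: eq[OF that] gauge_invariant_values_def)
  qed
  show "affine_weak_star_homeomorphism S (kms_states (gauge_flow \<iota> V) \<beta>) (kms_of_state \<alpha> \<iota> V \<beta>)"
  proof (rule affine_weak_star_homeomorphismI[where g = "defect_state \<beta>"])
    show "continuous_on S (\<lambda>\<tau>. kms_of_state \<alpha> \<iota> V \<beta> \<tau> b)" for b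
      using \<Psi>(3)[of b] by (rule continuous_on_eq) (simp add: eq)
    show "continuous_on (kms_states (gauge_flow \<iota> V) \<beta>) (\<lambda>\<psi>. defect_state \<beta> \<psi> a)" for a
      unfolding defect_state_def using ratio_neq_1
      by (intro continuous_intros continuous_on_subset[OF continuous_on_product_coordinates]) auto
    fix \<tau>
    assume \<tau>: "\<tau> \<in> S"
    show "kms_of_state \<alpha> \<iota> V \<beta> \<tau> \<in> kms_states (gauge_flow \<iota> V) \<beta>"
      by (simp add: eq \<tau> \<Psi> kms_states_iff \<beta>)
    show "defect_state \<beta> (kms_of_state \<alpha> \<iota> V \<beta> \<tau>) = \<tau>"
      unfolding eq[OF \<tau>] by (rule defect_state_eq[OF \<Psi>(1,2)[OF \<tau>] sums[OF \<tau>] val[OF \<tau>]])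
  next
    fix \<psi>
    assume "\<psi> \<in> kms_states (gauge_flow \<iota> V) \<beta>"
    then have \<psi>: "\<psi> \<in> states" "gauge_invariant_values \<psi> \<beta>"
      by (auto simp: kms_states_iff \<beta>)
    show "defect_state \<beta> \<psi> \<in> S"
      by (rule S(3)[OF \<psi>])
    show "kms_of_state \<alpha> \<iota> V \<beta> (defect_state \<beta> \<psi>) = \<psi>"
      by (rule kms_of_state_defect_state[OF \<psi>])
  next
    fix \<tau> \<omega> and t :: real
    assume *: "\<tau> \<in> S" "\<omega> \<in> S" "t \<in> {0..1}"
    let ?s = "\<lambda>a. of_real t * s \<tau> a + of_real (1 - t) * s \<omega> a"
    show "kms_of_state \<alpha> \<iota> V \<beta> (\<lambda>a. of_real t * \<tau> a + of_real (1 - t) * \<omega> a) =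
        (\<lambda>b. of_real t * kms_of_state \<alpha> \<iota> V \<beta> \<tau> b + of_real (1 - t) * kms_of_state \<alpha> \<iota> V \<beta> \<omega> b)"
      unfolding eq[OF *(1)] eq[OF *(2)]
    proof (rule kms_of_state_eq[where s = ?s])
      show "(\<lambda>m. of_real (exp (- \<beta>) ^ m) *
          (of_real t * \<tau> ((transfer ^^ m) a) + of_real (1 - t) * \<omega> ((transfer ^^ m) a))) sums ?s a" for a
        using sums_add[OF sums_mult[OF sums[OF *(1), of a], of "of_real t"]
            sums_mult[OF sums[OF *(2), of a], of "of_real (1 - t)"]]
        by (simp only: distrib_left mult.left_commute)
      show "of_real t * \<Psi> \<tau> (\<iota> a) + of_real (1 - t) * \<Psi> \<omega> (\<iota> a) =
          of_real (1 - exp (- \<beta>) * real CARD('n)) * ?s a" for a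
        unfolding val[OF *(1)] val[OF *(2)] by (simp only: distrib_left mult.left_commute)
      show "(\<lambda>a. of_real t * \<tau> a + of_real (1 - t) * \<omega> a) \<in> states"
        using S(1,2) * by blast
    qed (use * \<Psi> \<beta> in \<open>auto intro!: states_convex gauge_invariant_values_convex simp del: of_real_diff\<close>)
  qed
qed

end

text \<open>Here \<open>exp (- \<beta>)\<close> is \<open>1 / CARD('n)\<close>, so with
  \<open>defect = 0\<close> the formula \<open>values_defect\<close> becomes the averaging
  condition. The inverse map is restriction to the coefficient algebra.\<close>

lemma critical_parametrization:
  assumes "ln (real CARD('n)) > 0" and defect: "defect = 0"
    and \<Psi>: "\<And>\<tau>. \<tau> \<in> AVT \<alpha> \<Longrightarrow> \<Psi> \<tau> \<in> states"
      "\<And>\<tau>. \<tau> \<in> AVT \<alpha> \<Longrightarrow> gauge_invariant_values (\<Psi> \<tau>) (ln (real CARD('n)))"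
      "\<And>b. continuous_on (AVT \<alpha>) (\<lambda>\<tau>. \<Psi> \<tau> b)" "\<And>\<tau> a. \<tau> \<in> AVT \<alpha> \<Longrightarrow> \<Psi> \<tau> (\<iota> a) = \<tau> a"
  shows "affine_weak_star_homeomorphism (AVT \<alpha>) (kms_states (gauge_flow \<iota> V) (ln (real CARD('n))))
      (critical_kms_of_state \<alpha> \<iota> V)"
    and "\<And>\<tau> \<mu> a \<nu>. \<tau> \<in> AVT \<alpha> \<Longrightarrow> critical_kms_of_state \<alpha> \<iota> V \<tau> (elem \<mu> a \<nu>) =
      (if \<mu> = \<nu> then of_real (exp (- (real (length \<mu>) * ln (real CARD('n))))) * \<tau> a else 0)"
proof -
  let ?\<beta> = "ln (real CARD('n))"
  have \<beta>: "?\<beta> \<noteq> 0"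
    using assms(1) by simp
  have eq: "critical_kms_of_state \<alpha> \<iota> V \<tau> = \<Psi> \<tau>" if "\<tau> \<in> AVT \<alpha>" for \<tau>
    by (rule critical_kms_of_state_eq) (use that \<Psi> \<beta> in auto)
  show "critical_kms_of_state \<alpha> \<iota> V \<tau> (elem \<mu> a \<nu>) =
      (if \<mu> = \<nu> then of_real (exp (- (real (length \<mu>) * ?\<beta>))) * \<tau> a else 0)" if "\<tau> \<in> AVT \<alpha>" for \<tau> \<mu> a \<nu>
    using \<Psi>(2)[OF that, unfolded gauge_invariant_values_def, rule_format, of \<mu> a \<nu>]
    by (simp only: eq[OF that] \<Psi>(4)[OF that])
  show "affine_weak_star_homeomorphism (AVT \<alpha>) (kms_states (gauge_flow \<iota> V) ?\<beta>) (critical_kms_of_state \<alpha> \<iota> V)"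
  proof (rule affine_weak_star_homeomorphismI[where g = "\<lambda>\<psi> a. \<psi> (\<iota> a)"])
    show "continuous_on (AVT \<alpha>) (\<lambda>\<tau>. critical_kms_of_state \<alpha> \<iota> V \<tau> b)" for b
      using \<Psi>(3)[of b] by (rule continuous_on_eq) (simp add: eq)
    show "continuous_on (kms_states (gauge_flow \<iota> V) ?\<beta>) (\<lambda>\<psi>. \<psi> (\<iota> a))" for a
      by (rule continuous_on_subset[OF continuous_on_product_coordinates]) auto
    fix \<tau>
    assume \<tau>: "\<tau> \<in> AVT \<alpha>"
    show "critical_kms_of_state \<alpha> \<iota> V \<tau> \<in> kms_states (gauge_flow \<iota> V) ?\<beta>"
      by (simp add: eq \<tau> \<Psi> kms_states_iff \<beta>)
    show "(\<lambda>a. critical_kms_of_state \<alpha> \<iota> V \<tau> (\<iota> a)) = \<tau>"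
      by (simp add: eq \<tau> \<Psi>)
  next
    fix \<psi>
    assume "\<psi> \<in> kms_states (gauge_flow \<iota> V) ?\<beta>"
    then have \<psi>: "\<psi> \<in> states" "gauge_invariant_values \<psi> ?\<beta>"
      by (auto simp: kms_states_iff \<beta>)
    have "\<psi> (\<iota> a) = (1 / of_nat CARD('n)) * (\<Sum>i\<in>UNIV. \<psi> (\<iota> (\<alpha> i a)))" for a
    proof -
      have "exp (- ?\<beta>) = 1 / real CARD('n)"
        by (simp add: exp_minus divide_inverse)
      then have "0 = \<psi> (\<iota> a) - (1 / of_nat CARD('n)) * \<psi> (\<iota> (transfer a))"
        using values_defect[OF \<psi>, of a] cbounded_linearD(3)[OF states_cbounded_linear[OF \<psi>(1)]]
        by (simp add: defect)
      moreover have "\<psi> (\<iota> (transfer a)) = (\<Sum>i\<in>UNIV. \<psi> (\<iota> (\<alpha> i a)))"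
        by (simp only: transfer_def \<iota>_sum cbounded_linearD(7)[OF states_cbounded_linear[OF \<psi>(1)]])
      ultimately show ?thesis
        by simp
    qed
    then show "(\<lambda>a. \<psi> (\<iota> a)) \<in> AVT \<alpha>"
      unfolding AVT_def using state_\<iota>_state[OF \<psi>(1)] by blast
    show "critical_kms_of_state \<alpha> \<iota> V (\<lambda>a. \<psi> (\<iota> a)) = \<psi>"
      by (rule critical_kms_of_state_eq) (use \<psi> \<beta> in auto)
  next
    fix \<tau> \<omega> and t :: real
    assume *: "\<tau> \<in> AVT \<alpha>" "\<omega> \<in> AVT \<alpha>" "t \<in> {0..1}"
    show "critical_kms_of_state \<alpha> \<iota> V (\<lambda>a. of_real t * \<tau> a + of_real (1 - t) * \<omega> a) =
        (\<lambda>b. of_real t * critical_kms_of_state \<alpha> \<iota> V \<tau> b + of_real (1 - t) * critical_kms_of_state \<alpha> \<iota> V \<omega> b)"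
      unfolding eq[OF *(1)] eq[OF *(2)]
      by (rule critical_kms_of_state_eq)
        (use * \<Psi> \<beta> in \<open>auto intro!: states_convex gauge_invariant_values_convex simp del: of_real_diff\<close>)
  qed
qed

end


section \<open>Construction of KMS states on the Toeplitz algebra\<close>

context classical_toeplitz
begin

sublocale classical_rep \<sigma> \<iota> V ..

context
  fixes \<beta> :: real
  assumes subcritical: "ln (real CARD('n)) < \<beta>"
begin

text \<open>The series converges in norm: \<open>compress m\<close> adds up
  \<open>CARD('n) ^ m\<close> contractions, and
  \<open>exp (- \<beta>) * CARD('n) < 1\<close>.\<close>

definition expectation :: "'b \<Rightarrow> 'x \<Rightarrow>\<^sub>C complex" where
  "expectation b = suminf (\<lambda>m. exp (- \<beta>) ^ m *\<^sub>R compress m b)"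

lemma norm_expectation_term_le:
  "norm (exp (- \<beta>) ^ m *\<^sub>R compress m b) \<le> (exp (- \<beta>) * real CARD('n)) ^ m * norm b"
  using mult_left_mono[OF norm_compress_le[of m b], of "exp (- \<beta>) ^ m"]
  by (simp add: power_mult_distrib mult.assoc)

lemma summable_ratio: "summable (\<lambda>m. (exp (- \<beta>) * real CARD('n)) ^ m * c)"
  using ratio_less_1[OF subcritical] by (intro summable_mult2 summable_geometric) auto

lemma expectation_sums: "(\<lambda>m. exp (- \<beta>) ^ m *\<^sub>R compress m b) sums expectation b"
  unfolding expectation_def
  by (rule summable_sums, rule summable_comparison_test[OF _ summable_ratio[of "norm b"]])
    (use norm_expectation_term_le in auto)

lemma cbounded_linear_expectation: "cbounded_linear expectation"
proof -
  note c = cbounded_linearD[OF cbounded_linear_compress]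
  have add: "expectation (x + y) = expectation x + expectation y" for x y
  proof (rule sums_unique2[OF expectation_sums[of "x + y"]])
    show "(\<lambda>m. exp (- \<beta>) ^ m *\<^sub>R compress m (x + y)) sums (expectation x + expectation y)"
      using sums_add[OF expectation_sums[of x] expectation_sums[of y]] by (simp add: c scaleR_add_right)
  qed
  have scale: "expectation (z *\<^sub>C x) = z *\<^sub>C expectation x" for z x
  proof (rule sums_unique2[OF expectation_sums[of "z *\<^sub>C x"]])
    have "(\<lambda>m. z *\<^sub>C (exp (- \<beta>) ^ m *\<^sub>R compress m x)) sums (z *\<^sub>C expectation x)"
      by (rule bounded_linear.sums[OF bounded_linear_cscale expectation_sums])
    then show "(\<lambda>m. exp (- \<beta>) ^ m *\<^sub>R compress m (z *\<^sub>C x)) sums (z *\<^sub>C expectation x)"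
      by (simp add: c scaleR_conv_cscale cscale_cscale mult.commute)
  qed
  have "norm (expectation x) \<le> suminf (\<lambda>m. (exp (- \<beta>) * real CARD('n)) ^ m * norm x)" for x
    unfolding expectation_def by (rule norm_suminf_le[OF norm_expectation_term_le summable_ratio])
  also have "suminf (\<lambda>m. (exp (- \<beta>) * real CARD('n)) ^ m * norm x) =
      suminf (\<lambda>m. (exp (- \<beta>) * real CARD('n)) ^ m) * norm x" for x
    using ratio_less_1[OF subcritical] by (intro suminf_mult2[symmetric] summable_geometric) auto
  finally have "bounded_linear expectation"
    by (intro bounded_linear_of_complex_linear[OF add scale])
  then show ?thesis
    by (simp add: cbounded_linear_def scale)
qed

lemma expectation_positive: "apply_bcontfun (expectation (star b * b)) x \<in> \<real>\<^sub>\<ge>\<^sub>0"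
proof (rule nonneg_Reals_sums)
  show "(\<lambda>m. apply_bcontfun (exp (- \<beta>) ^ m *\<^sub>R compress m (star b * b)) x) sums
      apply_bcontfun (expectation (star b * b)) x"
    by (rule bounded_linear.sums[OF cbounded_linearD(1)[OF cbounded_linear_apply_bcontfun] expectation_sums])
  show "apply_bcontfun (exp (- \<beta>) ^ m *\<^sub>R compress m (star b * b)) x \<in> \<real>\<^sub>\<ge>\<^sub>0" for m
    using compress_positive[of m b x]
    by (auto simp: scaleR_conv_cscale simp del: of_real_power intro!: nonneg_Reals_mult_I)
qed

lemma expectation_\<iota>_sums: "(\<lambda>m. exp (- \<beta>) ^ m *\<^sub>R (transfer ^^ m) a) sums expectation (\<iota> a)"
  using expectation_sums[of "elem [] a []"] compress_elem[of _ "[]" a] by simp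

text \<open>A word of length \<open>m < length \<mu>\<close> cannot begin with \<mu>, so these terms
  vanish; shifting the index by \<open>length \<mu>\<close> leaves the series of
  \<open>\<iota> a\<close>.\<close>

lemma expectation_elem:
  "expectation (elem \<mu> a \<nu>) = (if \<mu> = \<nu> then exp (- \<beta>) ^ length \<mu> *\<^sub>R expectation (\<iota> a) else 0)"
proof (cases "\<mu> = \<nu>")
  case False
  then show ?thesis
    by (simp add: expectation_def compress_elem_eq_0)
next
  case True
  let ?f = "\<lambda>m. exp (- \<beta>) ^ m *\<^sub>R compress m (elem \<mu> a \<mu>)"
  have "(\<lambda>m. exp (- \<beta>) ^ length \<mu> *\<^sub>R (exp (- \<beta>) ^ m *\<^sub>R (transfer ^^ m) a)) sums
      (exp (- \<beta>) ^ length \<mu> *\<^sub>R expectation (\<iota> a))"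
    by (rule sums_scaleR_right[OF expectation_\<iota>_sums])
  then have "(\<lambda>m. ?f (m + length \<mu>)) sums (exp (- \<beta>) ^ length \<mu> *\<^sub>R expectation (\<iota> a))"
    by (simp add: compress_elem power_add mult.commute)
  then have "?f sums (exp (- \<beta>) ^ length \<mu> *\<^sub>R expectation (\<iota> a) + (\<Sum>m<length \<mu>. ?f m))"
    by (rule sums_iff_shift[THEN iffD1])
  moreover have "(\<Sum>m<length \<mu>. ?f m) = 0"
    by (intro sum.neutral) (simp add: compress_elem_eq_0)
  ultimately show ?thesis
    using sums_unique2[OF expectation_sums[of "elem \<mu> a \<mu>"]] True by simp
qed

definition subcritical_state :: "(('x \<Rightarrow>\<^sub>C complex) \<Rightarrow> complex) \<Rightarrow> 'b \<Rightarrow> complex" where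
  "subcritical_state \<tau> b = of_real (1 - exp (- \<beta>) * real CARD('n)) * \<tau> (expectation b)"

lemma subcritical_sums:
  assumes "\<tau> \<in> states"
  shows "(\<lambda>m. of_real (exp (- \<beta>) ^ m) * \<tau> ((transfer ^^ m) a)) sums \<tau> (expectation (\<iota> a))"
proof -
  note lin = cbounded_linearD[OF states_cbounded_linear[OF assms]]
  have "(\<lambda>m. \<tau> (exp (- \<beta>) ^ m *\<^sub>R (transfer ^^ m) a)) sums \<tau> (expectation (\<iota> a))"
    by (rule bounded_linear.sums[OF lin(1) expectation_\<iota>_sums])
  then show ?thesis
    by (simp add: scaleR_conv_cscale lin del: of_real_power)
qed

lemma gauge_invariant_subcritical_state:
  assumes "\<tau> \<in> states"
  shows "gauge_invariant_values (subcritical_state \<tau>) \<beta>"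
proof -
  note lin = cbounded_linearD[OF states_cbounded_linear[OF assms]]
  have "exp (- \<beta>) ^ k = exp (- (real k * \<beta>))" for k
    by (simp flip: exp_of_nat_mult)
  then show ?thesis
    by (auto simp: gauge_invariant_values_def subcritical_state_def expectation_elem lin scaleR_conv_cscale)
qed

lemma subcritical_state_state:
  assumes "\<tau> \<in> states"
  shows "subcritical_state \<tau> \<in> states"
  unfolding states_iff
proof (intro conjI allI)
  note lin = cbounded_linearD[OF states_cbounded_linear[OF assms]]
  show "cbounded_linear (subcritical_state \<tau>)"
    using cbounded_linear_cscale[OF cbounded_linear_compose[OF states_cbounded_linear[OF assms]
        cbounded_linear_expectation], of "of_real (1 - exp (- \<beta>) * real CARD('n))"]
    by (simp add: subcritical_state_def[abs_def])
  show "subcritical_state \<tau> (star x * x) \<in> \<real>\<^sub>\<ge>\<^sub>0" for x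
    unfolding subcritical_state_def
  proof (rule nonneg_Reals_mult_I)
    show "of_real (1 - exp (- \<beta>) * real CARD('n)) \<in> \<real>\<^sub>\<ge>\<^sub>0"
      using ratio_less_1[OF subcritical] by (simp only: nonneg_Reals_of_real_iff)
    show "\<tau> (expectation (star x * x)) \<in> \<real>\<^sub>\<ge>\<^sub>0"
      by (rule bcontfun_state_nonneg[OF states_positive_functional[OF assms] expectation_positive])
  qed
  \<comment> \<open>The geometric series counting words with weight
    \<open>exp (- \<beta>) ^ m\<close>; its sum is the reciprocal of the normalising factor.\<close>
  have "(\<lambda>m. of_real (exp (- \<beta>) ^ m) * \<tau> ((transfer ^^ m) 1)) sums
      (1 / (1 - of_real (exp (- \<beta>) * real CARD('n))))"
  proof -
    have "of_real (exp (- \<beta>) ^ m) * \<tau> ((transfer ^^ m) 1) = of_real (exp (- \<beta>) * real CARD('n)) ^ m" for m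
    proof -
      have "of_nat k = of_nat k *\<^sub>C (1 :: 'x \<Rightarrow>\<^sub>C complex)" for k
        by (induction k) (auto simp: cscale_add_left)
      then have "\<tau> (of_nat k) = \<tau> (of_nat k *\<^sub>C 1)" for k
        by (rule arg_cong)
      then have "\<tau> (of_nat k) = of_nat k" for k
        by (simp add: lin(6) states_one[OF assms])
      then show ?thesis
        by (simp only: transfer_pow_one) (simp add: power_mult_distrib)
    qed
    moreover have "cmod (of_real (exp (- \<beta>) * real CARD('n))) < 1"
      using ratio_less_1[OF subcritical] by (simp only: norm_of_real) simp
    ultimately show ?thesis
      using geometric_sums by simp
  qed
  from sums_unique2[OF subcritical_sums[OF assms, of 1] this] show "subcritical_state \<tau> 1 = 1"
    using ratio_neq_1[OF subcritical] by (simp add: subcritical_state_def field_simps)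
qed

lemma continuous_subcritical_state: "continuous_on S (\<lambda>\<tau>. subcritical_state \<tau> b)"
  unfolding subcritical_state_def
  by (intro continuous_intros continuous_on_subset[OF continuous_on_product_coordinates]) auto

lemma toeplitz_parametrization:
  "affine_weak_star_homeomorphism states (kms_states (gauge_flow \<iota> V) \<beta>) (kms_of_state \<alpha> \<iota> V \<beta>)"
  "\<tau> \<in> states \<Longrightarrow> kms_of_state \<alpha> \<iota> V \<beta> \<tau> (elem \<mu> a \<nu>) = kms_value \<beta> \<tau> \<mu> \<nu> a"
  by (rule subcritical_parametrization[OF subcritical order_refl states_convex defect_state_state[OF subcritical]
        subcritical_state_state gauge_invariant_subcritical_state continuous_subcritical_state
        subcritical_sums subcritical_state_def]; assumption)+

end

section \<open>KMS states at the critical value \<open>\<beta> = log d\<close>\<close>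

definition critical_state :: "(('x \<Rightarrow>\<^sub>C complex) \<Rightarrow> complex) \<Rightarrow> 'b \<Rightarrow> complex" where
  "critical_state \<tau> b = lim (\<lambda>m. \<tau> (compress m b) / of_nat (CARD('n) ^ m))"

lemma state_le:
  fixes \<tau> :: "('x \<Rightarrow>\<^sub>C complex) \<Rightarrow> complex"
  assumes "\<tau> \<in> states"
  shows "cmod (\<tau> a) \<le> norm a"
  by (rule bcontfun_positive_functional_le[OF states_positive_functional states_one]) (rule assms)+

lemma AVT_transfer_pow: "\<tau> \<in> AVT \<alpha> \<Longrightarrow> \<tau> ((transfer ^^ m) a) = of_nat (CARD('n) ^ m) * \<tau> a"
proof (induction m)
  case (Suc m)
  then have lin: "cbounded_linear \<tau>"
    by (intro states_cbounded_linear AVT_states)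
  have "\<tau> b = (1 / of_nat CARD('n)) * (\<Sum>i\<in>UNIV. \<tau> (\<alpha> i b))" for b
    using Suc.prems unfolding AVT_def by blast
  then have "of_nat CARD('n) * \<tau> b = of_nat CARD('n) * ((1 / of_nat CARD('n)) * (\<Sum>i\<in>UNIV. \<tau> (\<alpha> i b)))" for b
    by (rule arg_cong)
  then have "\<tau> (transfer b) = of_nat CARD('n) * \<tau> b" for b
    by (simp add: transfer_def cbounded_linearD(7)[OF lin])
  then show ?case
    using Suc by simp
qed simp

lemma critical_term_le:
  assumes "\<tau> \<in> states"
  shows "cmod (\<tau> (compress m b) / of_nat (CARD('n) ^ m)) \<le> norm b"
  using order_trans[OF state_le[OF assms] norm_compress_le[of m b]]
  by (simp add: norm_divide norm_power divide_le_eq mult.commute)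

text \<open>Averaging gives \<open>\<tau> ((transfer ^^ m) a) = CARD('n) ^ m * \<tau> a\<close>, so
  for equal words the sequence is constant from \<open>m = length \<mu>\<close> on.\<close>

lemma critical_limit_elem:
  assumes "\<tau> \<in> AVT \<alpha>"
  shows "(\<lambda>m. \<tau> (compress m (elem \<mu> a \<nu>)) / of_nat (CARD('n) ^ m)) \<longlonglongrightarrow>
    (if \<mu> = \<nu> then \<tau> a / of_nat (CARD('n) ^ length \<mu>) else 0)"
proof (cases "\<mu> = \<nu>")
  case False
  then show ?thesis
    by (simp add: compress_elem_eq_0 cbounded_linearD(3)[OF states_cbounded_linear[OF AVT_states[OF assms]]])
next
  case True
  have "(\<lambda>m. \<tau> (compress (m + length \<mu>) (elem \<mu> a \<mu>)) / of_nat (CARD('n) ^ (m + length \<mu>))) \<longlonglongrightarrow>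
      \<tau> a / of_nat (CARD('n) ^ length \<mu>)"
    by (simp add: compress_elem AVT_transfer_pow[OF assms] power_add)
  then have "(\<lambda>m. \<tau> (compress m (elem \<mu> a \<mu>)) / of_nat (CARD('n) ^ m)) \<longlonglongrightarrow> \<tau> a / of_nat (CARD('n) ^ length \<mu>)"
    by (rule LIMSEQ_offset)
  then show ?thesis
    using True by simp
qed

text \<open>Convergence is known on the \<open>elem\<close>s. The normalised functionals are
  contractive uniformly in \<open>m\<close>, so the elements on which they converge form a closed
  subspace.\<close>

lemma critical_limit:
  assumes \<tau>: "\<tau> \<in> AVT \<alpha>"
  shows "(\<lambda>m. \<tau> (compress m b) / of_nat (CARD('n) ^ m)) \<longlonglongrightarrow> critical_state \<tau> b"
proof -
  let ?f = "\<lambda>b m. \<tau> (compress m b) / of_nat (CARD('n) ^ m)"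
  have st: "\<tau> \<in> states"
    by (rule AVT_states[OF \<tau>])
  have lin: "cbounded_linear (\<lambda>b. ?f b m)" for m
    using cbounded_linear_cscale[OF cbounded_linear_compose[OF states_cbounded_linear[OF st]
        cbounded_linear_compress], of "1 / of_nat (CARD('n) ^ m)"] by simp
  have "convergent (?f b)"
  proof (rule elem_induct[where P = "\<lambda>b. convergent (?f b)"])
    show "closed {b. convergent (?f b)}"
    proof (rule closed_sequential_limits[THEN iffD2], safe)
      fix c b
      assume c: "\<forall>n. c n \<in> {b. convergent (?f b)}" and "c \<longlonglongrightarrow> b"
      have "Cauchy (?f b)"
      proof (rule metric_CauchyI)
        fix e :: real
        assume "e > 0"
        then obtain n where n: "dist (c n) b < e / 3"
          using \<open>c \<longlonglongrightarrow> b\<close> metric_LIMSEQ_D[of c b "e / 3"] by auto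
        have near: "dist (?f b m) (?f (c n) m) < e / 3" for m
          using critical_term_le[OF st, of m "b - c n"] n cbounded_linearD(5)[OF lin, of m b "c n"]
          by (simp add: dist_norm norm_minus_commute)
        have "Cauchy (?f (c n))"
          using c by (auto intro: convergent_Cauchy)
        then obtain N where N: "dist (?f (c n) m) (?f (c n) k) < e / 3" if "m \<ge> N" "k \<ge> N" for m k
          using \<open>e > 0\<close> metric_CauchyD[of "?f (c n)" "e / 3"] by auto
        have "dist (?f b m) (?f b k) < e" if "m \<ge> N" "k \<ge> N" for m k
          using near[of m] near[of k] N[OF that] by metric
        then show "\<exists>N. \<forall>m\<ge>N. \<forall>k\<ge>N. dist (?f b m) (?f b k) < e"
          by blast
      qed
      then show "convergent (?f b)"
        by (simp add: Cauchy_convergent_iff)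
    qed
    show "convergent (?f (elem \<mu> a \<nu>))" for \<mu> a \<nu>
      using critical_limit_elem[OF \<tau>] by (rule convergentI)
    show "convergent (?f (x + y))" if "convergent (?f x)" "convergent (?f y)" for x y
      using convergent_add[OF that] by (simp only: cbounded_linearD(2)[OF lin])
    show "convergent (?f (c *\<^sub>C x))" if "convergent (?f x)" for c x
      using convergent_mult[OF convergent_const that, of c]
      by (simp only: cbounded_linearD(6)[OF lin] cscale_complex_eq)
  qed
  then show ?thesis
    unfolding critical_state_def by (rule convergent_LIMSEQ_iff[THEN iffD1])
qed

lemma critical_state_elem:
  assumes "\<tau> \<in> AVT \<alpha>"
  shows "critical_state \<tau> (elem \<mu> a \<nu>) = (if \<mu> = \<nu> then \<tau> a / of_nat (CARD('n) ^ length \<mu>) else 0)"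
  using LIMSEQ_unique[OF critical_limit[OF assms] critical_limit_elem[OF assms]] .

lemma critical_state_\<iota>: "\<tau> \<in> AVT \<alpha> \<Longrightarrow> critical_state \<tau> (\<iota> a) = \<tau> a"
  using critical_state_elem[of \<tau> "[]" a "[]"] by simp

lemma critical_state_linear:
  assumes "\<tau> \<in> AVT \<alpha>"
  shows "critical_state \<tau> (x + y) = critical_state \<tau> x + critical_state \<tau> y"
    and "critical_state \<tau> (c *\<^sub>C x) = c * critical_state \<tau> x"
    and "cmod (critical_state \<tau> x) \<le> norm x"
proof -
  have st: "\<tau> \<in> states"
    by (rule AVT_states[OF assms])
  note lin = cbounded_linearD[OF states_cbounded_linear[OF st]] cbounded_linearD[OF cbounded_linear_compress]
  show "critical_state \<tau> (x + y) = critical_state \<tau> x + critical_state \<tau> y"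
    by (rule LIMSEQ_unique[OF critical_limit[OF assms]])
      (use tendsto_add[OF critical_limit[OF assms, of x] critical_limit[OF assms, of y]]
        in \<open>simp add: lin add_divide_distrib\<close>)
  show "critical_state \<tau> (c *\<^sub>C x) = c * critical_state \<tau> x"
    by (rule LIMSEQ_unique[OF critical_limit[OF assms]])
      (use tendsto_mult[OF tendsto_const critical_limit[OF assms, of x], of c] in \<open>simp add: lin\<close>)
  show "cmod (critical_state \<tau> x) \<le> norm x"
    by (rule tendsto_upperbound[OF tendsto_norm[OF critical_limit[OF assms]]])
      (use critical_term_le[OF st] in auto)
qed

lemma critical_state_state:
  assumes "\<tau> \<in> AVT \<alpha>"
  shows "critical_state \<tau> \<in> states"
  unfolding states_iff
proof (intro conjI allI)
  have st: "\<tau> \<in> states"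
    by (rule AVT_states[OF assms])
  have "bounded_linear (critical_state \<tau>)"
    by (rule bounded_linear_of_complex_linear[where K = 1])
      (use critical_state_linear[OF assms] in auto)
  then show "cbounded_linear (critical_state \<tau>)"
    by (simp add: cbounded_linear_def critical_state_linear[OF assms])
  fix x
  have "\<tau> (compress m (star x * x)) / of_nat (CARD('n) ^ m) \<in> \<real>\<^sub>\<ge>\<^sub>0" for m
    by (rule nonneg_Reals_divide_I[OF bcontfun_state_nonneg[OF states_positive_functional[OF st] compress_positive]])
      simp
  then show "critical_state \<tau> (star x * x) \<in> \<real>\<^sub>\<ge>\<^sub>0"
    using closed_sequentially[OF closed_nonneg_Reals_complex _ critical_limit[OF assms]] by blast
  show "critical_state \<tau> 1 = 1"
    using critical_state_\<iota>[OF assms, of 1] states_one[OF st] by simp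
qed

lemma gauge_invariant_critical_state:
  assumes "\<tau> \<in> AVT \<alpha>"
  shows "gauge_invariant_values (critical_state \<tau>) (ln (real CARD('n)))"
proof -
  have "exp (- (real k * ln (real CARD('n)))) = 1 / real CARD('n) ^ k" for k
    by (simp add: exp_minus exp_of_nat_mult divide_inverse)
  then show ?thesis
    using assms by (auto simp: gauge_invariant_values_def critical_state_elem critical_state_\<iota>)
qed

text \<open>A limit in \<open>m\<close> need not be continuous in \<tau>. On an \<open>elem\<close>
  the value is explicit, and the bound by \<open>norm b\<close>, uniform in \<tau>, makes continuity
  a closed condition on \<open>b\<close>.\<close>

lemma continuous_critical_state: "continuous_on (AVT \<alpha>) (\<lambda>\<tau>. critical_state \<tau> b)"
proof (rule elem_induct[where P = "\<lambda>b. continuous_on (AVT \<alpha>) (\<lambda>\<tau>. critical_state \<tau> b)"])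
  show "closed {b. continuous_on (AVT \<alpha>) (\<lambda>\<tau>. critical_state \<tau> b)}"
  proof (rule closed_sequential_limits[THEN iffD2], safe)
    fix c b
    assume c: "\<forall>n. c n \<in> {b. continuous_on (AVT \<alpha>) (\<lambda>\<tau>. critical_state \<tau> b)}" and "c \<longlonglongrightarrow> b"
    show "continuous_on (AVT \<alpha>) (\<lambda>\<tau>. critical_state \<tau> b)"
    proof (rule uniform_limit_theorem[OF always_eventually])
      show "uniform_limit (AVT \<alpha>) (\<lambda>n \<tau>. critical_state \<tau> (c n)) (\<lambda>\<tau>. critical_state \<tau> b) sequentially"
      proof (rule uniform_limitI)
        fix e :: real
        assume "e > 0"
        then have "\<forall>\<^sub>F n in sequentially. dist (c n) b < e"
          using \<open>c \<longlonglongrightarrow> b\<close> by (simp add: tendsto_iff)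
        then show "\<forall>\<^sub>F n in sequentially. \<forall>\<tau>\<in>AVT \<alpha>. dist (critical_state \<tau> (c n)) (critical_state \<tau> b) < e"
        proof eventually_elim
          case (elim n)
          show ?case
          proof
            fix \<tau>
            assume \<tau>: "\<tau> \<in> AVT \<alpha>"
            have "critical_state \<tau> (c n) - critical_state \<tau> b = critical_state \<tau> (c n - b)"
              using cbounded_linearD(5)[OF states_cbounded_linear[OF critical_state_state[OF \<tau>]]] by simp
            then show "dist (critical_state \<tau> (c n)) (critical_state \<tau> b) < e"
              using critical_state_linear(3)[OF \<tau>, of "c n - b"] elim by (simp add: dist_norm)
          qed
        qed
      qed
    qed (use c in auto)
  qed
  show "continuous_on (AVT \<alpha>) (\<lambda>\<tau>. critical_state \<tau> (elem \<mu> a \<nu>))" for \<mu> a \<nu>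
  proof (rule continuous_on_eq)
    show "continuous_on (AVT \<alpha>) (\<lambda>\<tau>. if \<mu> = \<nu> then \<tau> a / of_nat (CARD('n) ^ length \<mu>) else 0)"
      by (cases "\<mu> = \<nu>")
        (auto intro!: continuous_intros continuous_on_subset[OF continuous_on_product_coordinates])
  qed (simp add: critical_state_elem)
  show "continuous_on (AVT \<alpha>) (\<lambda>\<tau>. critical_state \<tau> (x + y))"
    if "continuous_on (AVT \<alpha>) (\<lambda>\<tau>. critical_state \<tau> x)" "continuous_on (AVT \<alpha>) (\<lambda>\<tau>. critical_state \<tau> y)" for x y
    using continuous_on_add[OF that] by (rule continuous_on_eq) (simp add: critical_state_linear)
  show "continuous_on (AVT \<alpha>) (\<lambda>\<tau>. critical_state \<tau> (c *\<^sub>C x))"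
    if "continuous_on (AVT \<alpha>) (\<lambda>\<tau>. critical_state \<tau> x)" for c x
    using continuous_on_mult[OF continuous_on_const[of _ c] that] by (rule continuous_on_eq) (simp add: critical_state_linear)
qed

end


section \<open>The Cuntz-Pimsner quotient\<close>

lemma closed_ideal_closed_ideal_generated: "closed_ideal (closed_ideal_generated G)"
  unfolding closed_ideal_generated_def closed_ideal_def by auto

lemma closed_ideal_generated_base: "G \<subseteq> closed_ideal_generated G"
  unfolding closed_ideal_generated_def by auto

lemma closed_ideal_generated_minimal: "closed_ideal I \<Longrightarrow> G \<subseteq> I \<Longrightarrow> closed_ideal_generated G \<subseteq> I"
  unfolding closed_ideal_generated_def by auto

context covariant_rep
begin

text \<open>The elements \<open>x\<close> with \<open>\<psi> (y * x * z) = 0\<close> for all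
  \<open>y\<close> and \<open>z\<close> form a closed ideal. For a generator \<open>g\<close>,
  Cauchy-Schwarz gives \<open>\<psi> (w * g) = 0\<close>, and the KMS relation carries
  \<open>z\<close> to the front, reducing to that case.\<close>

lemma state_vanishes_on_closed_ideal:
  assumes \<psi>: "\<psi> \<in> states" "gauge_invariant_values \<psi> \<beta>"
    and G: "\<And>g. g \<in> G \<Longrightarrow> \<psi> (star g * g) = 0" and x: "x \<in> closed_ideal_generated G"
  shows "\<psi> x = 0"
proof -
  note cb = states_cbounded_linear[OF \<psi>(1)]
  let ?N = "{x. \<forall>y z. \<psi> (y * x * z) = 0}"
  have "closed_ideal ?N"
    unfolding closed_ideal_def
  proof (intro conjI ballI allI)
    have "closed {x. \<psi> (y * x * z) = 0}" for y z
      by (intro closed_Collect_eq continuous_on_compose2[OF cbounded_linearD(8)[OF cb]] continuous_intros) auto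
    moreover have "?N = (\<Inter>y. \<Inter>z. {x. \<psi> (y * x * z) = 0})"
      by auto
    ultimately show "closed ?N"
      by auto
    fix x a
    assume "x \<in> ?N"
    then have x: "\<psi> (y * x * z) = 0" for y z
      by simp
    show "a * x \<in> ?N" "x * a \<in> ?N"
      using x[of "_ * a"] x[of _ "a * _"] by (simp_all add: mult.assoc)
  qed (auto simp: distrib_left distrib_right cbounded_linearD[OF cb])
  moreover have "G \<subseteq> ?N"
  proof safe
    fix g y z
    assume g: "g \<in> G"
    have left: "\<psi> (w * g) = 0" for w
      using positive_functional_Cauchy_Schwarz[OF states_positive_functional[OF \<psi>(1)], of "star w" g] G[OF g]
      by simp
    have "\<psi> (y * g * elem \<mu> a \<nu>) = 0" for \<mu> a \<nu>
      using scaled_trace_elem[OF \<psi>, of \<mu> \<nu> a] left[of "elem \<mu> a \<nu> * y"]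
      by (simp add: scaled_trace_def mult.assoc)
    then have "(\<lambda>z. \<psi> (y * g * z)) = (\<lambda>z. 0 *\<^sub>C \<psi> z)"
      by (intro elem_eqI cbounded_linear_compose[OF cb] cbounded_linear_mult_left cbounded_linear_cscale cb) simp
    then show "\<psi> (y * g * z) = 0"
      by (metis cscale_zero_left)
  qed
  ultimately have "x \<in> ?N"
    using closed_ideal_generated_minimal x by blast
  then have "\<psi> (1 * x * 1) = 0"
    by blast
  then show ?thesis
    by simp
qed

end

locale cp_quotient = classical_toeplitz \<sigma> \<iota> V
  for \<sigma> :: "'n::finite \<Rightarrow> 'x::topological_space \<Rightarrow> 'x" and \<iota> :: "('x \<Rightarrow>\<^sub>C complex) \<Rightarrow> 'b::cstar_algebra" and V +
  fixes q :: "'b \<Rightarrow> 'o::cstar_algebra"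
  assumes quotient: "cuntz_pimsner_quotient (classical_system \<sigma>) \<iota> V q"
begin

definition I :: "'b set" where
  "I = closed_ideal_generated {\<iota> a * defect | a. a \<in> J_ideal \<alpha>}"

lemma closed_ideal_I: "closed_ideal I"
  unfolding I_def by (rule closed_ideal_closed_ideal_generated)

lemma generator_in_I: "a \<in> J_ideal \<alpha> \<Longrightarrow> \<iota> a * defect \<in> I"
  unfolding I_def by (rule subsetD[OF closed_ideal_generated_base]) blast

lemma
  q_hom: "star_hom q" and q_surj: "surj q" and norm_q: "norm (q x) = infdist x I"
proof -
  have "is_quotient_map I q"
    using quotient by (simp only: cuntz_pimsner_quotient_def I_def defect_def)
  then show "star_hom q" "surj q" "norm (q x) = infdist x I"
    unfolding is_quotient_map_def by blast+
qed

lemmas q = star_homD[OF q_hom] cbounded_linearD[OF star_homD(1)[OF q_hom]]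

lemma q_eq_0_iff: "q x = 0 \<longleftrightarrow> x \<in> I"
proof -
  have "closed I" "I \<noteq> {}"
    using closed_ideal_I by (auto simp: closed_ideal_def)
  then show ?thesis
    using in_closed_iff_infdist_zero[of I x] norm_q[of x] by (metis norm_eq_zero)
qed

text \<open>The representative depends on the class only and not on \<open>f\<close>, which makes
  continuity in a parameter of \<open>f\<close> immediate.\<close>

definition descend :: "('b \<Rightarrow> 'c) \<Rightarrow> 'o \<Rightarrow> 'c" where
  "descend f y = f (SOME x. q x = y)"

text \<open>Since \<open>f x = f (x - i)\<close> for \<open>i\<close> in the ideal,
  \<open>norm (f x)\<close> is at most \<open>K * dist x i\<close>; the infimum over
  \<open>i\<close> is the quotient norm times \<open>K\<close>.\<close>

lemma
  fixes f :: "'b \<Rightarrow> 'c::cstar_algebra"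
  assumes f: "cbounded_linear f" and zero: "\<And>x. x \<in> I \<Longrightarrow> f x = 0"
  shows descend: "descend f (q x) = f x"
    and norm_descend_le: "(\<And>x. norm (f x) \<le> norm x * K) \<Longrightarrow> K > 0 \<Longrightarrow> norm (descend f y) \<le> norm y * K"
    and cbounded_linear_descend: "cbounded_linear (descend f)"
proof -
  note lin = cbounded_linearD[OF f]
  show d: "descend f (q x) = f x" for x
  proof -
    let ?x = "SOME x'. q x' = q x"
    have "q ?x = q x"
      by (rule someI) simp
    then have "?x - x \<in> I"
      by (simp add: q flip: q_eq_0_iff)
    then show ?thesis
      using zero[of "?x - x"] by (simp add: descend_def lin)
  qed
  show norm: "norm (descend f y) \<le> norm y * K" if K: "\<And>x. norm (f x) \<le> norm x * K" "K > 0" for K y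
  proof -
    obtain x where y: "y = q x"
      using q_surj by blast
    have "norm (f x) / K \<le> dist x i" if "i \<in> I" for i
      using K(1)[of "x - i"] zero[OF that] \<open>K > 0\<close> by (simp add: lin dist_norm field_simps)
    moreover have "I \<noteq> {}"
      using closed_ideal_I by (auto simp: closed_ideal_def)
    ultimately have "norm (f x) / K \<le> infdist x I"
      by (auto simp: infdist_def intro!: cINF_greatest)
    then show ?thesis
      using K(2) by (simp add: y d norm_q field_simps)
  qed
  obtain K where K: "K > 0" "\<And>x. norm (f x) \<le> norm x * K"
    using bounded_linear.pos_bounded[OF lin(1)] by blast
  have add: "descend f (y + z) = descend f y + descend f z" for y z
  proof -
    obtain x x' where "y = q x" "z = q x'"
      using q_surj by blast
    then show ?thesis
      using d[of "x + x'"] by (simp add: q d lin)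
  qed
  have scale: "descend f (c *\<^sub>C y) = c *\<^sub>C descend f y" for c y
  proof -
    obtain x where "y = q x"
      using q_surj by blast
    then show ?thesis
      using d[of "c *\<^sub>C x"] by (simp add: q d lin)
  qed
  show "cbounded_linear (descend f)"
    using bounded_linear_of_complex_linear[OF add scale, of K] norm[OF K(2,1)]
    by (simp add: cbounded_linear_def scale mult.commute)
qed

text \<open>The defect is gauge invariant, so the generators are fixed, and the preimage of
  \<open>I\<close> is a closed ideal containing them.\<close>

lemma gauge_action_I:
  assumes z: "cmod z = 1" and x: "x \<in> I"
  shows "gauge_action \<iota> V z x \<in> I"
proof -
  note ga = gauge_action[OF z]
  note g = star_homD[OF ga(1)] cbounded_linearD[OF star_homD(1)[OF ga(1)]]
  let ?N = "{x. gauge_action \<iota> V z x \<in> I}"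
  have "closed ?N"
    using closed_vimage[of I "gauge_action \<iota> V z"] closed_ideal_I g(12)[of UNIV]
    by (simp add: closed_ideal_def vimage_def)
  then have "closed_ideal ?N"
    using closed_ideal_I by (auto simp: closed_ideal_def g)
  moreover have "{\<iota> a * defect | a. a \<in> J_ideal \<alpha>} \<subseteq> ?N"
  proof -
    have "cnj z *\<^sub>C (z *\<^sub>C x) = x" for x :: 'b
      using z by (simp add: cscale_cscale mult.commute[of "cnj z"] flip: complex_norm_square)
    then have "gauge_action \<iota> V z defect = defect"
      by (simp add: defect_def g ga star_cscale cscale_mult_left cscale_mult_right)
    then show ?thesis
      using generator_in_I by (auto simp: g ga)
  qed
  ultimately show ?thesis
    using closed_ideal_generated_minimal[of ?N "{\<iota> a * defect | a. a \<in> J_ideal \<alpha>}"] x unfolding I_def by blast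
qed

lemma q_case_sum: "q \<circ> case_sum \<iota> V = case_sum (q \<circ> \<iota>) (q \<circ> V)"
  by (auto simp: fun_eq_iff split: sum.splits)

sublocale cp: covariant_rep \<alpha> "q \<circ> \<iota>" "q \<circ> V"
proof
  fix a b c i j
  show "star ((q \<circ> V) i) * (q \<circ> V) j = (if i = j then 1 else 0)"
    using isometry[of i j] by (auto simp flip: q(3,4) simp: q(2,7))
  show "(q \<circ> \<iota>) a * (q \<circ> V) i = (q \<circ> V) i * (q \<circ> \<iota>) (\<alpha> i a)"
    using covariance[of a i] by (simp flip: q(3))
  have "q ` closure (range (eval_poly (case_sum \<iota> V))) \<subseteq> closure (q ` range (eval_poly (case_sum \<iota> V)))"
    by (rule image_closure_subset[OF q(12)]) (auto simp: closure_subset)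
  also have "q ` range (eval_poly (case_sum \<iota> V)) = range (eval_poly (case_sum (q \<circ> \<iota>) (q \<circ> V)))"
    by (simp add: image_image star_hom_eval_poly[OF q_hom] q_case_sum)
  finally show "closure (range (eval_poly (case_sum (q \<circ> \<iota>) (q \<circ> V)))) = UNIV"
    using q_surj by (auto simp: dense)
qed (auto simp: \<iota>_add \<iota>_scale \<iota>_mult \<iota>_star q)

text \<open>The gauge map of the Toeplitz algebra followed by \<open>q\<close> kills
  \<open>I\<close>, hence descends; multiplicativity is checked on representatives.\<close>

sublocale cp: classical_rep \<sigma> "q \<circ> \<iota>" "q \<circ> V"
proof
  fix z :: complex
  assume z: "cmod z = 1"
  note ga = gauge_action[OF z]
  note g = star_homD[OF ga(1)]
  define f where "f = (\<lambda>x. q (gauge_action \<iota> V z x))"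
  have f: "cbounded_linear f"
    unfolding f_def by (rule cbounded_linear_compose[OF q(1) g(1)])
  have zero: "f x = 0" if "x \<in> I" for x
    using gauge_action_I[OF z that] by (simp add: f_def q_eq_0_iff)
  note d = descend[OF f zero]
  have "norm (q x) \<le> norm x" for x
    using infdist_le[of 0 I x] closed_ideal_I by (simp add: norm_q closed_ideal_def)
  then have "norm (f x) \<le> norm x * 1" for x
    using order_trans[OF _ ga(4)] by (simp add: f_def)
  then have norm: "norm (descend f y) \<le> norm y" for y
    using norm_descend_le[OF f zero, of 1 y] by simp
  have "star_hom (descend f)"
    unfolding star_hom_def
  proof (intro conjI allI)
    show "bounded_linear (descend f)"
      by (rule cbounded_linearD(1)[OF cbounded_linear_descend[OF f zero]])
    show "descend f 1 = 1"
      using d[of 1] by (simp add: q f_def g)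
    fix c x y
    show "descend f (c *\<^sub>C x) = c *\<^sub>C descend f x"
      by (rule cbounded_linearD(6)[OF cbounded_linear_descend[OF f zero]])
    obtain x' y' where xy: "x = q x'" "y = q y'"
      using q_surj by blast
    show "descend f (x * y) = descend f x * descend f y"
      by (simp only: xy d q(3)[symmetric]) (simp add: q f_def g)
    show "descend f (star x) = star (descend f x)"
      by (simp only: xy d q(4)[symmetric]) (simp add: q f_def g)
  qed
  moreover have "descend f ((q \<circ> \<iota>) a) = (q \<circ> \<iota>) a" "descend f ((q \<circ> V) i) = z *\<^sub>C (q \<circ> V) i" for a i
    by (simp_all add: d) (simp_all add: f_def ga q)
  ultimately show "\<exists>g. star_hom g \<and> (\<forall>a. g ((q \<circ> \<iota>) a) = (q \<circ> \<iota>) a) \<and>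
      (\<forall>i. g ((q \<circ> V) i) = z *\<^sub>C (q \<circ> V) i) \<and> (\<forall>x. norm (g x) \<le> norm x)"
    using norm by blast
qed

lemma word_prod_q: "word_prod (q \<circ> V) w = q (word_prod V w)"
  by (induction w) (simp_all add: word_prod_def q)

lemma cp_elem: "cp.elem \<mu> a \<nu> = q (elem \<mu> a \<nu>)"
  by (simp add: cp.elem_def elem_def word_prod_q q)

lemma cp_defect: "cp.defect = q defect"
  by (simp add: cp.defect_def defect_def q)

text \<open>\<open>J_ideal\<close> contains \<open>star a * a\<close> along with \<open>a\<close>,
  and \<open>star_\<iota>_defect\<close> brings \<open>star g * g\<close> into the form on which
  \<psi> vanishes by assumption.\<close>

lemma state_zero_on_I:
  assumes "\<psi> \<in> states" "gauge_invariant_values \<psi> \<beta>" "x \<in> I"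
    and zero: "\<And>a. a \<in> J_ideal \<alpha> \<Longrightarrow> \<psi> (\<iota> a * defect) = 0"
  shows "\<psi> x = 0"
proof (rule state_vanishes_on_closed_ideal[OF assms(1,2) _ assms(3)[unfolded I_def]])
  fix g
  assume "g \<in> {\<iota> a * defect | a. a \<in> J_ideal \<alpha>}"
  then obtain a where g: "g = \<iota> a * defect" and a: "a \<in> J_ideal \<alpha>"
    by blast
  have "star a * a \<in> J_ideal \<alpha>"
    using a by (auto simp: J_ideal_def mult.assoc)
  then show "\<psi> (star g * g) = 0"
    unfolding g star_\<iota>_defect by (rule zero)
qed

lemma
  assumes \<psi>: "\<psi> \<in> states" "gauge_invariant_values \<psi> \<beta>"
    and zero: "\<And>a. a \<in> J_ideal \<alpha> \<Longrightarrow> \<psi> (\<iota> a * defect) = 0"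
  shows descend_state: "descend \<psi> \<in> states"
    and descend_values: "cp.gauge_invariant_values (descend \<psi>) \<beta>"
    and descend_\<iota>: "descend \<psi> ((q \<circ> \<iota>) a) = \<psi> (\<iota> a)"
proof -
  note I0 = state_zero_on_I[OF \<psi> _ zero]
  note d = descend[OF states_cbounded_linear[OF \<psi>(1)] I0]
  show "descend \<psi> \<in> states"
    unfolding states_iff
  proof (intro conjI allI)
    show "cbounded_linear (descend \<psi>)"
      by (rule cbounded_linear_descend[OF states_cbounded_linear[OF \<psi>(1)] I0])
    fix y
    obtain x where "y = q x"
      using q_surj by blast
    then have "descend \<psi> (star y * y) = \<psi> (star x * x)"
      using d[of "star x * x"] by (simp add: q)
    then show "descend \<psi> (star y * y) \<in> \<real>\<^sub>\<ge>\<^sub>0"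
      using \<psi>(1) by (simp add: states_iff)
    show "descend \<psi> 1 = 1"
      using d[of 1] states_one[OF \<psi>(1)] by (simp add: q)
  qed
  show "cp.gauge_invariant_values (descend \<psi>) \<beta>"
    using \<psi>(2) by (simp add: cp.gauge_invariant_values_def gauge_invariant_values_def cp_elem d)
  show "descend \<psi> ((q \<circ> \<iota>) a) = \<psi> (\<iota> a)"
    by (simp add: d)
qed

text \<open>Compressing \<open>subcritical_state\<close> returns \<tau>, so its values on the
  generators \<open>\<iota> a * defect\<close> are multiples of \<open>\<tau> a\<close>. Vanishing
  on \<open>J_ideal\<close> is therefore the condition for descent.\<close>

lemma quotient_parametrization:
  fixes \<beta> :: real
  assumes subcritical: "ln (real CARD('n)) < \<beta>"
  defines "S \<equiv> {\<tau> \<in> states. \<forall>a\<in>J_ideal \<alpha>. \<tau> a = 0}"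
  shows "affine_weak_star_homeomorphism S (kms_states (gauge_flow (q \<circ> \<iota>) (q \<circ> V)) \<beta>)
      (kms_of_state \<alpha> (q \<circ> \<iota>) (q \<circ> V) \<beta>)"
    and "\<tau> \<in> S \<Longrightarrow> kms_of_state \<alpha> (q \<circ> \<iota>) (q \<circ> V) \<beta> \<tau> (cp.elem \<mu> a \<nu>) = kms_value \<beta> \<tau> \<mu> \<nu> a"
proof -
  let ?\<psi> = "subcritical_state \<beta>"
  have st: "\<tau> \<in> states" if "\<tau> \<in> S" for \<tau>
    using that by (simp add: S_def)
  have zero: "?\<psi> \<tau> (\<iota> a * defect) = 0" if "\<tau> \<in> S" "a \<in> J_ideal \<alpha>" for \<tau> a
  proof -
    have "defect_state \<beta> (?\<psi> \<tau>) a = \<tau> a"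
      by (rule fun_cong[OF defect_state_eq[OF subcritical subcritical_state_state[OF subcritical st]
            gauge_invariant_subcritical_state[OF subcritical st] subcritical_sums[OF subcritical st]
            subcritical_state_def[OF subcritical]]]) (rule that)+
    then show ?thesis
      using that ratio_neq_1[OF subcritical] by (simp add: S_def defect_state_def)
  qed
  have desc: "descend (?\<psi> \<tau>) \<in> states" "cp.gauge_invariant_values (descend (?\<psi> \<tau>)) \<beta>"
      "descend (?\<psi> \<tau>) ((q \<circ> \<iota>) a) = ?\<psi> \<tau> (\<iota> a)" if \<tau>: "\<tau> \<in> S" for \<tau> a
  proof -
    note * = subcritical_state_state[OF subcritical st[OF \<tau>]]
      gauge_invariant_subcritical_state[OF subcritical st[OF \<tau>]] zero[OF \<tau>]
    show "descend (?\<psi> \<tau>) \<in> states" "cp.gauge_invariant_values (descend (?\<psi> \<tau>)) \<beta>"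
      "descend (?\<psi> \<tau>) ((q \<circ> \<iota>) a) = ?\<psi> \<tau> (\<iota> a)"
      by (rule descend_state[OF *] descend_values[OF *] descend_\<iota>[OF *]; assumption)+
  qed
  have 1: "(\<lambda>a. of_real t * \<tau> a + of_real (1 - t) * \<omega> a) \<in> S"
    if "\<tau> \<in> S" "\<omega> \<in> S" "t \<in> {0..1}" for \<tau> \<omega> t
    using that states_convex[of \<tau> \<omega> t] by (simp add: S_def)
  \<comment> \<open>Conversely \<open>q\<close> kills \<open>\<iota> a * defect\<close> for
    \<open>a\<close> in \<open>J_ideal\<close>, so the recovered parameter vanishes there.\<close>
  have 2: "cp.defect_state \<beta> \<omega> \<in> S" if "\<omega> \<in> states" "cp.gauge_invariant_values \<omega> \<beta>" for \<omega>
  proof -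
    have "cp.defect_state \<beta> \<omega> a = 0" if "a \<in> J_ideal \<alpha>" for a
    proof -
      have "(q \<circ> \<iota>) a * cp.defect = q (\<iota> a * defect)"
        by (simp add: cp_defect q)
      also have "\<dots> = 0"
        using generator_in_I[OF that] by (simp add: q_eq_0_iff)
      finally show ?thesis
        using cbounded_linearD(3)[OF states_cbounded_linear[OF \<open>\<omega> \<in> states\<close>]] by (simp add: cp.defect_state_def)
    qed
    then show ?thesis
      using cp.defect_state_state[OF subcritical that] by (simp add: S_def)
  qed
  \<comment> \<open>After unfolding, this is evaluation at a fixed representative.\<close>
  have 3: "continuous_on S (\<lambda>\<tau>. descend (?\<psi> \<tau>) y)" for y
    unfolding descend_def by (rule continuous_subcritical_state[OF subcritical])
  have 4: "descend (?\<psi> \<tau>) ((q \<circ> \<iota>) a) = of_real (1 - exp (- \<beta>) * real CARD('n)) * \<tau> (expectation \<beta> (\<iota> a))"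
    if "\<tau> \<in> S" for \<tau> a
    unfolding desc(3)[OF that] by (rule subcritical_state_def[OF subcritical])
  have sub: "S \<subseteq> states"
    by (auto simp: S_def)
  note P = cp.subcritical_parametrization[OF subcritical sub 1 2, where \<Psi> = "\<lambda>\<tau>. descend (?\<psi> \<tau>)" and
      s = "\<lambda>\<tau> a. \<tau> (expectation \<beta> (\<iota> a))"]
  show "affine_weak_star_homeomorphism S (kms_states (gauge_flow (q \<circ> \<iota>) (q \<circ> V)) \<beta>)
      (kms_of_state \<alpha> (q \<circ> \<iota>) (q \<circ> V) \<beta>)"
    by (rule P(1); (assumption | rule desc(1,2) 3 4 subcritical_sums[OF subcritical st])+)
  show "\<tau> \<in> S \<Longrightarrow> kms_of_state \<alpha> (q \<circ> \<iota>) (q \<circ> V) \<beta> \<tau> (cp.elem \<mu> a \<nu>) = kms_value \<beta> \<tau> \<mu> \<nu> a"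
    by (rule P(2); (assumption | rule desc(1,2) 3 4 subcritical_sums[OF subcritical st])+)
qed

text \<open>Injectivity makes \<open>J_ideal\<close> everything, so every
  \<open>\<iota> a * defect\<close> has to be killed; the averaging condition ensures this.\<close>

lemma critical_quotient_parametrization:
  assumes pos: "ln (real CARD('n)) > 0" and inj: "injective_system \<alpha>"
  shows "affine_weak_star_homeomorphism (AVT \<alpha>) (kms_states (gauge_flow (q \<circ> \<iota>) (q \<circ> V)) (ln (real CARD('n))))
      (critical_kms_of_state \<alpha> (q \<circ> \<iota>) (q \<circ> V))"
    and "\<tau> \<in> AVT \<alpha> \<Longrightarrow> critical_kms_of_state \<alpha> (q \<circ> \<iota>) (q \<circ> V) \<tau> (cp.elem \<mu> a \<nu>) =
      (if \<mu> = \<nu> then of_real (exp (- (real (length \<mu>) * ln (real CARD('n))))) * \<tau> a else 0)"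
proof -
  have J: "J_ideal \<alpha> = UNIV"
    using inj by (simp add: J_ideal_def injective_system_def)
  \<comment> \<open>With \<open>a = 1\<close> the defect itself is a generator of the ideal.\<close>
  have "q (\<iota> 1 * defect) = 0"
    using generator_in_I[of 1] by (simp add: J q_eq_0_iff)
  then have defect: "cp.defect = 0"
    by (simp add: cp_defect)
  \<comment> \<open>In \<open>values_defect\<close> the weight \<open>1 / CARD('n)\<close> cancels
    the factor \<open>CARD('n)\<close> from \<open>\<tau> (transfer a)\<close>.\<close>
  have zero: "critical_state \<tau> (\<iota> a * defect) = 0" if \<tau>: "\<tau> \<in> AVT \<alpha>" for \<tau> a
  proof -
    have "exp (- ln (real CARD('n))) = 1 / real CARD('n)"
      by (simp add: exp_minus divide_inverse)
    then show ?thesis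
      using AVT_transfer_pow[OF \<tau>, of 1 a]
      by (simp add: values_defect[OF critical_state_state[OF \<tau>] gauge_invariant_critical_state[OF \<tau>]]
          critical_state_\<iota>[OF \<tau>])
  qed
  have desc: "descend (critical_state \<tau>) \<in> states"
      "cp.gauge_invariant_values (descend (critical_state \<tau>)) (ln (real CARD('n)))"
      "descend (critical_state \<tau>) ((q \<circ> \<iota>) a) = critical_state \<tau> (\<iota> a)" if \<tau>: "\<tau> \<in> AVT \<alpha>" for \<tau> a
  proof -
    note * = critical_state_state[OF \<tau>] gauge_invariant_critical_state[OF \<tau>] zero[OF \<tau>]
    show "descend (critical_state \<tau>) \<in> states"
      "cp.gauge_invariant_values (descend (critical_state \<tau>)) (ln (real CARD('n)))"
      "descend (critical_state \<tau>) ((q \<circ> \<iota>) a) = critical_state \<tau> (\<iota> a)"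
      by (rule descend_state[OF *] descend_values[OF *] descend_\<iota>[OF *]; assumption)+
  qed
  have 3: "continuous_on (AVT \<alpha>) (\<lambda>\<tau>. descend (critical_state \<tau>) y)" for y
    unfolding descend_def by (rule continuous_critical_state)
  have 4: "descend (critical_state \<tau>) ((q \<circ> \<iota>) a) = \<tau> a" if "\<tau> \<in> AVT \<alpha>" for \<tau> a
    unfolding desc(3)[OF that] by (rule critical_state_\<iota>[OF that])
  note P = cp.critical_parametrization[OF pos defect, where \<Psi> = "\<lambda>\<tau>. descend (critical_state \<tau>)"]
  show "affine_weak_star_homeomorphism (AVT \<alpha>) (kms_states (gauge_flow (q \<circ> \<iota>) (q \<circ> V)) (ln (real CARD('n))))
      (critical_kms_of_state \<alpha> (q \<circ> \<iota>) (q \<circ> V))"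
    by (rule P(1); (assumption | rule desc(1,2) 3 4)+)
  show "\<tau> \<in> AVT \<alpha> \<Longrightarrow> critical_kms_of_state \<alpha> (q \<circ> \<iota>) (q \<circ> V) \<tau> (cp.elem \<mu> a \<nu>) =
      (if \<mu> = \<nu> then of_real (exp (- (real (length \<mu>) * ln (real CARD('n))))) * \<tau> a else 0)"
    by (rule P(2); (assumption | rule desc(1,2) 3 4)+)
qed

end


section \<open>Piecewise conjugacy\<close>

lemma homeomorphism_UNIV:
  assumes "homeomorphism UNIV UNIV \<phi> \<phi>'"
  shows "continuous_on UNIV \<phi>" "continuous_on UNIV \<phi>'" "\<phi>' (\<phi> x) = x" "\<phi> (\<phi>' y) = y"
  using assms by (auto simp: homeomorphism_def)

text \<open>The permutation may change from point to point, so a single \<open>\<rho> i\<close> need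
  not be conjugate to any one \<open>\<sigma> j\<close>; what transfers are expressions symmetric in
  the indices.\<close>

locale piecewise_conjugacy = A: classical \<sigma> + C: classical \<rho>
  for \<sigma> :: "'n::finite \<Rightarrow> 'x::topological_space \<Rightarrow> 'x" and \<rho> :: "'n \<Rightarrow> 'y::topological_space \<Rightarrow> 'y" +
  fixes \<phi> \<phi>'
  assumes homeomorphism: "homeomorphism UNIV UNIV \<phi> \<phi>'"
    and conj: "\<exists>\<pi>. bij \<pi> \<and> (\<forall>i. \<rho> i (\<phi> x) = \<phi> (\<sigma> (\<pi> i) x))"
begin

lemmas \<phi> = homeomorphism_UNIV[OF homeomorphism]

text \<open>The permutation at \<open>y\<close> is the inverse of the one at
  \<open>\<phi>' y\<close>. By this symmetry each inclusion between parameter sets yields the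
  opposite one.\<close>

lemma inverse_conjugacy: "piecewise_conjugacy \<rho> \<sigma> \<phi>' \<phi>"
proof unfold_locales
  show "homeomorphism UNIV UNIV \<phi>' \<phi>"
    using homeomorphism by (rule homeomorphism_symD)
  fix y
  obtain \<pi> where \<pi>: "bij \<pi>" "\<And>i. \<rho> i (\<phi> (\<phi>' y)) = \<phi> (\<sigma> (\<pi> i) (\<phi>' y))"
    using conj by blast
  have "\<sigma> i (\<phi>' y) = \<phi>' (\<rho> (inv \<pi> i) y)" for i
    using \<pi>(2)[of "inv \<pi> i"] \<pi>(1) by (simp add: \<phi> bij_is_surj surj_f_inv_f)
  then show "\<exists>\<pi>. bij \<pi> \<and> (\<forall>i. \<sigma> i (\<phi>' y) = \<phi>' (\<rho> (\<pi> i) y))"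
    using \<pi>(1) bij_imp_bij_inv by blast
qed

lemma apply_comp: "apply_bcontfun (comp_op \<phi> c) x = apply_bcontfun c (\<phi> x)"
  by (rule apply_comp_op[OF \<phi>(1)])

lemma comp_op_inverse: "comp_op \<phi> (comp_op \<phi>' a) = a"
  by (rule bcontfun_eqI) (simp add: apply_comp apply_comp_op[OF \<phi>(2)] \<phi>)

text \<open>At each point the two sums have the same terms in a different order.\<close>

lemma comp_op_transfer: "comp_op \<phi> (C.transfer c) = A.transfer (comp_op \<phi> c)"
proof (rule bcontfun_eqI)
  fix x
  obtain \<pi> where \<pi>: "bij \<pi>" "\<And>i. \<rho> i (\<phi> x) = \<phi> (\<sigma> (\<pi> i) x)"
    using conj by blast
  have "(\<Sum>i\<in>UNIV. apply_bcontfun c (\<phi> (\<sigma> (\<pi> i) x))) = (\<Sum>i\<in>UNIV. apply_bcontfun c (\<phi> (\<sigma> i x)))"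
    by (rule sum.reindex_bij_betw[OF \<pi>(1)])
  then show "apply_bcontfun (comp_op \<phi> (C.transfer c)) x = apply_bcontfun (A.transfer (comp_op \<phi> c)) x"
    by (simp add: apply_comp A.transfer_def C.transfer_def apply_bcontfun_sum A.apply_\<alpha> C.apply_\<alpha> \<pi>(2))
qed

lemma comp_op_transfer_pow: "comp_op \<phi> ((C.transfer ^^ m) c) = (A.transfer ^^ m) (comp_op \<phi> c)"
  by (induction m) (simp_all add: comp_op_transfer)

lemma kms_value_comp_op: "C.kms_value \<beta> (\<tau> \<circ> comp_op \<phi>) \<mu> \<nu> c = A.kms_value \<beta> \<tau> \<mu> \<nu> (comp_op \<phi> c)"
  by (simp add: A.kms_value_def C.kms_value_def comp_op_transfer_pow)

lemma states_comp_op: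
  assumes "\<tau> \<in> states"
  shows "\<tau> \<circ> comp_op \<phi> \<in> states"
proof -
  note \<phi>hom = star_homD[OF star_hom_comp_op[OF \<phi>(1)]]
  have "cbounded_linear (\<tau> \<circ> comp_op \<phi>)"
    unfolding comp_def by (rule cbounded_linear_compose[OF states_cbounded_linear[OF assms] \<phi>hom(1)])
  then show ?thesis
    using assms by (simp add: states_iff \<phi>hom)
qed

lemma AVT_comp_op:
  assumes \<tau>: "\<tau> \<in> AVT (classical_system \<sigma>)"
  shows "\<tau> \<circ> comp_op \<phi> \<in> AVT (classical_system \<rho>)"
proof -
  have st: "\<tau> \<in> states" and avg: "\<tau> a = (1 / of_nat CARD('n)) * (\<Sum>i\<in>UNIV. \<tau> (classical_system \<sigma> i a))" for a
    using \<tau> unfolding AVT_def by blast+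
  note lin = cbounded_linearD(7)[OF states_cbounded_linear[OF st]]
  note lin' = cbounded_linearD(7)[OF star_homD(1)[OF star_hom_comp_op[OF \<phi>(1)]]]
  have "(\<tau> \<circ> comp_op \<phi>) c = (1 / of_nat CARD('n)) * (\<Sum>i\<in>UNIV. (\<tau> \<circ> comp_op \<phi>) (classical_system \<rho> i c))" for c
  proof -
    have "(\<Sum>i\<in>UNIV. (\<tau> \<circ> comp_op \<phi>) (classical_system \<rho> i c)) = \<tau> (comp_op \<phi> (C.transfer c))"
      by (simp add: C.transfer_def lin lin')
    also have "\<dots> = (\<Sum>i\<in>UNIV. \<tau> (classical_system \<sigma> i (comp_op \<phi> c)))"
      by (simp add: comp_op_transfer A.transfer_def lin)
    finally show ?thesis
      using avg[of "comp_op \<phi> c"] by (simp only: comp_def)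
  qed
  then show ?thesis
    unfolding AVT_def using states_comp_op[OF st] by blast
qed

text \<open>An element of the common kernel for \<sigma> vanishes at all points
  \<open>\<sigma> i x\<close>; pulled back by \<open>\<phi>'\<close> it vanishes at all
  \<open>\<rho> i y\<close>. So \<open>c\<close> annihilates the pullback, and applying
  \<open>comp_op \<phi>\<close> returns to the original element.\<close>

lemma comp_op_J_ideal:
  assumes "c \<in> J_ideal (classical_system \<rho>)"
  shows "comp_op \<phi> c \<in> J_ideal (classical_system \<sigma>)"
  unfolding J_ideal_def
proof safe
  fix b
  assume b: "b \<in> (\<Inter>i. {b. classical_system \<sigma> i b = 0})"
  interpret inverse: piecewise_conjugacy \<rho> \<sigma> \<phi>' \<phi>
    by (rule inverse_conjugacy)
  have b0: "apply_bcontfun b (\<sigma> i x) = 0" for i x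
    using b A.apply_\<alpha>[of i b x] by auto
  have "classical_system \<rho> i (comp_op \<phi>' b) = 0" for i
  proof (rule bcontfun_eqI)
    fix y
    obtain \<pi> where "\<And>i. \<rho> i (\<phi> (\<phi>' y)) = \<phi> (\<sigma> (\<pi> i) (\<phi>' y))"
      using conj by blast
    then show "apply_bcontfun (classical_system \<rho> i (comp_op \<phi>' b)) y = apply_bcontfun 0 y"
      by (simp add: C.apply_\<alpha> inverse.apply_comp \<phi> b0)
  qed
  then have "c * comp_op \<phi>' b = 0"
    using assms by (auto simp: J_ideal_def)
  then have "comp_op \<phi> (c * comp_op \<phi>' b) = 0"
    by (simp add: cbounded_linearD(3)[OF star_homD(1)[OF star_hom_comp_op[OF \<phi>(1)]]])
  then show "comp_op \<phi> c * b = 0"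
    by (simp add: star_homD(3)[OF star_hom_comp_op[OF \<phi>(1)]] comp_op_inverse)
qed

lemma pullback_homeomorphism:
  assumes "\<And>\<tau>. \<tau> \<in> S \<Longrightarrow> \<tau> \<circ> comp_op \<phi> \<in> S'" "\<And>\<omega>. \<omega> \<in> S' \<Longrightarrow> \<omega> \<circ> comp_op \<phi>' \<in> S"
  shows "affine_weak_star_homeomorphism S S' (\<lambda>\<tau>. \<tau> \<circ> comp_op \<phi>)"
proof -
  interpret inverse: piecewise_conjugacy \<rho> \<sigma> \<phi>' \<phi>
    by (rule inverse_conjugacy)
  show ?thesis
    by (rule affine_weak_star_homeomorphismI[where g = "\<lambda>\<omega>. \<omega> \<circ> comp_op \<phi>'"])
      (auto simp: assms[unfolded comp_def] comp_def comp_op_inverse inverse.comp_op_inverse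
        intro!: continuous_on_subset[OF continuous_on_product_coordinates])
qed

end


text \<open>The lift is the inverse of \<psi> followed by \<open>f\<close> and \<psi>'.\<close>

lemma lifts_along_exists:
  assumes \<psi>: "affine_weak_star_homeomorphism S K \<psi>" and \<psi>': "affine_weak_star_homeomorphism S' K' \<psi>'"
    and f: "affine_weak_star_homeomorphism S S' f"
    and convex: "\<And>\<tau> \<omega> t. \<tau> \<in> S \<Longrightarrow> \<omega> \<in> S \<Longrightarrow> t \<in> {0..1} \<Longrightarrow>
      (\<lambda>a. of_real t * \<tau> a + of_real (1 - t) * \<omega> a) \<in> S"
  shows "\<exists>\<Phi>. lifts_along S K \<psi> S' K' \<psi>' f \<Phi>"
proof -
  obtain g g' h where g: "homeomorphism S K \<psi> g" and g': "homeomorphism S' K' \<psi>' g'" and h: "homeomorphism S S' f h"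
    using assms(1-3) unfolding affine_weak_star_homeomorphism_def by blast
  note affine = assms(1-3)[unfolded affine_weak_star_homeomorphism_def, THEN conjunct2, rule_format]
  define \<Phi> where "\<Phi> = \<psi>' \<circ> (f \<circ> g)"
  have gS: "g \<omega> \<in> S" "\<psi> (g \<omega>) = \<omega>" if "\<omega> \<in> K" for \<omega>
    using g that by (auto simp: homeomorphism_def)
  have fS: "f \<tau> \<in> S'" if "\<tau> \<in> S" for \<tau>
    using h that by (auto simp: homeomorphism_def)
  have "homeomorphism K K' \<Phi> (\<psi> \<circ> h \<circ> g')"
    using homeomorphism_compose[OF homeomorphism_compose[OF homeomorphism_symD[OF g] h] g']
    by (simp add: \<Phi>_def comp_def)
  moreover have "\<Phi> (\<lambda>x. of_real t * \<omega> x + of_real (1 - t) * \<omega>' x) =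
      (\<lambda>y. of_real t * \<Phi> \<omega> y + of_real (1 - t) * \<Phi> \<omega>' y)"
    if "\<omega> \<in> K" "\<omega>' \<in> K" "t \<in> {0..1}" for \<omega> \<omega>' and t :: real
  proof -
    \<comment> \<open>Affinity of the inverse \<open>g\<close> relies on convexity of
      \<open>S\<close>: the combination of preimages must itself lie in the domain of
      \<psi>.\<close>
    let ?m = "\<lambda>a. of_real t * g \<omega> a + of_real (1 - t) * g \<omega>' a"
    have "\<psi> ?m = (\<lambda>x. of_real t * \<omega> x + of_real (1 - t) * \<omega>' x)"
      using affine(1)[OF gS(1)[OF that(1)] gS(1)[OF that(2)] that(3)] by (simp only: gS(2) that)
    then have "g (\<lambda>x. of_real t * \<omega> x + of_real (1 - t) * \<omega>' x) = ?m"
      using g convex[OF gS(1)[OF that(1)] gS(1)[OF that(2)] that(3)] by (metis homeomorphism_apply1)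
    then show ?thesis
      using affine(3)[OF gS(1)[OF that(1)] gS(1)[OF that(2)] that(3)]
        affine(2)[OF fS[OF gS(1)[OF that(1)]] fS[OF gS(1)[OF that(2)]] that(3)]
      by (simp only: \<Phi>_def comp_def)
  qed
  ultimately have "affine_weak_star_homeomorphism K K' \<Phi>"
    unfolding affine_weak_star_homeomorphism_def by blast
  moreover have "\<Phi> (\<psi> \<tau>) = \<psi>' (f \<tau>)" if "\<tau> \<in> S" for \<tau>
    using homeomorphism_apply1[OF g that] by (simp add: \<Phi>_def)
  ultimately have "lifts_along S K \<psi> S' K' \<psi>' f \<Phi>"
    using assms(1-3) unfolding lifts_along_def by blast
  then show ?thesis
    by blast
qed

theorem corollary4p3:
  fixes \<sigma> :: "'n::finite \<Rightarrow> 'x::t2_space \<Rightarrow> 'x"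
    and \<rho> :: "'n \<Rightarrow> 'y::t2_space \<Rightarrow> 'y"
    and \<phi> :: "'x \<Rightarrow> 'y"
    and \<iota>A :: "('x \<Rightarrow>\<^sub>C complex) \<Rightarrow> 'ta::cstar_algebra" and VA :: "'n \<Rightarrow> 'ta"
    and \<iota>C :: "('y \<Rightarrow>\<^sub>C complex) \<Rightarrow> 'tc::cstar_algebra" and VC :: "'n \<Rightarrow> 'tc"
    and qA :: "'ta \<Rightarrow> 'oa::cstar_algebra" and qC :: "'tc \<Rightarrow> 'oc::cstar_algebra"
    and \<beta> :: real
  assumes "compact (UNIV :: 'x set)" and "compact (UNIV :: 'y set)"
    and "\<And>i. continuous_on UNIV (\<sigma> i)" and "\<And>i. continuous_on UNIV (\<rho> i)"
    and "piecewise_conjugate \<sigma> \<rho> \<phi>"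
    and "toeplitz_algebra (classical_system \<sigma>) \<iota>A VA"
    and "toeplitz_algebra (classical_system \<rho>) \<iota>C VC"
    and "cuntz_pimsner_quotient (classical_system \<sigma>) \<iota>A VA qA"
    and "cuntz_pimsner_quotient (classical_system \<rho>) \<iota>C VC qC"
  shows
    "(\<beta> > ln (real CARD('n)) \<longrightarrow>
       (let \<psi>A = kms_of_state (classical_system \<sigma>) \<iota>A VA \<beta>;
            \<psi>C = kms_of_state (classical_system \<rho>) \<iota>C VC \<beta> in
        (\<exists>\<Phi>. lifts_along states (kms_states (gauge_flow \<iota>A VA) \<beta>) \<psi>A
                states (kms_states (gauge_flow \<iota>C VC) \<beta>) \<psi>C (\<lambda>\<tau>. \<tau> \<circ> comp_op \<phi>) \<Phi>) \<and>
        (\<forall>\<tau>\<in>states. \<forall>c \<mu> \<nu>.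
           \<psi>C (\<tau> \<circ> comp_op \<phi>) (word_prod VC \<mu> * \<iota>C c * star (word_prod VC \<nu>)) =
           \<psi>A \<tau> (word_prod VA \<mu> * \<iota>A (comp_op \<phi> c) * star (word_prod VA \<nu>)))))
   \<and>
     (\<beta> > ln (real CARD('n)) \<longrightarrow>
       (let SA = qA \<circ> VA; SC = qC \<circ> VC;
            TA = {\<tau>\<in>states. \<forall>a\<in>J_ideal (classical_system \<sigma>). \<tau> a = 0};
            TC = {\<tau>\<in>states. \<forall>c\<in>J_ideal (classical_system \<rho>). \<tau> c = 0};
            \<phi>A = kms_of_state (classical_system \<sigma>) (qA \<circ> \<iota>A) SA \<beta>;
            \<phi>C = kms_of_state (classical_system \<rho>) (qC \<circ> \<iota>C) SC \<beta> in
        (\<exists>\<Phi>. lifts_along TA (kms_states (gauge_flow (qA \<circ> \<iota>A) SA) \<beta>) \<phi>A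
                TC (kms_states (gauge_flow (qC \<circ> \<iota>C) SC) \<beta>) \<phi>C (\<lambda>\<tau>. \<tau> \<circ> comp_op \<phi>) \<Phi>) \<and>
        (\<forall>\<tau>\<in>TA. \<forall>c \<mu> \<nu>.
           \<phi>C (\<tau> \<circ> comp_op \<phi>) (word_prod SC \<mu> * qC (\<iota>C c) * star (word_prod SC \<nu>)) =
           \<phi>A \<tau> (word_prod SA \<mu> * qA (\<iota>A (comp_op \<phi> c)) * star (word_prod SA \<nu>)))))
   \<and>
     (\<beta> = ln (real CARD('n)) \<and> \<beta> > 0 \<and>
        injective_system (classical_system \<sigma>) \<and> injective_system (classical_system \<rho>) \<longrightarrow>
       (let SA = qA \<circ> VA; SC = qC \<circ> VC;
            \<psi>A = critical_kms_of_state (classical_system \<sigma>) (qA \<circ> \<iota>A) SA;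
            \<psi>C = critical_kms_of_state (classical_system \<rho>) (qC \<circ> \<iota>C) SC in
        (\<exists>\<Phi>. lifts_along (AVT (classical_system \<sigma>)) (kms_states (gauge_flow (qA \<circ> \<iota>A) SA) \<beta>) \<psi>A
                (AVT (classical_system \<rho>)) (kms_states (gauge_flow (qC \<circ> \<iota>C) SC) \<beta>) \<psi>C (\<lambda>\<tau>. \<tau> \<circ> comp_op \<phi>) \<Phi>) \<and>
        (\<forall>\<tau>\<in>AVT (classical_system \<sigma>). \<forall>c \<mu> \<nu>.
           \<psi>C (\<tau> \<circ> comp_op \<phi>) (word_prod SC \<mu> * qC (\<iota>C c) * star (word_prod SC \<nu>)) =
           \<psi>A \<tau> (word_prod SA \<mu> * qA (\<iota>A (comp_op \<phi> c)) * star (word_prod SA \<nu>)))))"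
proof -
  interpret A: cp_quotient \<sigma> \<iota>A VA qA
    by unfold_locales (rule assms)+
  interpret C: cp_quotient \<rho> \<iota>C VC qC
    by unfold_locales (rule assms)+
  obtain \<phi>' where \<phi>': "homeomorphism UNIV UNIV \<phi> \<phi>'"
    using assms(5) unfolding piecewise_conjugate_def by blast
  interpret piecewise_conjugacy \<sigma> \<rho> \<phi> \<phi>'
  proof unfold_locales
    show "\<exists>\<pi>. bij \<pi> \<and> (\<forall>i. \<rho> i (\<phi> x) = \<phi> (\<sigma> (\<pi> i) x))" for x
      using assms(5) unfolding piecewise_conjugate_def by blast
  qed (rule \<phi>')
  \<comment> \<open>The reverse conjugacy shows that pulling back along \<open>\<phi>\<close> is
    onto each of the three parameter sets.\<close>
  interpret inverse: piecewise_conjugacy \<rho> \<sigma> \<phi>' \<phi>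
    by (rule inverse_conjugacy)
  let ?f = "\<lambda>\<tau>. \<tau> \<circ> comp_op \<phi>"
  let ?TA = "{\<tau>\<in>states. \<forall>a\<in>J_ideal (classical_system \<sigma>). \<tau> a = 0}"
  let ?TC = "{\<tau>\<in>states. \<forall>c\<in>J_ideal (classical_system \<rho>). \<tau> c = 0}"
  have quotient: "?f \<tau> \<in> ?TC" if "\<tau> \<in> ?TA" for \<tau>
    using that states_comp_op comp_op_J_ideal by auto
  have quotient_inverse: "\<omega> \<circ> comp_op \<phi>' \<in> ?TA" if "\<omega> \<in> ?TC" for \<omega>
    using that inverse.states_comp_op inverse.comp_op_J_ideal by auto
  have quotient_convex: "(\<lambda>a. of_real t * \<tau> a + of_real (1 - t) * \<omega> a) \<in> ?TA"
    if "\<tau> \<in> ?TA" "\<omega> \<in> ?TA" "t \<in> {0..1}" for \<tau> \<omega> and t :: real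
    using that states_convex[of \<tau> \<omega> t] by simp
  note elem = A.elem_def C.elem_def A.cp.elem_def C.cp.elem_def o_apply
  show ?thesis
    unfolding Let_def
  proof (intro conjI impI ballI allI, goal_cases)
    case 1
    show ?case
      by (rule lifts_along_exists[OF A.toeplitz_parametrization(1)[OF 1] C.toeplitz_parametrization(1)[OF 1]
            pullback_homeomorphism[OF states_comp_op inverse.states_comp_op] states_convex])
  next
    case (2 \<tau> c \<mu> \<nu>)
    show ?case
      using A.toeplitz_parametrization(2)[OF 2, of \<mu> "comp_op \<phi> c" \<nu>]
        C.toeplitz_parametrization(2)[OF 2(1) states_comp_op[OF 2(2)], of \<mu> c \<nu>]
      by (simp only: elem kms_value_comp_op)
  next
    case 3
    show ?case
      by (rule lifts_along_exists[OF A.quotient_parametrization(1)[OF 3] C.quotient_parametrization(1)[OF 3]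
            pullback_homeomorphism[OF quotient quotient_inverse] quotient_convex])
  next
    case (4 \<tau> c \<mu> \<nu>)
    show ?case
      using A.quotient_parametrization(2)[OF 4, of \<mu> "comp_op \<phi> c" \<nu>]
        C.quotient_parametrization(2)[OF 4(1) quotient[OF 4(2)], of \<mu> c \<nu>]
      by (simp only: elem kms_value_comp_op)
  next
    case 5
    then have \<beta>: "\<beta> = ln (real CARD('n))" "\<beta> > 0"
      and inj: "injective_system (classical_system \<sigma>)" "injective_system (classical_system \<rho>)"
      by blast+
    note pos = \<beta>(2)[unfolded \<beta>(1)]
    show ?case
      unfolding \<beta>(1)
      by (rule lifts_along_exists[OF A.critical_quotient_parametrization(1)[OF pos inj(1)]
            C.critical_quotient_parametrization(1)[OF pos inj(2)]
            pullback_homeomorphism[OF AVT_comp_op inverse.AVT_comp_op] A.AVT_convex])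
  next
    case (6 \<tau> c \<mu> \<nu>)
    then have \<beta>: "\<beta> = ln (real CARD('n))" "\<beta> > 0"
      and inj: "injective_system (classical_system \<sigma>)" "injective_system (classical_system \<rho>)"
      by blast+
    note pos = \<beta>(2)[unfolded \<beta>(1)]
    \<comment> \<open>The critical values involve \<tau> alone; \<open>transfer\<close> enters
      through \<open>AVT_comp_op\<close>.\<close>
    show ?case
      using A.critical_quotient_parametrization(2)[OF pos inj(1) 6(2), of \<mu> "comp_op \<phi> c" \<nu>]
        C.critical_quotient_parametrization(2)[OF pos inj(2) AVT_comp_op[OF 6(2)], of \<mu> c \<nu>]
      by (simp only: elem)
  qed
qed

end
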